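(* Let $\vec\mu=(\mu_1,\mu_2)$ be an Angelesco system, let $\vec\kappa\in\mathbb R^2$ with $\kappa_1+\kappa_2=1$, and let $\mathcal J_{\vec\kappa}$ be the corresponding Jacobi matrix on the infinite rooted binary tree. Then $$\sigma(\mathcal J_{\vec\kappa})\subseteq\Delta_1\cup\Delta_2\cup E_{\vec\varkappa}.$$ Furthermore, if $\operatorname{supp}\mu_k=\Delta_k$ for each $k\in\{1,2\}$, then this inclusion is an equality.
   Context: Angelesco system: $\mu_1,\mu_2$ are finite positive Borel measures on $\mathbb R$ with compact supports of infinite cardinality, $\Delta_i$ is the convex hull of $\operatorname{supp}\mu_i$ (a compact interval), and $\Delta_1\cap\Delta_2=\varnothing$ (the paper labels them so that $\Delta_1$ lies to the left of $\Delta_2$). $\|\mu_k\|=\mu_k(\mathbb R)$, $\widehat\mu_k(z)=\int\frac{d\mu_k(x)}{z-x}$. For $\vec n=(n_1,n_2)\in\mathbb Z_+^2$, $P_{\vec n}$ is the monic polynomial of degree $|\vec n|=n_1+n_2$ with $\int P_{\vec n}(x)x^md\mu_k(x)=0$ for $0\le m<n_k$, $k=1,2$ (it exists and is unique for Angelesco systems). There are uniformly bounded real recurrence coefficients with $xP_{\vec n}=P_{\vec n+\vec e_i}+b_{\vec n,i}P_{\vec n}+a_{\vec n,1}P_{\vec n-\vec e_1}+a_{\vec n,2}P_{\vec n-\vec e_2}$, $\vec n\in\mathbb Z_+^2$, $i\in\{1,2\}$ ($\vec e_1=(1,0)$, $\vec e_2=(0,1)$; terms with negative indices are $0$), and $a_{\vec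 n,i}>0$ for $\vec n\in\mathbb N^2$. $\mathcal V$ is the vertex set of the infinite rooted binary tree with root $O$: each $Y$ has two children $Y_{(ch),1},Y_{(ch),2}$; $Y_{(p)}$ is the parent of $Y\ne O$. $\Pi(O)=(1,1)$, $\Pi(Y_{(ch),i})=\Pi(Y)+\vec e_i$; $\iota_Y=i$ if $Y$ is the $i$-th child of its parent. $V_O=\kappa_1b_{(0,1),1}+\kappa_2b_{(1,0),2}$, $W_O=1$; $V_Y=b_{\Pi(Y_{(p)}),\iota_Y}$, $W_Y=a_{\Pi(Y_{(p)}),\iota_Y}>0$ for $Y\neq O$. With $f_{O_{(p)}}:=0$, $$(\mathcal J_{\vec\kappa}f)_Y=V_Yf_Y+W_Y^{1/2}f_{Y_{(p)}}+W_{Y_{(ch),1}}^{1/2}f_{Y_{(ch),1}}+W_{Y_{(ch),2}}^{1/2}f_{Y_{(ch),2}},$$ a bounded self-adjoint operator on $\ell^2(\mathcal V)$. $\vec\varkappa=(\varkappa_1,\varkappa_2)=(\kappa_2,\kappa_1)$, $L_{\vec\varkappa}(z)=\varkappa_1\|\mu_1\|^{-1}\widehat\mu_1(z)+\varkappa_2\|\mu_2\|^{-1}\widehat\mu_2(z)$, and $E_{\vec\varkappa}=\{E\in\mathbb R\setminus(\Delta_1\cup\Delta_2):L_{\vec\varkappa}(E)=0\}$. *)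

theory Defs
  imports "HOL-Analysis.Analysis"
begin

definition measure_supp :: "real measure \<Rightarrow> real set" where
  "measure_supp M = {x. \<forall>U. open U \<longrightarrow> x \<in> U \<longrightarrow> emeasure M U > 0}"

text \<open>Pairs are indexed by the two-element type \<^typ>\<open>2\<close>, whose elements are \<open>1\<close> and
  \<open>2\<close>; multi-indices are vectors in \<^typ>\<open>nat^2\<close>, with unit vectors \<open>axis i 1\<close>.\<close>

definition Delta :: "(2 \<Rightarrow> real measure) \<Rightarrow> 2 \<Rightarrow> real set" where
  "Delta \<mu> i = convex hull (measure_supp (\<mu> i))"

definition angelesco :: "(2 \<Rightarrow> real measure) \<Rightarrow> bool" where
  "angelesco \<mu> \<longleftrightarrow>
     (\<forall>i. finite_measure (\<mu> i) \<and> sets (\<mu> i) = sets borel \<and>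
          compact (measure_supp (\<mu> i)) \<and> infinite (measure_supp (\<mu> i))) \<and>
     Delta \<mu> 1 \<inter> Delta \<mu> 2 = {}"

definition stieltjes :: "real measure \<Rightarrow> complex \<Rightarrow> complex" where
  "stieltjes M z = (\<integral>x. 1 / (z - complex_of_real x) \<partial>M)"

definition mop :: "(2 \<Rightarrow> real measure) \<Rightarrow> nat^2 \<Rightarrow> real poly" where
  "mop \<mu> n = (THE p. lead_coeff p = 1 \<and> degree p = n $ 1 + n $ 2 \<and>
     (\<forall>k. \<forall>m < n $ k. (\<integral>x. poly p x * x ^ m \<partial>\<mu> k) = 0))"

text \<open>Since subtraction on \<^typ>\<open>nat\<close> truncates, the convention that polynomials with a
  negative index vanish is made explicit.\<close>

definition mop_pred :: "(2 \<Rightarrow> real measure) \<Rightarrow> nat^2 \<Rightarrow> 2 \<Rightarrow> real poly" where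
  "mop_pred \<mu> n j = (if n $ j = 0 then 0 else mop \<mu> (n - axis j 1))"

text \<open>The coefficient \<open>a $ j\<close> is not determined by the recurrence when \<open>n $ j = 0\<close>; it is then
  set to \<open>0\<close>, so that the pair \<open>(a, b)\<close> is unique. These values do not enter the
  Jacobi matrix.\<close>

definition recurrence_coeffs :: "(2 \<Rightarrow> real measure) \<Rightarrow> nat^2 \<Rightarrow> (real^2) \<times> (real^2)" where
  "recurrence_coeffs \<mu> n = (THE (a, b).
     (\<forall>i. [:0, 1:] * mop \<mu> n =
            mop \<mu> (n + axis i 1) + smult (b $ i) (mop \<mu> n)
            + smult (a $ 1) (mop_pred \<mu> n 1) + smult (a $ 2) (mop_pred \<mu> n 2)) \<and>
     (\<forall>j. n $ j = 0 \<longrightarrow> a $ j = 0))"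

definition rec_a :: "(2 \<Rightarrow> real measure) \<Rightarrow> nat^2 \<Rightarrow> 2 \<Rightarrow> real" where
  "rec_a \<mu> n i = fst (recurrence_coeffs \<mu> n) $ i"

definition rec_b :: "(2 \<Rightarrow> real measure) \<Rightarrow> nat^2 \<Rightarrow> 2 \<Rightarrow> real" where
  "rec_b \<mu> n i = snd (recurrence_coeffs \<mu> n) $ i"

datatype vertex = Root | Child vertex "2"

primrec proj :: "vertex \<Rightarrow> nat^2" where
  "proj Root = vector [1, 1]"
| "proj (Child Y i) = proj Y + axis i 1"

primrec potential :: "(2 \<Rightarrow> real measure) \<Rightarrow> real^2 \<Rightarrow> vertex \<Rightarrow> real" where
  "potential \<mu> \<kappa> Root =
     \<kappa> $ 1 * rec_b \<mu> (vector [0, 1]) 1 + \<kappa> $ 2 * rec_b \<mu> (vector [1, 0]) 2"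
| "potential \<mu> \<kappa> (Child Y i) = rec_b \<mu> (proj Y) i"

primrec weight :: "(2 \<Rightarrow> real measure) \<Rightarrow> vertex \<Rightarrow> real" where
  "weight \<mu> Root = 1"
| "weight \<mu> (Child Y i) = rec_a \<mu> (proj Y) i"

primrec at_parent :: "(vertex \<Rightarrow> complex) \<Rightarrow> vertex \<Rightarrow> complex" where
  "at_parent f Root = 0"
| "at_parent f (Child Y i) = f Y"

definition jacobi :: "(2 \<Rightarrow> real measure) \<Rightarrow> real^2 \<Rightarrow> (vertex \<Rightarrow> complex) \<Rightarrow> vertex \<Rightarrow> complex" where
  "jacobi \<mu> \<kappa> f Y =
     of_real (potential \<mu> \<kappa> Y) * f Y
     + of_real (sqrt (weight \<mu> Y)) * at_parent f Y
     + of_real (sqrt (weight \<mu> (Child Y 1))) * f (Child Y 1)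
     + of_real (sqrt (weight \<mu> (Child Y 2))) * f (Child Y 2)"

definition ell2 :: "('v \<Rightarrow> complex) set" where
  "ell2 = {f. (\<lambda>v. (cmod (f v))\<^sup>2) summable_on UNIV}"

definition ell2_norm :: "('v \<Rightarrow> complex) \<Rightarrow> real" where
  "ell2_norm f = sqrt (\<Sum>\<^sub>\<infinity>v. (cmod (f v))\<^sup>2)"

text \<open>The complement of the resolvent set: \<open>z\<close> is in the spectrum of \<open>A\<close> unless
  \<open>A - z\<close> maps \<^const>\<open>ell2\<close> bijectively onto itself with a bounded inverse.\<close>

definition ell2_spectrum :: "(('v \<Rightarrow> complex) \<Rightarrow> ('v \<Rightarrow> complex)) \<Rightarrow> complex set" where
  "ell2_spectrum A = {z. \<not>
     (bij_betw (\<lambda>f v. A f v - z * f v) ell2 ell2 \<and>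
      (\<exists>C. \<forall>f \<in> ell2. ell2_norm f \<le> C * ell2_norm (\<lambda>v. A f v - z * f v)))}"

definition L_fun :: "(2 \<Rightarrow> real measure) \<Rightarrow> real^2 \<Rightarrow> complex \<Rightarrow> complex" where
  "L_fun \<mu> c z =
     of_real (c $ 1 / measure (\<mu> 1) UNIV) * stieltjes (\<mu> 1) z
     + of_real (c $ 2 / measure (\<mu> 2) UNIV) * stieltjes (\<mu> 2) z"

definition E_set :: "(2 \<Rightarrow> real measure) \<Rightarrow> real^2 \<Rightarrow> real set" where
  "E_set \<mu> c = {E. E \<notin> Delta \<mu> 1 \<union> Delta \<mu> 2 \<and> L_fun \<mu> c (of_real E) = 0}"

end

theory Submission
  imports Defs "HOL-Complex_Analysis.Complex_Analysis"
begin

text \<open>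
  The functions \<open>L n z = \<Sum>k. \<integral> A n k x / (z - x) d\<mu> k x\<close> of the type I forms satisfy the recurrence
  of the Jacobi matrix everywhere except at the root, where the defect is \<open>L\<kappa>\<close>. They have no zeros
  off the two intervals, so cutting them off at subtrees yields resolvent kernels that are analytic
  off \<open>K = \<Delta>1 \<union> \<Delta>2 \<union> E\<close>. For a real point \<open>E\<close> at distance \<open>\<delta>\<close> from \<open>K\<close> these kernels generate the moments
  of \<open>S = M - (J - E)\<^sup>2\<close>, which therefore grow at most like \<open>(M - \<delta>\<^sup>2)^n\<close>; as \<open>S\<close> is symmetric, this
  bounds its norm and makes \<open>J - E\<close> invertible. In particular no a priori bound on the recurrence
  coefficients is used: the boundedness of \<open>J\<close> comes out of the same moment estimate.

  Conversely, if a point of \<open>K\<close> were in the resolvent set, then \<open>L (1, 1) / L\<kappa>\<close> would be bounded and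
  Lipschitz near it off the real axis. At a zero of \<open>L\<kappa>\<close> this is absurd. On \<open>\<Delta>k\<close> this quotient is a
  Mobius transform of the ratio of the two Stieltjes transforms, so that the Stieltjes transform of
  \<open>\<mu> k\<close> would be real in the limit on some interval, which therefore could not meet the support.\<close>

text \<open>The kernels \<open>u\<close> are at first only formal: they solve the resolvent equation
  entry by entry, with no square-summability. What ties them to the operator is analyticity together
  with decay at infinity, since the Taylor coefficients are then forced to be matrix entries of
  powers. Passing to the square is dictated by discs: a gap of \<open>K\<close> around
  \<open>E\<close> cannot be seen by an expansion in \<open>J\<close> itself, whereas
  \<open>M - (x - E)\<^sup>2\<close> maps \<open>K\<close> into
  \<open>[0, M - \<delta>\<^sup>2]\<close>, a set separated from \<open>M\<close> by a circle around
  0.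

  Zero-freeness of \<open>L n\<close> is an orthogonality effect. A polynomial \<open>q\<close> of
  degree less than \<open>|n|\<close> can be pulled out of the Cauchy transform, and
  \<open>q\<close> can be chosen to cancel the sign changes of both components, so
  \<open>q z * L n z\<close> becomes the integral of a one-signed function. The combination
  \<open>L\<kappa>\<close> lacks one orthogonality relation; the argument survives only off the real
  axis, and real zeros do occur: they form \<open>E\<close>.

  In the converse, kernels commute with conjugation, so a Lipschitz bound across the axis makes
  imaginary parts \<open>O(|Im z|)\<close>. The base point must not be an atom, because near an atom
  the Stieltjes transform grows like \<open>1 / |Im z|\<close> and the Mobius map might not be
  invertible.\<close>

unbundle no Formal_Power_Series.fps_syntax

section \<open>Square-summable functions\<close>

lemma L2_set_cmod_le_ell2_norm:
  assumes "f \<in> ell2" "finite F"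
  shows "L2_set (\<lambda>v. cmod (f v)) F \<le> ell2_norm f"
proof -
  have "(\<Sum>v\<in>F. (cmod (f v))\<^sup>2) \<le> (\<Sum>\<^sub>\<infinity>v. (cmod (f v))\<^sup>2)"
    using assms by (intro finite_sum_le_infsum) (auto simp: ell2_def)
  then show ?thesis unfolding L2_set_def ell2_norm_def by simp
qed

lemma ell2_norm_nonneg [simp]: "ell2_norm f \<ge> 0"
  unfolding ell2_norm_def by (simp add: infsum_nonneg)

lemma ell2I:
  assumes "\<And>F. finite F \<Longrightarrow> L2_set (\<lambda>v. cmod (f v)) F \<le> B"
  shows "f \<in> ell2" "ell2_norm f \<le> B"
proof -
  have B: "B \<ge> 0" using assms[of "{}"] by simp
  have le: "(\<Sum>v\<in>F. (cmod (f v))\<^sup>2) \<le> B\<^sup>2" if "finite F" for F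
    using assms[OF that] unfolding L2_set_def by (simp add: sqrt_le_D)
  show f: "f \<in> ell2"
    unfolding ell2_def mem_Collect_eq
    by (rule nonneg_bdd_above_summable_on) (auto intro!: bdd_aboveI[of _ "B\<^sup>2"] le)
  have "(\<Sum>\<^sub>\<infinity>v. (cmod (f v))\<^sup>2) \<le> B\<^sup>2"
    using f le by (intro infsum_le_finite_sums) (auto simp: ell2_def)
  then show "ell2_norm f \<le> B"
    unfolding ell2_norm_def using B by (simp add: real_le_lsqrt infsum_nonneg)
qed

lemma cmod_le_ell2_norm: "f \<in> ell2 \<Longrightarrow> cmod (f v) \<le> ell2_norm f"
  using L2_set_cmod_le_ell2_norm[of f "{v}"] by simp

lemma ell2_add:
  assumes "f \<in> ell2" "g \<in> ell2"
  shows "(\<lambda>v. f v + g v) \<in> ell2" "ell2_norm (\<lambda>v. f v + g v) \<le> ell2_norm f + ell2_norm g"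
proof -
  have "L2_set (\<lambda>v. cmod (f v + g v)) F \<le> ell2_norm f + ell2_norm g" if "finite F" for F
  proof -
    have "L2_set (\<lambda>v. cmod (f v + g v)) F \<le> L2_set (\<lambda>v. cmod (f v) + cmod (g v)) F"
      by (intro L2_set_mono) (auto intro: norm_triangle_ineq)
    also have "\<dots> \<le> L2_set (\<lambda>v. cmod (f v)) F + L2_set (\<lambda>v. cmod (g v)) F"
      by (rule L2_set_triangle_ineq)
    also have "\<dots> \<le> ell2_norm f + ell2_norm g"
      using assms that by (intro add_mono L2_set_cmod_le_ell2_norm)
    finally show ?thesis .
  qed
  from ell2I[OF this] show "(\<lambda>v. f v + g v) \<in> ell2"
    "ell2_norm (\<lambda>v. f v + g v) \<le> ell2_norm f + ell2_norm g" by auto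
qed

lemma ell2_scale:
  assumes "f \<in> ell2" shows "(\<lambda>v. c * f v) \<in> ell2"
proof (rule ell2I(1))
  fix F :: "'a set" assume "finite F"
  then show "L2_set (\<lambda>v. cmod (c * f v)) F \<le> cmod c * ell2_norm f"
    using L2_set_cmod_le_ell2_norm[OF assms]
    by (simp add: norm_mult L2_set_right_distrib[symmetric] mult_left_mono)
qed

lemma ell2_norm_scale: "ell2_norm (\<lambda>v. c * f v) = cmod c * ell2_norm f"
proof -
  have "(\<Sum>\<^sub>\<infinity>v. (cmod (c * f v))\<^sup>2) = (cmod c)\<^sup>2 * (\<Sum>\<^sub>\<infinity>v. (cmod (f v))\<^sup>2)"
    by (simp add: norm_mult power_mult_distrib infsum_cmult_right')
  then show ?thesis unfolding ell2_norm_def by (simp add: real_sqrt_mult)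
qed

lemma ell2_diff:
  assumes "f \<in> ell2" "g \<in> ell2"
  shows "(\<lambda>v. f v - g v) \<in> ell2" "ell2_norm (\<lambda>v. f v - g v) \<le> ell2_norm f + ell2_norm g"
  using ell2_add[OF assms(1) ell2_scale[OF assms(2), of "-1"]] ell2_norm_scale[of "-1" g]
  by simp_all

lemma ell2_eq_0:
  assumes "f \<in> ell2" "ell2_norm f \<le> 0" shows "f = (\<lambda>v. 0)"
proof
  fix v show "f v = 0" using cmod_le_ell2_norm[OF assms(1), of v] assms(2)
    by (metis norm_le_zero_iff order_trans)
qed

lemma finite_support_ell2:
  assumes "finite F" "{v. f v \<noteq> 0} \<subseteq> F"
  shows "f \<in> ell2" "(ell2_norm f)\<^sup>2 = (\<Sum>v\<in>F. (cmod (f v))\<^sup>2)"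
proof -
  have hs: "((\<lambda>v. (cmod (f v))\<^sup>2) has_sum (\<Sum>v\<in>F. (cmod (f v))\<^sup>2)) UNIV"
    by (rule has_sum_finite_neutralI) (use assms in auto)
  show "f \<in> ell2" using hs unfolding ell2_def by (auto simp: summable_on_def)
  have "(\<Sum>\<^sub>\<infinity>v. (cmod (f v))\<^sup>2) = (\<Sum>v\<in>F. (cmod (f v))\<^sup>2)" using hs by (simp add: infsumI)
  then show "(ell2_norm f)\<^sup>2 = (\<Sum>v\<in>F. (cmod (f v))\<^sup>2)"
    unfolding ell2_norm_def by (simp add: sum_nonneg)
qed

lemma ell2_sum:
  assumes "finite A" "\<And>i. i \<in> A \<Longrightarrow> h i \<in> ell2"
  shows "(\<lambda>v. \<Sum>i\<in>A. h i v) \<in> ell2 \<and> ell2_norm (\<lambda>v. \<Sum>i\<in>A. h i v) \<le> (\<Sum>i\<in>A. ell2_norm (h i))"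
  using assms
proof (induction A rule: finite_induct)
  case empty
  show ?case using finite_support_ell2[where f = "\<lambda>v. \<Sum>i\<in>{}. h i v" and F = "{}"] by auto
next
  case (insert i A)
  have "(\<lambda>v. \<Sum>i\<in>A. h i v) \<in> ell2" "ell2_norm (\<lambda>v. \<Sum>i\<in>A. h i v) \<le> (\<Sum>i\<in>A. ell2_norm (h i))"
    "h i \<in> ell2" using insert by auto
  with ell2_add[of "h i" "\<lambda>v. \<Sum>i\<in>A. h i v"] show ?case using insert(1,2) by auto
qed

lemma ell2_series:
  assumes h: "\<And>n. h n \<in> ell2" and le: "\<And>n. ell2_norm (h n) \<le> C * r ^ n" and r: "0 \<le> r" "r < 1"
  shows "summable (\<lambda>n. h n v)" "(\<lambda>v. \<Sum>n. h n v) \<in> ell2"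
proof -
  have summ: "summable (\<lambda>n. h n v)" for v
  proof (rule summable_comparison_test')
    show "summable (\<lambda>n. C * r ^ n)" using r by (intro summable_mult summable_geometric) auto
    show "norm (h n v) \<le> C * r ^ n" for n
      using cmod_le_ell2_norm[OF h, of n v] le[of n] by linarith
  qed
  then show "summable (\<lambda>n. h n v)" .
  have C: "C \<ge> 0" using order_trans[OF ell2_norm_nonneg le[of 0]] by simp
  have "L2_set (\<lambda>v. cmod (\<Sum>n. h n v)) F \<le> C / (1 - r)" if F: "finite F" for F
  proof (rule LIMSEQ_le_const2)
    show "(\<lambda>m. L2_set (\<lambda>v. cmod (\<Sum>n<m. h n v)) F) \<longlonglongrightarrow> L2_set (\<lambda>v. cmod (\<Sum>n. h n v)) F"
      unfolding L2_set_def by (intro tendsto_intros summable_LIMSEQ summ)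
    have "L2_set (\<lambda>v. cmod (\<Sum>n<m. h n v)) F \<le> C / (1 - r)" for m
    proof -
      have *: "(\<lambda>v. \<Sum>n<m. h n v) \<in> ell2" "ell2_norm (\<lambda>v. \<Sum>n<m. h n v) \<le> (\<Sum>n<m. ell2_norm (h n))"
        using ell2_sum[of "{..<m}" h] h by auto
      have "(\<Sum>n<m. ell2_norm (h n)) \<le> (\<Sum>n<m. C * r ^ n)" by (intro sum_mono le)
      also have "\<dots> = C * (\<Sum>n<m. r ^ n)" by (simp add: sum_distrib_left)
      also have "\<dots> \<le> C * (1 / (1 - r))"
      proof (intro mult_left_mono C)
        have "(\<Sum>n<m. r ^ n) \<le> (\<Sum>n. r ^ n)"
          using r by (intro sum_le_suminf summable_geometric) auto
        then show "(\<Sum>n<m. r ^ n) \<le> 1 / (1 - r)" using r by (simp add: suminf_geometric)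
      qed
      finally show ?thesis using * L2_set_cmod_le_ell2_norm[OF *(1) F] by auto
    qed
    then show "\<exists>N. \<forall>m\<ge>N. L2_set (\<lambda>v. cmod (\<Sum>n<m. h n v)) F \<le> C / (1 - r)" by blast
  qed
  from ell2I(1)[OF this] show "(\<lambda>v. \<Sum>n. h n v) \<in> ell2" .
qed

text \<open>The sum runs over the support of \<open>f\<close> alone, so \<open>g\<close> may be
  arbitrary once \<open>f\<close> is finitely supported. Symmetry of an operator can thus be
  expressed before anything is known about square-summability of its values.\<close>

definition ip :: "('v \<Rightarrow> complex) \<Rightarrow> ('v \<Rightarrow> complex) \<Rightarrow> complex" where
  "ip f g = (\<Sum>v\<in>{v. f v \<noteq> 0}. f v * cnj (g v))"

lemma ip_eq: "finite F \<Longrightarrow> {v. f v \<noteq> 0} \<subseteq> F \<Longrightarrow> ip f g = (\<Sum>v\<in>F. f v * cnj (g v))"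
  unfolding ip_def by (rule sum.mono_neutral_left) auto

lemma ip_eq_right:
  assumes "finite {v. f v \<noteq> 0}" "finite F" "{v. g v \<noteq> 0} \<subseteq> F"
  shows "ip f g = (\<Sum>v\<in>F. f v * cnj (g v))"
proof -
  have "ip f g = (\<Sum>v\<in>F \<union> {v. f v \<noteq> 0}. f v * cnj (g v))"
    using assms by (intro ip_eq) auto
  also have "\<dots> = (\<Sum>v\<in>F. f v * cnj (g v))"
    using assms by (intro sum.mono_neutral_right) auto
  finally show ?thesis .
qed

lemma ip_self:
  assumes "finite {v. f v \<noteq> 0}" shows "ip f f = of_real ((ell2_norm f)\<^sup>2)"
  unfolding finite_support_ell2(2)[OF assms order_refl] ip_def
  by (simp add: complex_norm_square[symmetric])

lemma norm_ip_le:
  assumes "finite {v. f v \<noteq> 0}" "g \<in> ell2"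
  shows "cmod (ip f g) \<le> ell2_norm f * ell2_norm g"
proof -
  let ?F = "{v. f v \<noteq> 0}"
  have "cmod (ip f g) \<le> (\<Sum>v\<in>?F. cmod (f v) * cmod (g v))"
    unfolding ip_def by (rule sum_norm_le) (simp add: norm_mult)
  also have "\<dots> = (\<Sum>v\<in>?F. \<bar>cmod (f v)\<bar> * \<bar>cmod (g v)\<bar>)" by simp
  also have "\<dots> \<le> L2_set (\<lambda>v. cmod (f v)) ?F * L2_set (\<lambda>v. cmod (g v)) ?F"
    by (rule L2_set_mult_ineq)
  also have "\<dots> \<le> ell2_norm f * ell2_norm g"
    using assms finite_support_ell2[OF assms(1) order_refl]
    by (intro mult_mono L2_set_cmod_le_ell2_norm) auto
  finally show ?thesis .
qed

text \<open>By \<open>cvx\<close> the ratios of consecutive terms never decrease. If the first ratio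
  exceeded \<open>r\<close>, the sequence would dominate a geometric one of larger ratio, against
  the growth bound.\<close>

lemma log_convex_growth:
  fixes a :: "nat \<Rightarrow> real"
  assumes nn: "\<And>n. a n \<ge> 0" and cvx: "\<And>n. (a (Suc n))\<^sup>2 \<le> a n * a (Suc (Suc n))"
    and le: "\<And>n. a n \<le> C * r ^ n" and r: "r > 0"
  shows "a 1 \<le> r * a 0"
proof (rule ccontr)
  assume "\<not> a 1 \<le> r * a 0"
  then have gt: "a 1 > r * a 0" by simp
  have a0: "a 0 > 0"
  proof (rule ccontr)
    assume "\<not> a 0 > 0"
    then have "a 0 = 0" using nn[of 0] by simp
    then show False using cvx[of 0] gt by simp
  qed
  define q where "q = a 1 / a 0"
  have q: "q > r" using gt a0 unfolding q_def by (simp add: field_simps)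
  have step: "a n > 0 \<and> a (Suc n) \<ge> q * a n" for n
  proof (induction n)
    case 0 show ?case using a0 unfolding q_def by simp
  next
    case (Suc n)
    then have p: "a (Suc n) > 0" using q r by (smt (verit) mult_pos_pos)
    have "a (Suc n) * (q * a n) \<le> a (Suc n) * a (Suc n)"
      using Suc p by (intro mult_left_mono) auto
    also have "\<dots> \<le> a n * a (Suc (Suc n))" using cvx[of n] by (simp add: power2_eq_square)
    finally have "a n * (q * a (Suc n)) \<le> a n * a (Suc (Suc n))" by (simp add: mult_ac)
    then show ?case using p Suc by (auto dest: mult_left_le_imp_le)
  qed
  have ge: "a n \<ge> a 0 * q ^ n" for n
  proof (induction n)
    case (Suc n)
    have "a 0 * q ^ Suc n \<le> q * a n" using Suc q r by (simp add: mult.left_commute)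
    then show ?case using step[of n] by linarith
  qed simp
  have "a 0 * (q / r) ^ n \<le> C" for n
    using ge[of n] le[of n] r by (simp add: power_divide field_simps)
  moreover obtain n where "(C + 1) / a 0 < (q / r) ^ n"
    using real_arch_pow[of "q / r" "(C + 1) / a 0"] q r by (auto simp: less_divide_eq)
  ultimately show False using a0 by (smt (verit) divide_less_eq mult.commute)
qed

section \<open>Locally finite symmetric operators\<close>

definition ket :: "'v \<Rightarrow> 'v \<Rightarrow> complex" where
  "ket x = (\<lambda>v. if v = x then 1 else 0)"

lemma ket_support: "{v. ket x v \<noteq> 0} = {x}"
  by (auto simp: ket_def)

lemma ket_ell2: "ket x \<in> ell2"
  by (rule finite_support_ell2(1)[of "{x}"]) (auto simp: ket_def)

text \<open>The matrix of \<open>T\<close> has finite rows (\<open>loc\<close>), so \<open>T\<close>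
  acts on all functions, and finite columns (\<open>fin\<close>). Boundedness is not an axiom,
  because it is to be derived from the growth of moments.\<close>

locale local_symmetric =
  fixes T :: "('v \<Rightarrow> complex) \<Rightarrow> 'v \<Rightarrow> complex"
  assumes lin: "T (\<lambda>v. a * f v + b * g v) = (\<lambda>v. a * T f v + b * T g v)"
    and loc: "\<exists>N. finite N \<and> (\<forall>f g. (\<forall>x\<in>N. f x = g x) \<longrightarrow> T f y = T g y)"
    and fin: "finite {v. f v \<noteq> 0} \<Longrightarrow> finite {v. T f v \<noteq> 0}"
    and sym: "finite {v. f v \<noteq> 0} \<Longrightarrow> finite {v. g v \<noteq> 0} \<Longrightarrow> ip (T f) g = ip f (T g)"
begin

lemma T_add: "T (\<lambda>v. f v + g v) = (\<lambda>v. T f v + T g v)"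
  using lin[of 1 f 1 g] by simp

lemma T_diff: "T (\<lambda>v. f v - g v) = (\<lambda>v. T f v - T g v)"
  using lin[of 1 f "-1" g] by simp

lemma T_scale: "T (\<lambda>v. c * f v) = (\<lambda>v. c * T f v)"
  using lin[of c f 0 f] by simp

lemma T_zero: "T (\<lambda>v. 0) = (\<lambda>v. 0)"
  using lin[of 0 _ 0] by simp

lemma T_sum: "finite A \<Longrightarrow> T (\<lambda>v. \<Sum>i\<in>A. c i * h i v) = (\<lambda>v. \<Sum>i\<in>A. c i * T (h i) v)"
proof (induction A rule: finite_induct)
  case (insert i A)
  have "T (\<lambda>v. c i * h i v + 1 * (\<Sum>i\<in>A. c i * h i v))
      = (\<lambda>v. c i * T (h i) v + 1 * T (\<lambda>v. \<Sum>i\<in>A. c i * h i v) v)" by (rule lin)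
  then show ?case using insert by simp
qed (simp add: T_zero)

text \<open>Values outside \<open>N\<close> do not affect \<open>T f y\<close>, and on
  \<open>N\<close> the function is a finite combination of kets. This finite sum lets
  \<open>T\<close> commute with pointwise limits and with the extraction of power series
  coefficients.\<close>

lemma matrix_rep: "\<exists>N. finite N \<and> (\<forall>f. T f y = (\<Sum>x\<in>N. f x * T (ket x) y))"
proof -
  obtain N where N: "finite N" "\<And>f g. (\<forall>x\<in>N. f x = g x) \<Longrightarrow> T f y = T g y"
    using loc by blast
  have "T f y = (\<Sum>x\<in>N. f x * T (ket x) y)" for f
  proof -
    have "T f y = T (\<lambda>v. \<Sum>x\<in>N. f x * ket x v) y"
      by (rule N(2)) (auto simp: ket_def if_distrib N(1) cong: if_cong)
    then show ?thesis using T_sum[OF N(1), of f ket] by simp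
  qed
  with N(1) show ?thesis by blast
qed

lemma T_tendsto:
  assumes "\<And>x. ((\<lambda>i. f i x) \<longlongrightarrow> h x) F"
  shows "((\<lambda>i. T (f i) y) \<longlongrightarrow> T h y) F"
proof -
  obtain N where N: "finite N" "\<And>f. T f y = (\<Sum>x\<in>N. f x * T (ket x) y)"
    using matrix_rep by blast
  have "((\<lambda>i. \<Sum>x\<in>N. f i x * T (ket x) y) \<longlongrightarrow> (\<Sum>x\<in>N. h x * T (ket x) y)) F"
    by (intro tendsto_sum tendsto_mult assms tendsto_const)
  then show ?thesis by (simp only: N(2)[symmetric])
qed

text \<open>Finitely many values of \<open>T f\<close> depend on finitely many values of
  \<open>f\<close>, so every partial norm of \<open>T f\<close> is controlled by a truncation of
  \<open>f\<close>, whose norm is not larger.\<close>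

lemma bounded_extend:
  assumes C: "C \<ge> 0" and le: "\<And>f. finite {v. f v \<noteq> 0} \<Longrightarrow> ell2_norm (T f) \<le> C * ell2_norm f"
    and f: "f \<in> ell2"
  shows "T f \<in> ell2" "ell2_norm (T f) \<le> C * ell2_norm f"
proof -
  have "L2_set (\<lambda>v. cmod (T f v)) F \<le> C * ell2_norm f" if F: "finite F" for F
  proof -
    have "\<forall>y. \<exists>N. finite N \<and> (\<forall>f g. (\<forall>x\<in>N. f x = g x) \<longrightarrow> T f y = T g y)" using loc by blast
    then obtain N where N: "\<And>y. finite (N y)"
      "\<And>y f g. (\<forall>x\<in>N y. f x = g x) \<Longrightarrow> T f y = T g y" by metis
    define G where "G = (\<Union>y\<in>F. N y)"
    have G: "finite G" unfolding G_def using F N(1) by auto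
    define h where "h = (\<lambda>v. if v \<in> G then f v else 0)"
    have hs: "{v. h v \<noteq> 0} \<subseteq> G" by (auto simp: h_def)
    have hf: "finite {v. h v \<noteq> 0}" using hs G finite_subset by blast
    have eq: "T f y = T h y" if "y \<in> F" for y
      by (rule N(2)) (use that in \<open>auto simp: h_def G_def\<close>)
    have "L2_set (\<lambda>v. cmod (T f v)) F = L2_set (\<lambda>v. cmod (T h v)) F"
      by (rule L2_set_cong) (auto simp: eq)
    also have "\<dots> \<le> ell2_norm (T h)"
      by (intro L2_set_cmod_le_ell2_norm F finite_support_ell2(1)[OF fin[OF hf]]) auto
    also have "\<dots> \<le> C * ell2_norm h" by (rule le[OF hf])
    also have "ell2_norm h \<le> ell2_norm f"
    proof -
      have "(ell2_norm h)\<^sup>2 = (\<Sum>v\<in>G. (cmod (f v))\<^sup>2)"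
        using finite_support_ell2(2)[OF G hs] by (simp add: h_def)
      then have "ell2_norm h = L2_set (\<lambda>v. cmod (f v)) G"
        unfolding L2_set_def by (metis abs_of_nonneg ell2_norm_nonneg real_sqrt_abs)
      then show ?thesis using L2_set_cmod_le_ell2_norm[OF f G] by simp
    qed
    finally show ?thesis using C by (simp add: mult_left_mono)
  qed
  from ell2I[OF this] show "T f \<in> ell2" "ell2_norm (T f) \<le> C * ell2_norm f" by auto
qed

lemma pow_fin: "finite {v. f v \<noteq> 0} \<Longrightarrow> finite {v. (T ^^ n) f v \<noteq> 0}"
  by (induction n) (auto intro: fin)

lemma pow_sym:
  assumes "finite {v. f v \<noteq> 0}" "finite {v. g v \<noteq> 0}"
  shows "ip ((T ^^ n) f) g = ip f ((T ^^ n) g)"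
  using assms(2)
proof (induction n arbitrary: g)
  case (Suc n)
  have "ip ((T ^^ Suc n) f) g = ip ((T ^^ n) f) (T g)"
    using sym[OF pow_fin[OF assms(1)] Suc.prems] by simp
  also have "\<dots> = ip f ((T ^^ n) (T g))" by (rule Suc.IH[OF fin[OF Suc.prems]])
  finally show ?case by (simp add: funpow_swap1)
qed simp

lemma pow_sum: "finite A \<Longrightarrow>
  (T ^^ n) (\<lambda>v. \<Sum>i\<in>A. c i * h i v) = (\<lambda>v. \<Sum>i\<in>A. c i * (T ^^ n) (h i) v)"
  by (induction n) (auto simp: T_sum)

text \<open>Symmetry moves one factor \<open>T\<close> across: the square of the middle norm is the
  pairing of the two outer vectors, to which Cauchy-Schwarz applies.\<close>

lemma norm_pow_log_convex:
  assumes f: "finite {v. f v \<noteq> 0}"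
  shows "(ell2_norm ((T ^^ Suc n) f))\<^sup>2 \<le> ell2_norm ((T ^^ n) f) * ell2_norm ((T ^^ Suc (Suc n)) f)"
proof -
  note p = pow_fin[OF f]
  have "complex_of_real ((ell2_norm ((T ^^ Suc n) f))\<^sup>2) = ip (T ((T ^^ n) f)) ((T ^^ Suc n) f)"
    using ip_self[OF p[of "Suc n"]] by simp
  also have "\<dots> = ip ((T ^^ n) f) ((T ^^ Suc (Suc n)) f)" using sym[OF p[of n] p[of "Suc n"]] by simp
  finally have "(ell2_norm ((T ^^ Suc n) f))\<^sup>2 = cmod (ip ((T ^^ n) f) ((T ^^ Suc (Suc n)) f))"
    by (metis abs_of_nonneg norm_of_real zero_le_power2)
  also have "\<dots> \<le> ell2_norm ((T ^^ n) f) * ell2_norm ((T ^^ Suc (Suc n)) f)"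
    by (rule norm_ip_le[OF p finite_support_ell2(1)[OF p order_refl]])
  finally show ?thesis .
qed

text \<open>Moving \<open>n\<close> powers across the pairing turns the squared norm into the
  diagonal moment of order \<open>2 * n\<close>.\<close>

lemma norm_pow_ket_le:
  assumes "\<And>n. cmod ((T ^^ n) (ket x) x) \<le> C * r ^ n" "r > 0"
  shows "ell2_norm ((T ^^ n) (ket x)) \<le> sqrt C * r ^ n"
proof -
  have k: "finite {v. ket x v \<noteq> 0}" by (simp add: ket_support)
  note p = pow_fin[OF k]
  have "complex_of_real ((ell2_norm ((T ^^ n) (ket x)))\<^sup>2) = ip ((T ^^ n) (ket x)) ((T ^^ n) (ket x))"
    using ip_self[OF p[of n]] by simp
  also have "\<dots> = ip (ket x) ((T ^^ n) ((T ^^ n) (ket x)))" by (rule pow_sym[OF k p])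
  also have "\<dots> = cnj ((T ^^ (n + n)) (ket x) x)"
    unfolding funpow_add by (simp add: ip_def ket_support) (simp add: ket_def)
  finally have "(ell2_norm ((T ^^ n) (ket x)))\<^sup>2 = cmod ((T ^^ (n + n)) (ket x) x)"
    by (metis abs_of_nonneg norm_of_real zero_le_power2 complex_mod_cnj)
  also have "\<dots> \<le> C * r ^ (n + n)" by (rule assms(1))
  finally have "(ell2_norm ((T ^^ n) (ket x)))\<^sup>2 \<le> C * (r ^ n)\<^sup>2"
    by (simp add: power_add power2_eq_square)
  then have "ell2_norm ((T ^^ n) (ket x)) \<le> sqrt (C * (r ^ n)\<^sup>2)" by (rule real_le_rsqrt)
  then show ?thesis using assms(2) by (simp add: real_sqrt_mult)
qed

text \<open>For symmetric operators the growth rate of the diagonal moments is the norm: the norms of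
  \<open>(T ^^ n) f\<close> form a log-convex sequence.\<close>

lemma norm_le_of_moments:
  assumes mom: "\<And>x. \<exists>C. \<forall>n. cmod ((T ^^ n) (ket x) x) \<le> C * r ^ n" and r: "r > 0"
    and f: "finite {v. f v \<noteq> 0}"
  shows "ell2_norm (T f) \<le> r * ell2_norm f"
proof -
  obtain C where C: "\<And>x n. cmod ((T ^^ n) (ket x) x) \<le> C x * r ^ n" using mom by metis
  let ?A = "{v. f v \<noteq> 0}"
  have f_eq: "f = (\<lambda>v. \<Sum>x\<in>?A. f x * ket x v)"
    by (rule ext) (use f in \<open>auto simp: ket_def if_distrib cong: if_cong\<close>)
  have "ell2_norm ((T ^^ n) f) \<le> (\<Sum>x\<in>?A. cmod (f x) * sqrt (C x)) * r ^ n" for n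
  proof -
    have ke: "(T ^^ n) (ket x) \<in> ell2" for x
      by (rule finite_support_ell2(1)[OF pow_fin]) (auto simp: ket_support)
    have "(T ^^ n) f = (\<lambda>v. \<Sum>x\<in>?A. f x * (T ^^ n) (ket x) v)"
      by (subst f_eq) (rule pow_sum[OF f])
    then have "ell2_norm ((T ^^ n) f) \<le> (\<Sum>x\<in>?A. ell2_norm (\<lambda>v. f x * (T ^^ n) (ket x) v))"
      using ell2_sum[OF f, of "\<lambda>x v. f x * (T ^^ n) (ket x) v"] ell2_scale[OF ke] by auto
    also have "\<dots> \<le> (\<Sum>x\<in>?A. cmod (f x) * (sqrt (C x) * r ^ n))"
      unfolding ell2_norm_scale by (intro sum_mono mult_left_mono norm_pow_ket_le[OF C r]) auto
    finally show ?thesis by (simp add: sum_distrib_left sum_distrib_right mult_ac)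
  qed
  note growth = this
  have "ell2_norm ((T ^^ 1) f) \<le> r * ell2_norm ((T ^^ 0) f)"
    by (rule log_convex_growth[where a = "\<lambda>n. ell2_norm ((T ^^ n) f)", OF _ _ growth r])
      (use norm_pow_log_convex[OF f] in simp_all)
  then show ?thesis by simp
qed

text \<open>The solution is the Neumann series with terms \<open>T^n g / M^(n+1)\<close>. It
  converges in norm, but the equation itself is checked pointwise: partial sums telescope and
  \<open>T_tendsto\<close> passes to the limit.\<close>

lemma neumann_solution:
  assumes bd: "\<And>f. f \<in> ell2 \<Longrightarrow> T f \<in> ell2 \<and> ell2_norm (T f) \<le> r * ell2_norm f"
    and r: "0 \<le> r" "r < M" and g: "g \<in> ell2"
  shows "\<exists>h\<in>ell2. \<forall>v. of_real M * h v - T h v = g v"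
proof -
  have M: "M > 0" using r by simp
  have p: "(T ^^ n) g \<in> ell2 \<and> ell2_norm ((T ^^ n) g) \<le> ell2_norm g * r ^ n" for n
  proof (induction n)
    case (Suc n)
    then have "r * ell2_norm ((T ^^ n) g) \<le> r * (ell2_norm g * r ^ n)" using r(1) mult_left_mono by blast
    with Suc bd[of "(T ^^ n) g"] show ?case by (auto simp: mult_ac intro: order_trans)
  qed (use g in auto)
  define q where "q = (\<lambda>n v. of_real (1 / M ^ Suc n) * (T ^^ n) g v)"
  define h where "h = (\<lambda>v. \<Sum>n. q n v)"
  have q: "q n \<in> ell2" "ell2_norm (q n) \<le> (ell2_norm g / M) * (r / M) ^ n" for n
  proof -
    show "q n \<in> ell2" unfolding q_def by (rule ell2_scale) (use p in auto)
    have "ell2_norm (q n) = 1 / M ^ Suc n * ell2_norm ((T ^^ n) g)"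
      unfolding q_def ell2_norm_scale using M by (simp add: norm_divide norm_mult norm_power)
    also have "\<dots> \<le> 1 / M ^ Suc n * (ell2_norm g * r ^ n)"
      using p[of n] M by (intro mult_left_mono) auto
    also have "\<dots> = (ell2_norm g / M) * (r / M) ^ n" using M by (simp add: power_divide)
    finally show "ell2_norm (q n) \<le> (ell2_norm g / M) * (r / M) ^ n" .
  qed
  have rM: "0 \<le> r / M" "r / M < 1" using r M by auto
  note s = ell2_series[OF q rM]
  have "of_real M * h v - T h v = g v" for v
  proof (rule LIMSEQ_unique)
    let ?h = "\<lambda>n v. \<Sum>k<n. q k v"
    have lim: "(\<lambda>n. ?h n v) \<longlonglongrightarrow> h v" for v
      unfolding h_def by (intro summable_LIMSEQ s)
    show "(\<lambda>n. of_real M * ?h n v - T (?h n) v) \<longlonglongrightarrow> of_real M * h v - T h v"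
      by (intro tendsto_intros lim T_tendsto)
    have tel: "of_real M * ?h n v - T (?h n) v = g v - of_real M * q n v" for n
    proof (induction n)
      case 0 show ?case using M by (simp add: T_zero q_def)
    next
      case (Suc n)
      have "T (q n) v = of_real M * q (Suc n) v"
        unfolding q_def T_scale using M by (simp add: field_simps)
      moreover have "T (?h (Suc n)) v = T (?h n) v + T (q n) v" using T_add[of "?h n" "q n"] by simp
      ultimately show ?case using Suc by (simp add: algebra_simps)
    qed
    have "(\<lambda>n. g v - of_real M * q n v) \<longlonglongrightarrow> g v - of_real M * 0"
      by (intro tendsto_intros summable_LIMSEQ_zero s)
    then show "(\<lambda>n. of_real M * ?h n v - T (?h n) v) \<longlonglongrightarrow> g v" unfolding tel by simp
  qed
  moreover have "h \<in> ell2" unfolding h_def by (rule s)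
  ultimately show ?thesis by blast
qed

text \<open>Expanding the square leaves a combination of the identity, \<open>T\<close> and
  \<open>T\<close> applied twice, which inherits the four axioms; for locality, two applications
  reach the neighbours of neighbours.\<close>

lemma shifted_square:
  "local_symmetric (\<lambda>f v. complex_of_real M * f v
      - (T (\<lambda>x. T f x - of_real E * f x) v - of_real E * (T f v - of_real E * f v)))"
    (is "local_symmetric ?S")
proof -
  have S: "?S f v = (of_real M - (of_real E)\<^sup>2) * f v - T (T f) v + 2 * of_real E * T f v" for f v
    by (simp add: T_diff T_scale algebra_simps power2_eq_square)
  let ?U = "\<lambda>f v. (of_real M - (of_real E)\<^sup>2) * f v - T (T f) v + 2 * of_real E * T f v"
  have "local_symmetric ?U"
  proof
    fix a b :: complex and f g :: "'v \<Rightarrow> complex"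
    show "?U (\<lambda>v. a * f v + b * g v) = (\<lambda>v. a * ?U f v + b * ?U g v)"
      unfolding lin[of a f b g] lin[of a "T f" b "T g"] by (simp add: algebra_simps)
  next
    fix y
    obtain N where N: "finite N" "\<And>f g. (\<forall>x\<in>N. f x = g x) \<Longrightarrow> T f y = T g y"
      using loc by blast
    have "\<forall>y. \<exists>N. finite N \<and> (\<forall>f g. (\<forall>x\<in>N. f x = g x) \<longrightarrow> T f y = T g y)" using loc by blast
    then obtain N' where N': "\<And>y. finite (N' y)"
      "\<And>y f g. (\<forall>x\<in>N' y. f x = g x) \<Longrightarrow> T f y = T g y" by metis
    show "\<exists>N. finite N \<and> (\<forall>f g. (\<forall>x\<in>N. f x = g x) \<longrightarrow> ?U f y = ?U g y)"
    proof (intro exI[of _ "insert y (N \<union> (\<Union>x\<in>N. N' x))"] conjI allI impI)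
      show "finite (insert y (N \<union> (\<Union>x\<in>N. N' x)))" using N(1) N'(1) by auto
      fix f g :: "'v \<Rightarrow> complex"
      assume eq: "\<forall>x\<in>insert y (N \<union> (\<Union>x\<in>N. N' x)). f x = g x"
      have "T f y = T g y" by (rule N(2)) (use eq in auto)
      moreover have "T (T f) y = T (T g) y"
      proof (rule N(2), rule ballI)
        fix x assume "x \<in> N"
        then show "T f x = T g x" by (intro N'(2)) (use eq in auto)
      qed
      ultimately show "?U f y = ?U g y" using eq by simp
    qed
  next
    fix f :: "'v \<Rightarrow> complex" assume f: "finite {v. f v \<noteq> 0}"
    show "finite {v. ?U f v \<noteq> 0}"
      by (rule finite_subset[of _ "{v. f v \<noteq> 0} \<union> {v. T f v \<noteq> 0} \<union> {v. T (T f) v \<noteq> 0}"])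
        (use f fin fin[OF fin] in auto)
  next
    fix f g :: "'v \<Rightarrow> complex" assume f: "finite {v. f v \<noteq> 0}" and g: "finite {v. g v \<noteq> 0}"
    let ?F = "{v. f v \<noteq> 0} \<union> {v. T f v \<noteq> 0} \<union> {v. T (T f) v \<noteq> 0}"
    have F: "finite ?F" using f fin fin[OF fin] by auto
    have expl: "ip (?U f) g = (of_real M - (of_real E)\<^sup>2) * ip f g - ip (T (T f)) g + 2 * of_real E * ip (T f) g"
    proof -
      have "ip (?U f) g = (\<Sum>v\<in>?F. ?U f v * cnj (g v))" by (rule ip_eq[OF F]) auto
      moreover have "ip f g = (\<Sum>v\<in>?F. f v * cnj (g v))" by (rule ip_eq[OF F]) auto
      moreover have "ip (T f) g = (\<Sum>v\<in>?F. T f v * cnj (g v))" by (rule ip_eq[OF F]) auto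
      moreover have "ip (T (T f)) g = (\<Sum>v\<in>?F. T (T f) v * cnj (g v))" by (rule ip_eq[OF F]) auto
      ultimately show ?thesis
        by (simp add: sum.distrib sum_subtractf sum_distrib_left algebra_simps)
    qed
    have expr: "ip f (?U g) = (of_real M - (of_real E)\<^sup>2) * ip f g - ip f (T (T g)) + 2 * of_real E * ip f (T g)"
      unfolding ip_def by (simp add: sum.distrib sum_subtractf sum_distrib_left algebra_simps)
    show "ip (?U f) g = ip f (?U g)"
      unfolding expl expr using sym[OF f g] sym[OF fin[OF f] g] sym[OF f fin[OF g]] by simp
  qed
  moreover have "?S = ?U" by (intro ext) (rule S)
  ultimately show ?thesis by simp
qed

end

section \<open>Spectrum from an analytic family of resolvent kernels\<close>

text \<open>An even function does not notice which square root is taken, so the branch cut of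
  \<open>csqrt\<close> is invisible. Only the branch point 0 remains, and it is a removable
  singularity by continuity.\<close>

lemma even_compose_csqrt_holomorphic:
  assumes Q: "Q holomorphic_on \<Omega>" and \<Omega>: "open \<Omega>"
    and even: "\<And>\<zeta>. \<zeta> \<in> \<Omega> \<Longrightarrow> - \<zeta> \<in> \<Omega> \<and> Q (- \<zeta>) = Q \<zeta>"
    and B: "open B" and sub: "\<And>t. t \<in> B \<Longrightarrow> csqrt t \<in> \<Omega>"
  shows "(\<lambda>t. Q (csqrt t)) holomorphic_on B"
proof (rule no_isolated_singularity'[where K = "B \<inter> {0}"])
  have Qd: "Q field_differentiable at \<zeta>" if "\<zeta> \<in> \<Omega>" for \<zeta>
    using Q \<Omega> that holomorphic_on_imp_differentiable_at by blast
  show "((\<lambda>t. Q (csqrt t)) \<longlongrightarrow> Q (csqrt z)) (at z within B)" if z: "z \<in> B \<inter> {0}" for z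
  proof -
    have True: "0 \<in> B" using z by auto
    have "isCont Q 0" using sub[OF True] Qd field_differentiable_imp_continuous_at by fastforce
    moreover have "(csqrt \<longlongrightarrow> 0) (at z within B)"
    proof (rule tendsto_norm_zero_cancel)
      have "((\<lambda>t. sqrt (norm t)) \<longlongrightarrow> sqrt (norm z)) (at z within B)" by (intro tendsto_intros)
      then show "((\<lambda>t. norm (csqrt t)) \<longlongrightarrow> 0) (at z within B)" using z by simp
    qed
    ultimately show ?thesis using z isCont_tendsto_compose[of 0 Q csqrt "at z within B"] by simp
  qed
  have "(\<lambda>t. Q (csqrt t)) holomorphic_on B - {0}"
  proof (rule holomorphic_onI)
    fix t assume t: "t \<in> B - {0}"
    show "(\<lambda>t. Q (csqrt t)) field_differentiable at t within B - {0}"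
    proof (cases "t \<in> \<real>\<^sub>\<le>\<^sub>0")
      case False
      have "(Q \<circ> csqrt) field_differentiable at t"
        by (intro field_differentiable_compose field_differentiable_at_csqrt Qd False sub) (use t in auto)
      then show ?thesis by (simp add: o_def field_differentiable_at_within)
    next
      case True
      then have nt: "- t \<notin> \<real>\<^sub>\<le>\<^sub>0" using t by (auto simp: complex_nonpos_Reals_iff complex_eq_iff)
      \<comment> \<open>On the cut the branch \<open>\<i> * csqrt (- s)\<close> replaces
        \<open>csqrt s\<close>. It is differentiable there and differs from \<open>csqrt s\<close>
        at most by a sign, which \<open>Q\<close> does not see.\<close>
      have br: "Q (\<i> * csqrt (- s)) = Q (csqrt s) \<and> \<i> * csqrt (- s) \<in> \<Omega>" if "s \<in> B" for s
      proof -
        have "(\<i> * csqrt (- s))\<^sup>2 = (csqrt s)\<^sup>2" by (simp add: power_mult_distrib)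
        then have "\<i> * csqrt (- s) = csqrt s \<or> \<i> * csqrt (- s) = - csqrt s"
          using power2_eq_iff by blast
        then show ?thesis using even[OF sub[OF that]] sub[OF that] by auto
      qed
      have "(\<lambda>s. csqrt (- s)) field_differentiable at t"
        using field_differentiable_compose[of "\<lambda>s. - s" t csqrt] field_differentiable_at_csqrt[OF nt]
        by (simp add: o_def field_differentiable_minus field_differentiable_ident)
      then have "(\<lambda>s. \<i> * csqrt (- s)) field_differentiable at t"
        by (intro field_differentiable_mult field_differentiable_const)
      then have "(Q \<circ> (\<lambda>s. \<i> * csqrt (- s))) field_differentiable at t"
        by (rule field_differentiable_compose) (use t br Qd in auto)
      then have "(\<lambda>s. Q (\<i> * csqrt (- s))) field_differentiable at t within B - {0}"
        by (simp add: o_def field_differentiable_at_within)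
      then show ?thesis
        by (rule field_differentiable_transform_within[OF zero_less_one t, rotated]) (use br in auto)
    qed
  qed
  then show "(\<lambda>t. Q (csqrt t)) holomorphic_on B - B \<inter> {0}" by (simp add: Diff_Int)
qed (use B in auto)

lemma filterlim_uminus_at_infinity: "filterlim (\<lambda>z::'a::real_normed_vector. - z) at_infinity at_infinity"
  by (rule filterlim_norm_at_top_imp_at_infinity) (simp add: filterlim_norm_at_top)

text \<open>The columns \<open>u x z\<close> are only formal solutions: square-summability is a
  consequence, not an axiom. The decay in \<open>u_infinity\<close> makes the generating function of
  the moments extend analytically to the origin.\<close>

locale resolvent_family = local_symmetric T
  for T :: "('v \<Rightarrow> complex) \<Rightarrow> 'v \<Rightarrow> complex" +
  fixes K :: "real set" and u :: "'v \<Rightarrow> complex \<Rightarrow> 'v \<Rightarrow> complex"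
  assumes K: "compact K"
    and u_holomorphic: "(\<lambda>z. u x z y) holomorphic_on - (complex_of_real ` K)"
    and u_infinity: "((\<lambda>z. u x z y) \<longlongrightarrow> 0) at_infinity"
    and u_eq: "z \<notin> complex_of_real ` K \<Longrightarrow> T (u x z) y - z * u x z y = ket x y"
begin

lemma closed_K: "closed (complex_of_real ` K)"
  by (intro compact_imp_closed compact_continuous_image K continuous_intros)

text \<open>For a self-adjoint operator with spectrum in \<open>K\<close>, the bounds would place
  the spectrum of its shifted square in \<open>[d, M]\<close>. For a real point off \<open>K\<close>
  the squared distance serves as \<open>d\<close>; for nonreal points \<open>d = 0\<close>
  suffices.\<close>

context
  fixes E M d :: real
  assumes d: "0 \<le> d" "d < M" and dist_K: "\<And>x. x \<in> K \<Longrightarrow> d \<le> (x - E)\<^sup>2 \<and> (x - E)\<^sup>2 \<le> M"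
begin

definition \<Omega> :: "complex set" where
  "\<Omega> = {\<zeta>. of_real E + \<zeta> \<notin> complex_of_real ` K \<and> of_real E - \<zeta> \<notin> complex_of_real ` K}"

text \<open>\<open>Q x y\<close> evaluated at \<open>csqrt t\<close> is the resolvent kernel of \<open>(T - E)\<^sup>2\<close> at \<open>t\<close>, and
  \<open>V x y w\<close> is that kernel at \<open>t = M - 1 / w\<close>, where it generates the moments of
  \<open>S = M - (T - E)\<^sup>2\<close>.\<close>

definition Q :: "'v \<Rightarrow> 'v \<Rightarrow> complex \<Rightarrow> complex" where
  "Q x y = (\<lambda>\<zeta>. let f = (\<lambda>\<zeta>. (u x (of_real E + \<zeta>) y - u x (of_real E - \<zeta>) y) / 2)
     in if \<zeta> = 0 then deriv f 0 else (f \<zeta> - f 0) / (\<zeta> - 0))"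

definition V :: "'v \<Rightarrow> 'v \<Rightarrow> complex \<Rightarrow> complex" where
  "V x y w = (if w = 0 then 0 else Q x y (csqrt (of_real M - 1 / w)))"

definition S :: "('v \<Rightarrow> complex) \<Rightarrow> 'v \<Rightarrow> complex" where
  "S f v = of_real M * f v - (T (\<lambda>x. T f x - of_real E * f x) v - of_real E * (T f v - of_real E * f v))"

lemma local_symmetric_S: "local_symmetric S"
  unfolding S_def[abs_def] by (rule shifted_square)

lemma open_\<Omega>: "open \<Omega>"
proof -
  have "\<Omega> = (\<lambda>\<zeta>. of_real E + \<zeta>) -` (- (complex_of_real ` K)) \<inter> (\<lambda>\<zeta>. of_real E - \<zeta>) -` (- (complex_of_real ` K))"
    by (auto simp: \<Omega>_def)
  then show ?thesis using closed_K by (auto intro!: open_Int open_vimage continuous_intros)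
qed

text \<open>This is the partial fraction formula for the inverse of
  \<open>(T - E)\<^sup>2 - \<zeta>\<^sup>2\<close>. The numerator is odd in \<open>\<zeta>\<close>,
  hence zero at 0, so the difference quotient in \<open>Q\<close> merely fills in the removable
  singularity.\<close>

lemma Q_nonzero: "\<zeta> \<noteq> 0 \<Longrightarrow> Q x y \<zeta> = (u x (of_real E + \<zeta>) y - u x (of_real E - \<zeta>) y) / (2 * \<zeta>)"
  by (simp add: Q_def)

lemma Q_holomorphic: "Q x y holomorphic_on \<Omega>"
proof -
  have "(\<lambda>\<zeta>. u x (of_real E + \<zeta>) y) holomorphic_on \<Omega>"
    by (rule holomorphic_on_compose_gen[of "\<lambda>\<zeta>. of_real E + \<zeta>" _ "\<lambda>z. u x z y", unfolded o_def,
          OF _ u_holomorphic]) (auto simp: \<Omega>_def intro!: holomorphic_intros)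
  moreover have "(\<lambda>\<zeta>. u x (of_real E - \<zeta>) y) holomorphic_on \<Omega>"
    by (rule holomorphic_on_compose_gen[of "\<lambda>\<zeta>. of_real E - \<zeta>" _ "\<lambda>z. u x z y", unfolded o_def,
          OF _ u_holomorphic]) (auto simp: \<Omega>_def intro!: holomorphic_intros)
  ultimately have "(\<lambda>\<zeta>. (u x (of_real E + \<zeta>) y - u x (of_real E - \<zeta>) y) / 2) holomorphic_on \<Omega>"
    by (intro holomorphic_intros) auto
  from pole_lemma_open[OF this open_\<Omega>, of 0] show ?thesis unfolding Q_def Let_def .
qed

lemma Q_even: "\<zeta> \<in> \<Omega> \<Longrightarrow> - \<zeta> \<in> \<Omega> \<and> Q x y (- \<zeta>) = Q x y \<zeta>"
  by (cases "\<zeta> = 0") (auto simp: Q_nonzero \<Omega>_def field_simps)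

text \<open>If a square root of \<open>t\<close> led back to a point \<open>x\<close> of
  \<open>K\<close>, then \<open>t = (x - E)\<^sup>2\<close>, and \<open>M - t\<close> would lie in
  \<open>[0, M - d]\<close>.\<close>

lemma csqrt_\<Omega>:
  assumes "cmod (of_real M - t) > M - d" shows "csqrt t \<in> \<Omega>"
proof -
  have "x \<notin> K" if "of_real E + \<zeta> = of_real x" "\<zeta>\<^sup>2 = t" for \<zeta> x
  proof
    assume "x \<in> K"
    have "\<zeta> = of_real (x - E)" using that(1) by (simp add: algebra_simps)
    then have "t = of_real ((x - E)\<^sup>2)" using that(2) by (simp add: power2_eq_square)
    then have "of_real M - t = of_real (M - (x - E)\<^sup>2)" by simp
    then have "cmod (of_real M - t) = \<bar>M - (x - E)\<^sup>2\<bar>" by (metis norm_of_real)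
    then show False using assms dist_K[OF \<open>x \<in> K\<close>] by auto
  qed
  from this[of "csqrt t"] this[of "- csqrt t"] show ?thesis unfolding \<Omega>_def by auto
qed

text \<open>The deltas cancel when \<open>T - E\<close> acts on the difference of the two kernels,
  which leaves their average. A second application of \<open>T - E\<close> to the average gives one
  delta and returns \<open>\<zeta>\<^sup>2\<close> times \<open>Q\<close>.\<close>

lemma Q_eq:
  assumes "\<zeta> \<in> \<Omega>" "\<zeta> \<noteq> 0"
  shows "T (\<lambda>y. Q x y \<zeta>) y - of_real E * Q x y \<zeta> = (u x (of_real E + \<zeta>) y + u x (of_real E - \<zeta>) y) / 2"
    and "S (\<lambda>y. Q x y \<zeta>) y = (of_real M - \<zeta>\<^sup>2) * Q x y \<zeta> - ket x y"
proof -
  have p: "T (u x (of_real E + \<zeta>)) y = ket x y + (of_real E + \<zeta>) * u x (of_real E + \<zeta>) y"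
    "T (u x (of_real E - \<zeta>)) y = ket x y + (of_real E - \<zeta>) * u x (of_real E - \<zeta>) y" for y
    using u_eq[of "of_real E + \<zeta>" x y] u_eq[of "of_real E - \<zeta>" x y] assms(1)
    by (auto simp: \<Omega>_def algebra_simps)
  have Qe: "(\<lambda>y. Q x y \<zeta>) = (\<lambda>y. 1 / (2 * \<zeta>) * u x (of_real E + \<zeta>) y + (- 1 / (2 * \<zeta>)) * u x (of_real E - \<zeta>) y)"
    using assms(2) by (intro ext) (simp add: Q_nonzero diff_divide_distrib)
  have 1: "T (\<lambda>y. Q x y \<zeta>) y - of_real E * Q x y \<zeta> = (u x (of_real E + \<zeta>) y + u x (of_real E - \<zeta>) y) / 2" for y
  proof -
    have "T (\<lambda>y. Q x y \<zeta>) y = 1 / (2 * \<zeta>) * (ket x y + (of_real E + \<zeta>) * u x (of_real E + \<zeta>) y)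
        + (- 1 / (2 * \<zeta>)) * (ket x y + (of_real E - \<zeta>) * u x (of_real E - \<zeta>) y)"
      unfolding Qe lin p ..
    moreover have "Q x y \<zeta> = (u x (of_real E + \<zeta>) y - u x (of_real E - \<zeta>) y) / (2 * \<zeta>)"
      by (rule Q_nonzero[OF assms(2)])
    ultimately have "T (\<lambda>y. Q x y \<zeta>) y - of_real E * Q x y \<zeta>
      = 1 / (2 * \<zeta>) * (ket x y + (of_real E + \<zeta>) * u x (of_real E + \<zeta>) y)
        + (- 1 / (2 * \<zeta>)) * (ket x y + (of_real E - \<zeta>) * u x (of_real E - \<zeta>) y)
        - of_real E * ((u x (of_real E + \<zeta>) y - u x (of_real E - \<zeta>) y) / (2 * \<zeta>))" by simp
    also have "\<dots> = (u x (of_real E + \<zeta>) y + u x (of_real E - \<zeta>) y) / 2"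
      using assms(2) by (simp add: field_simps)
    finally show ?thesis .
  qed
  then show "T (\<lambda>y. Q x y \<zeta>) y - of_real E * Q x y \<zeta> = (u x (of_real E + \<zeta>) y + u x (of_real E - \<zeta>) y) / 2" .
  have "(\<lambda>y. (u x (of_real E + \<zeta>) y + u x (of_real E - \<zeta>) y) / 2)
      = (\<lambda>y. 1 / 2 * u x (of_real E + \<zeta>) y + 1 / 2 * u x (of_real E - \<zeta>) y)"
    by (simp add: add_divide_distrib)
  then have "T (\<lambda>y. (u x (of_real E + \<zeta>) y + u x (of_real E - \<zeta>) y) / 2) y
     = 1 / 2 * T (u x (of_real E + \<zeta>)) y + 1 / 2 * T (u x (of_real E - \<zeta>)) y"
    by (simp only: lin)
  then show "S (\<lambda>y. Q x y \<zeta>) y = (of_real M - \<zeta>\<^sup>2) * Q x y \<zeta> - ket x y"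
  proof -
    assume T2: "T (\<lambda>y. (u x (of_real E + \<zeta>) y + u x (of_real E - \<zeta>) y) / 2) y
     = 1 / 2 * T (u x (of_real E + \<zeta>)) y + 1 / 2 * T (u x (of_real E - \<zeta>)) y"
    have "of_real M * Q x y \<zeta> - S (\<lambda>y. Q x y \<zeta>) y
      = T (\<lambda>y. (u x (of_real E + \<zeta>) y + u x (of_real E - \<zeta>) y) / 2) y
        - of_real E * ((u x (of_real E + \<zeta>) y + u x (of_real E - \<zeta>) y) / 2)"
      by (simp only: S_def 1) simp
    also have "\<dots> = ket x y + \<zeta> * ((u x (of_real E + \<zeta>) y - u x (of_real E - \<zeta>) y) / 2)"
      by (simp only: T2 p) (simp add: field_simps)
    also have "(u x (of_real E + \<zeta>) y - u x (of_real E - \<zeta>) y) / 2 = \<zeta> * Q x y \<zeta>"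
      by (simp only: Q_nonzero[OF assms(2)]) (use assms(2) in simp)
    finally show ?thesis by (simp add: algebra_simps power2_eq_square)
  qed
qed

text \<open>With \<open>\<zeta>\<^sup>2 = M - 1 / w\<close> the equation of \<open>Q_eq\<close>
  becomes a fixed-point equation in powers of \<open>w\<close>. The condition
  \<open>w * M \<noteq> 1\<close> excludes \<open>\<zeta> = 0\<close>.\<close>

lemma V_eq:
  assumes "w \<noteq> 0" "cmod w < 1 / (M - d)" "w * of_real M \<noteq> 1"
  shows "V x y w = w * S (\<lambda>y. V x y w) y + w * ket x y"
proof -
  define \<zeta> where "\<zeta> = csqrt (of_real M - 1 / w)"
  have "1 / cmod w > M - d" using assms d by (simp add: field_simps)
  then have "\<zeta> \<in> \<Omega>" unfolding \<zeta>_def by (intro csqrt_\<Omega>) (simp add: norm_divide)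
  moreover have z2: "\<zeta>\<^sup>2 = of_real M - 1 / w" by (simp add: \<zeta>_def)
  moreover have "\<zeta> \<noteq> 0" using assms by (auto simp: \<zeta>_def field_simps)
  ultimately have "S (\<lambda>y. Q x y \<zeta>) y = 1 / w * Q x y \<zeta> - ket x y"
    using Q_eq(2)[of \<zeta> x y] by simp
  then show ?thesis using assms(1) by (simp add: V_def \<zeta>_def field_simps)
qed

text \<open>For \<open>t = M - 1 / w\<close> the bound on \<open>w\<close> says that
  \<open>|M - t| > M - d\<close>, exactly the region where \<open>csqrt t\<close> lands in
  \<open>\<Omega>\<close>. The origin \<open>w = 0\<close> corresponds to \<open>t\<close> at
  infinity, where \<open>Q\<close> decays.\<close>

lemma V_holomorphic: "V x y holomorphic_on ball 0 (1 / (M - d))"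
proof (rule no_isolated_singularity'[where K = "{0}"])
  let ?B = "{t. cmod (of_real M - t) > M - d}"
  have "open ?B" by (intro open_Collect_less continuous_intros)
  from even_compose_csqrt_holomorphic[OF Q_holomorphic open_\<Omega> Q_even this]
  have H: "(\<lambda>t. Q x y (csqrt t)) holomorphic_on ?B" by (auto intro: csqrt_\<Omega>)
  have "((\<lambda>t. Q x y (csqrt t)) \<circ> (\<lambda>w. of_real M - 1 / w)) holomorphic_on ball 0 (1 / (M - d)) - {0}"
    by (rule holomorphic_on_compose_gen[OF _ H])
      (use d in \<open>auto intro!: holomorphic_intros simp: norm_divide field_simps\<close>)
  then show "V x y holomorphic_on ball 0 (1 / (M - d)) - {0}"
    by (rule holomorphic_transform) (auto simp: V_def)
  show "(V x y \<longlongrightarrow> V x y z) (at z within ball 0 (1 / (M - d)))" if z: "z \<in> {0}" for z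
  proof -
    have inf: "filterlim (\<lambda>w::complex. csqrt (of_real M - 1 / w)) at_infinity (at 0)"
    proof -
      have "filterlim (\<lambda>w::complex. of_real M - 1 / w) at_infinity (at 0)"
        using tendsto_add_filterlim_at_infinity[OF tendsto_const[of "of_real M"]
            filterlim_compose[OF filterlim_uminus_at_infinity filterlim_inverse_at_infinity]]
        by (simp add: inverse_eq_divide)
      then have "filterlim (\<lambda>w::complex. sqrt (cmod (of_real M - 1 / w))) at_top (at 0)"
        by (intro filterlim_compose[OF sqrt_at_top] filterlim_at_infinity_imp_norm_at_top)
      then show ?thesis by (intro filterlim_norm_at_top_imp_at_infinity) simp
    qed
    have Q0: "(Q x y \<longlongrightarrow> 0) at_infinity"
    proof -
      have 1: "((\<lambda>\<zeta>. u x (of_real E + \<zeta>) y) \<longlongrightarrow> 0) at_infinity"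
        by (rule filterlim_compose[OF u_infinity])
          (rule tendsto_add_filterlim_at_infinity[OF tendsto_const filterlim_ident])
      have 2: "((\<lambda>\<zeta>. u x (of_real E - \<zeta>) y) \<longlongrightarrow> 0) at_infinity"
        using filterlim_compose[OF u_infinity
            tendsto_add_filterlim_at_infinity[OF tendsto_const[of "of_real E"] filterlim_uminus_at_infinity]]
        by simp
      have "((\<lambda>\<zeta>. (u x (of_real E + \<zeta>) y - u x (of_real E - \<zeta>) y) * (1/2) * inverse \<zeta>) \<longlongrightarrow> (0 - 0) * (1/2) * 0) at_infinity"
        by (intro tendsto_intros 1 2 tendsto_inverse_0)
      then have "((\<lambda>\<zeta>. (u x (of_real E + \<zeta>) y - u x (of_real E - \<zeta>) y) * (1/2) * inverse \<zeta>) \<longlongrightarrow> 0) at_infinity" by simp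
      moreover have "\<forall>\<^sub>F \<zeta> in at_infinity. (u x (of_real E + \<zeta>) y - u x (of_real E - \<zeta>) y) * (1/2) * inverse \<zeta> = Q x y \<zeta>"
        unfolding eventually_at_infinity
      proof (intro exI[of _ 1] allI impI)
        fix \<zeta> :: complex assume "1 \<le> cmod \<zeta>"
        then have "\<zeta> \<noteq> 0" by auto
        then show "(u x (of_real E + \<zeta>) y - u x (of_real E - \<zeta>) y) * (1/2) * inverse \<zeta> = Q x y \<zeta>"
          unfolding Q_nonzero[OF \<open>\<zeta> \<noteq> 0\<close>] by (simp add: field_simps)
      qed
      ultimately show ?thesis by (rule Lim_transform_eventually)
    qed
    have "((\<lambda>w. Q x y (csqrt (of_real M - 1 / w))) \<longlongrightarrow> 0) (at 0)"
      by (rule filterlim_compose[OF Q0 inf])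
    moreover have "\<forall>\<^sub>F w in at 0. Q x y (csqrt (of_real M - 1 / w)) = V x y w"
      by (auto simp: V_def eventually_at_filter)
    ultimately have "(V x y \<longlongrightarrow> 0) (at 0)" by (rule Lim_transform_eventually)
    then show ?thesis using z by (simp add: V_def tendsto_within_subset[of _ _ _ UNIV])
  qed
qed auto

section \<open>Taylor coefficients of \<open>V\<close> as moments of \<open>S\<close>\<close>

definition coef :: "'v \<Rightarrow> 'v \<Rightarrow> nat \<Rightarrow> complex" where
  "coef x y n = (deriv ^^ n) (V x y) 0 / fact n"

text \<open>Coefficients are compared in \<open>V_eq\<close>. Since \<open>S\<close> has finite
  rows, its action on \<open>V\<close> is a finite combination of power series, so no interchange of
  limits arises.\<close>

lemma coef_rec:
  "coef x y 0 = 0" "coef x y (Suc n) = S (\<lambda>y. coef x y n) y + (if n = 0 then ket x y else 0)"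
proof -
  interpret S: local_symmetric S by (rule local_symmetric_S)
  have R: "0 < 1 / (M - d)" using d by simp
  have F: "V x y has_fps_expansion fps_expansion (V x y) 0" for y
    by (rule has_fps_expansion_fps_expansion[OF open_ball _ V_holomorphic]) (use d in auto)
  have nth: "fps_nth (fps_expansion (V x y) 0) n = coef x y n" for y n
    by (simp add: fps_expansion_def coef_def)
  obtain N where N: "finite N" "\<And>f. S f y = (\<Sum>x\<in>N. f x * S (ket x) y)"
    using S.matrix_rep by blast
  define G where "G = fps_X * (\<Sum>a\<in>N. fps_expansion (V x a) 0 * fps_const (S (ket a) y)) + fps_X * fps_const (ket x y)"
  have 1: "(\<lambda>w. w * (\<Sum>a\<in>N. V x a w * S (ket a) y) + w * ket x y) has_fps_expansion G"
    unfolding G_def by (intro fps_expansion_intros F)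
  have 2: "\<forall>\<^sub>F w in nhds 0. w * (\<Sum>a\<in>N. V x a w * S (ket a) y) + w * ket x y = V x y w"
  proof -
    have "\<forall>\<^sub>F w in nhds (0::complex). w \<in> ball 0 (min (1 / M) (1 / (M - d)))"
      by (rule eventually_nhds_in_open) (use d in auto)
    then show ?thesis
    proof eventually_elim
      case (elim w)
      \<comment> \<open>The radius \<open>1 / M\<close> in the neighbourhood was chosen for this: it
        keeps \<open>w\<close> away from the one point that \<open>V_eq\<close> excludes.\<close>
      have "w * of_real M \<noteq> 1"
      proof
        assume "w * of_real M = 1"
        then have "cmod w * M = 1" using d by (metis abs_of_nonneg less_imp_le norm_mult norm_of_real norm_one order_le_less_trans)
        then show False using elim d by (simp add: field_simps)
      qed
      then show ?case using V_eq[of w x y] elim d N(2)[of "\<lambda>y. V x y w"]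
        by (cases "w = 0") (auto simp: V_def)
    qed
  qed
  from iffD1[OF has_fps_expansion_cong[OF 2 refl] 1] have "V x y has_fps_expansion G" .
  then have G: "fps_expansion (V x y) 0 = G" using F fps_expansion_unique_complex by blast
  show "coef x y 0 = 0" unfolding nth[symmetric] G by (simp add: G_def)
  have "coef x y (Suc n) = (\<Sum>a\<in>N. coef x a n * S (ket a) y) + (if n = 0 then ket x y else 0)"
    unfolding nth[symmetric] G by (simp add: G_def fps_sum_nth)
  then show "coef x y (Suc n) = S (\<lambda>y. coef x y n) y + (if n = 0 then ket x y else 0)"
    using N(2)[of "\<lambda>y. coef x y n"] by simp
qed

lemma coef_moment: "(\<lambda>y. coef x y (Suc n)) = (S ^^ n) (ket x)"
proof (induction n)
  case 0
  interpret S: local_symmetric S by (rule local_symmetric_S)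
  show ?case by (simp add: coef_rec S.T_zero)
next
  case (Suc n)
  have "(\<lambda>y. coef x y (Suc (Suc n))) = S (\<lambda>y. coef x y (Suc n))" by (subst coef_rec(2)) simp
  then show ?case using Suc by simp
qed

text \<open>This is the Cauchy estimate on the circle of radius \<open>1 / \<rho>\<close>, which
  lies inside the disc of analyticity. The \<open>n\<close>-th moment is the coefficient of order
  \<open>n + 1\<close>, whence the extra factor \<open>\<rho>\<close> in the constant.\<close>

lemma moment_growth:
  assumes \<rho>: "\<rho> > M - d"
  shows "\<exists>C. \<forall>n. cmod ((S ^^ n) (ket x) y) \<le> C * \<rho> ^ n"
proof -
  have p: "\<rho> > 0" using \<rho> d by simp
  have sub: "cball 0 (1 / \<rho>) \<subseteq> ball 0 (1 / (M - d) :: real)"  "cball (0::complex) (1 / \<rho>) \<subseteq> ball 0 (1 / (M - d))"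
    using \<rho> d p by (auto simp: divide_strict_left_mono order_le_less_trans)
  have hol: "V x y holomorphic_on cball 0 (1 / \<rho>)" using V_holomorphic sub holomorphic_on_subset by blast
  then have cont: "continuous_on (cball 0 (1 / \<rho>)) (V x y)" by (rule holomorphic_on_imp_continuous_on)
  then have "bounded (V x y ` cball 0 (1 / \<rho>))"
    by (intro compact_imp_bounded compact_continuous_image) auto
  then obtain B where B: "\<And>w. w \<in> cball 0 (1 / \<rho>) \<Longrightarrow> cmod (V x y w) \<le> B"
    unfolding bounded_iff by blast
  have "cmod ((S ^^ n) (ket x) y) \<le> (B * \<rho>) * \<rho> ^ n" for n
  proof -
    have "cmod ((deriv ^^ Suc n) (V x y) 0) \<le> fact (Suc n) * B / (1 / \<rho>) ^ Suc n"
      by (rule Cauchy_inequality[OF holomorphic_on_subset[OF hol] cont])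
        (use p B in auto)
    moreover have "cmod ((S ^^ n) (ket x) y) = cmod ((deriv ^^ Suc n) (V x y) 0) / fact (Suc n)"
      unfolding coef_moment[symmetric] coef_def by (simp add: norm_divide del: fact_Suc)
    ultimately show ?thesis
      using p by (simp add: divide_le_eq power_one_over mult_ac del: fact_Suc)
  qed
  then show ?thesis by blast
qed

lemma S_bounded:
  assumes "\<rho> > M - d" "f \<in> ell2"
  shows "S f \<in> ell2 \<and> ell2_norm (S f) \<le> \<rho> * ell2_norm f"
proof -
  interpret S: local_symmetric S by (rule local_symmetric_S)
  have p: "\<rho> > 0" using assms d by simp
  note b = S.norm_le_of_moments[OF moment_growth[OF assms(1)] p]
  show ?thesis using S.bounded_extend[OF less_imp_le[OF p] b assms(2)] by auto
qed

text \<open>With \<open>h = (T - E) f\<close>, symmetry gives that the squared norm of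
  \<open>h\<close> is the pairing of \<open>f\<close> with \<open>(M - S) f\<close>. A bound for
  \<open>S\<close> therefore bounds \<open>T - E\<close>, and then \<open>T\<close>.\<close>

lemma T_bounded: "\<exists>C\<ge>0. \<forall>f\<in>ell2. T f \<in> ell2 \<and> ell2_norm (T f) \<le> C * ell2_norm f"
proof -
  define \<rho> where "\<rho> = M + 1"
  have \<rho>: "\<rho> > M - d" "\<rho> > 0" using d by (auto simp: \<rho>_def)
  define C where "C = sqrt (M + \<rho>) + \<bar>E\<bar>"
  have C: "C \<ge> 0" using d \<rho> by (simp add: C_def)
  have "ell2_norm (T f) \<le> C * ell2_norm f" if f: "finite {v. f v \<noteq> 0}" for f
  proof -
    define h where "h = (\<lambda>v. T f v - of_real E * f v)"
    have h: "finite {v. h v \<noteq> 0}"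
      by (rule finite_subset[of _ "{v. T f v \<noteq> 0} \<union> {v. f v \<noteq> 0}"]) (use f fin in \<open>auto simp: h_def\<close>)
    note fl = finite_support_ell2(1)[OF f order_refl]
    note hl = finite_support_ell2(1)[OF h order_refl]
    have "ip h h = ip (T f) h - of_real E * ip f h"
    proof -
      let ?F = "{v. T f v \<noteq> 0} \<union> {v. f v \<noteq> 0}"
      have F: "finite ?F" using f fin by auto
      have "ip h h = (\<Sum>v\<in>?F. h v * cnj (h v))" by (rule ip_eq[OF F]) (auto simp: h_def)
      also have "\<dots> = (\<Sum>v\<in>?F. T f v * cnj (h v) - of_real E * (f v * cnj (h v)))"
        by (rule sum.cong) (auto simp: h_def algebra_simps)
      finally have "ip h h = (\<Sum>v\<in>?F. T f v * cnj (h v)) - of_real E * (\<Sum>v\<in>?F. f v * cnj (h v))"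
        by (simp only: sum_subtractf sum_distrib_left)
      moreover have "ip (T f) h = (\<Sum>v\<in>?F. T f v * cnj (h v))" by (rule ip_eq[OF F]) auto
      moreover have "ip f h = (\<Sum>v\<in>?F. f v * cnj (h v))" by (rule ip_eq[OF F]) auto
      ultimately show ?thesis by simp
    qed
    also have "\<dots> = ip f (T h) - of_real E * ip f h" using sym[OF f h] by simp
    also have "\<dots> = ip f (\<lambda>v. of_real M * f v - S f v)"
      unfolding ip_def S_def h_def by (simp add: sum_subtractf sum.distrib sum_distrib_left algebra_simps)
    finally have "(ell2_norm h)\<^sup>2 = cmod (ip f (\<lambda>v. of_real M * f v - S f v))"
      using ip_self[OF h] by (metis abs_of_nonneg norm_of_real zero_le_power2)
    also have "\<dots> \<le> ell2_norm f * ell2_norm (\<lambda>v. of_real M * f v - S f v)"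
      by (intro norm_ip_le f ell2_diff ell2_scale fl) (use S_bounded[OF \<rho>(1) fl] in auto)
    also have "\<dots> \<le> ell2_norm f * (M * ell2_norm f + \<rho> * ell2_norm f)"
    proof (intro mult_left_mono)
      have "ell2_norm (\<lambda>v. of_real M * f v - S f v) \<le> ell2_norm (\<lambda>v. of_real M * f v) + ell2_norm (S f)"
        by (intro ell2_diff(2) ell2_scale fl) (use S_bounded[OF \<rho>(1) fl] in auto)
      then show "ell2_norm (\<lambda>v. of_real M * f v - S f v) \<le> M * ell2_norm f + \<rho> * ell2_norm f"
        using S_bounded[OF \<rho>(1) fl] d by (simp add: ell2_norm_scale)
    qed auto
    finally have "(ell2_norm h)\<^sup>2 \<le> (M + \<rho>) * (ell2_norm f)\<^sup>2"
      by (simp add: power2_eq_square algebra_simps)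
    then have hb: "ell2_norm h \<le> sqrt (M + \<rho>) * ell2_norm f"
      using real_le_rsqrt real_sqrt_mult by fastforce
    have "T f = (\<lambda>v. h v + of_real E * f v)" by (simp add: h_def)
    then have "ell2_norm (T f) \<le> ell2_norm h + \<bar>E\<bar> * ell2_norm f"
      using ell2_add(2)[OF hl ell2_scale[OF fl, of "of_real E"]] by (simp add: ell2_norm_scale)
    then show ?thesis using hb by (simp add: C_def algebra_simps)
  qed
  then show ?thesis using bounded_extend[OF C] C by blast
qed

text \<open>With \<open>z = E + i \<tau>\<close>, the product \<open>(T - z) (T - cnj z) = M + \<tau>\<^sup>2 - S\<close> is inverted by a Neumann
  series.\<close>

lemma not_in_spectrum_aux:
  assumes pos: "d + \<tau>\<^sup>2 > 0" and z: "z = Complex E \<tau>"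
  shows "z \<notin> ell2_spectrum T"
proof -
  \<comment> \<open>The midpoint of \<open>M - d\<close> and \<open>M + \<tau>\<^sup>2\<close>:
    large enough to bound \<open>S\<close>, small enough for the Neumann series at
    \<open>M'\<close>.\<close>
  define \<rho> where "\<rho> = M + (\<tau>\<^sup>2 - d) / 2"
  define M' where "M' = M + \<tau>\<^sup>2"
  have \<rho>: "\<rho> > M - d" "\<rho> < M'" using pos d by (auto simp: \<rho>_def M'_def)
  have "M - d / 2 \<le> \<rho>" unfolding \<rho>_def by (simp add: field_simps)
  then have \<rho>0: "\<rho> \<ge> 0" using d by linarith
  interpret S: local_symmetric S by (rule local_symmetric_S)
  obtain C where C: "C \<ge> 0" "\<And>f. f \<in> ell2 \<Longrightarrow> T f \<in> ell2 \<and> ell2_norm (T f) \<le> C * ell2_norm f"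
    using T_bounded by blast
  let ?R = "\<lambda>z f v. T f v - z * f v"
  have Rl: "?R z f \<in> ell2" if "f \<in> ell2" for f z
    using C(2)[OF that] that by (intro ell2_diff ell2_scale) auto
  have Rb: "ell2_norm (?R z f) \<le> (C + cmod z) * ell2_norm f" if "f \<in> ell2" for f z
  proof -
    have "ell2_norm (?R z f) \<le> ell2_norm (T f) + ell2_norm (\<lambda>v. z * f v)"
      using C(2)[OF that] that by (intro ell2_diff ell2_scale) auto
    then show ?thesis using C(2)[OF that] by (simp add: ell2_norm_scale algebra_simps)
  qed
  have E: "z + cnj z = 2 * of_real E" "z * cnj z = (of_real E)\<^sup>2 + (of_real \<tau>)\<^sup>2"
    unfolding z by (auto simp: complex_eq_iff power2_eq_square)
  have prod: "?R w (?R w' f) v = of_real M' * f v - S f v"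
    if "w + w' = 2 * of_real E" "w * w' = (of_real E)\<^sup>2 + (of_real \<tau>)\<^sup>2" for f v w w'
  proof -
    have "?R w (?R w' f) v = T (T f) v - (w + w') * T f v + w * w' * f v"
      by (simp add: T_diff T_scale algebra_simps)
    also have "\<dots> = of_real M' * f v - S f v"
      unfolding that by (simp add: S_def M'_def T_diff T_scale algebra_simps power2_eq_square)
    finally show ?thesis .
  qed
  note prod1 = prod[of z "cnj z", OF E]
  note prod2 = prod[of "cnj z" z, unfolded add.commute[of "cnj z"] mult.commute[of "cnj z" z], OF E]
  \<comment> \<open>\<open>M' - S\<close> is bounded below by \<open>M' - \<rho>\<close>, and it
    factors as \<open>T - cnj z\<close> after \<open>T - z\<close>. Boundedness of the outer factor
    passes the lower bound on to \<open>T - z\<close>.\<close>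
  have below: "ell2_norm f \<le> (C + cmod z) / (M' - \<rho>) * ell2_norm (?R z f)" if f: "f \<in> ell2" for f
  proof -
    have "M' * ell2_norm f = ell2_norm (\<lambda>v. of_real M' * f v)"
      unfolding ell2_norm_scale norm_of_real using \<rho> \<rho>0 by simp
    also have "\<dots> = ell2_norm (\<lambda>v. (of_real M' * f v - S f v) + S f v)" by simp
    also have "\<dots> \<le> ell2_norm (\<lambda>v. of_real M' * f v - S f v) + ell2_norm (S f)"
      using S_bounded[OF \<rho>(1) f] f by (intro ell2_add(2) ell2_diff ell2_scale) auto
    also have "(\<lambda>v. of_real M' * f v - S f v) = ?R (cnj z) (?R z f)"
      by (intro ext) (simp add: prod2)
    also have "ell2_norm \<dots> \<le> (C + cmod z) * ell2_norm (?R z f)"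
      using Rb[OF Rl[OF f, of z], of "cnj z"] by simp
    finally have "(M' - \<rho>) * ell2_norm f \<le> (C + cmod z) * ell2_norm (?R z f)"
      using S_bounded[OF \<rho>(1) f] by (simp add: algebra_simps)
    then show ?thesis using \<rho> by (simp add: field_simps)
  qed
  have "bij_betw (?R z) ell2 ell2"
  proof (rule bij_betwI')
    fix f g :: "'v \<Rightarrow> complex" assume fg: "f \<in> ell2" "g \<in> ell2"
    show "(?R z f = ?R z g) = (f = g)"
    proof
      assume eq: "?R z f = ?R z g"
      have "?R z (\<lambda>v. f v - g v) = (\<lambda>v. ?R z f v - ?R z g v)"
        by (simp add: T_diff algebra_simps)
      also have "\<dots> = (\<lambda>v. 0 * f v)" using eq by (simp add: fun_eq_iff)
      finally have "ell2_norm (?R z (\<lambda>v. f v - g v)) = 0" by (simp only: ell2_norm_scale) simp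
      then have "ell2_norm (\<lambda>v. f v - g v) \<le> 0" using below[OF ell2_diff(1)[OF fg]] by simp
      from ell2_eq_0[OF ell2_diff(1)[OF fg] this] show "f = g" by (simp add: fun_eq_iff)
    qed simp
  next
    fix f :: "'v \<Rightarrow> complex" assume "f \<in> ell2"
    then show "?R z f \<in> ell2" by (rule Rl)
  next
    fix g :: "'v \<Rightarrow> complex" assume "g \<in> ell2"
    from S.neumann_solution[OF S_bounded[OF \<rho>(1)] \<rho>0 \<rho>(2) this]
    obtain h where h: "h \<in> ell2" "\<And>v. of_real M' * h v - S h v = g v" by blast
    \<comment> \<open>The other order of the factors gives surjectivity: the preimage of
      \<open>g\<close> is \<open>T - cnj z\<close> applied to the Neumann solution.\<close>
    have "g = ?R z (?R (cnj z) h)" using h(2) by (intro ext) (simp only: prod1)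
    then show "\<exists>f\<in>ell2. g = ?R z f" using Rl[OF h(1)] by blast
  qed
  then show ?thesis unfolding ell2_spectrum_def using below by blast
qed

text \<open>At a nonreal point the power series of \<open>V\<close> is the Neumann series for
  \<open>M + \<tau>\<^sup>2 - S\<close> applied to a ket, so it converges in \<open>ell2\<close>.
  This identifies the formal column with a square-summable vector, from which \<open>u\<close> is
  recovered as \<open>(T - E) Q + \<zeta> Q\<close>.\<close>

lemma u_ell2_aux:
  assumes "\<tau> \<noteq> 0" "d = 0"
  shows "u x (Complex E \<tau>) \<in> ell2"
proof -
  define \<zeta> where "\<zeta> = Complex 0 \<tau>"
  \<comment> \<open>Chosen so that \<open>M - 1 / w = - \<tau>\<^sup>2\<close>, the square of
    \<open>\<zeta>\<close>.\<close>
  define w where "w = complex_of_real (1 / (M + \<tau>\<^sup>2))"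
  define \<rho> where "\<rho> = M + \<tau>\<^sup>2 / 2"
  have \<tau>: "\<tau>\<^sup>2 > 0" using assms by simp
  have \<rho>: "\<rho> > M - d" "\<rho> > 0" "\<rho> < M + \<tau>\<^sup>2" using \<tau> assms(2) d unfolding \<rho>_def by (simp_all add: add_pos_pos)
  have pos: "M + \<tau>\<^sup>2 > 0" using \<tau> d by (intro add_pos_pos) auto
  have \<zeta>: "\<zeta>\<^sup>2 = of_real M - 1 / w" "\<zeta> \<noteq> 0"
    using assms d \<tau> by (auto simp: \<zeta>_def w_def complex_eq_iff power2_eq_square)
  have "w \<noteq> 0" using pos by (simp add: w_def del: of_real_add of_real_divide)
  have wn: "cmod w = 1 / (M + \<tau>\<^sup>2)" using d \<tau> pos unfolding w_def norm_of_real by simp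
  have w: "w \<in> ball 0 (1 / (M - d))"
    using assms d \<tau> wn by (simp add: frac_less2)
  have om: "\<zeta> \<in> \<Omega>" unfolding \<Omega>_def \<zeta>_def using assms by (auto simp: complex_eq_iff)
  have VQ: "V x y w = Q x y \<zeta>" for y
  proof -
    \<comment> \<open>The principal root may be the wrong one of the two; evenness of
      \<open>Q\<close> makes this harmless.\<close>
    have "csqrt (of_real M - 1 / w) = \<zeta> \<or> csqrt (of_real M - 1 / w) = - \<zeta>"
      unfolding \<zeta>(1)[symmetric] by (metis power2_csqrt power2_eq_iff)
    then show ?thesis using Q_even[OF om] \<open>w \<noteq> 0\<close> by (auto simp: V_def)
  qed
  have "finite {v. ket x v \<noteq> 0}" by (simp add: ket_support)
  interpret S: local_symmetric S by (rule local_symmetric_S)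
  have ke: "(S ^^ n) (ket x) \<in> ell2 \<and> ell2_norm ((S ^^ n) (ket x)) \<le> ell2_norm (ket x) * \<rho> ^ n" for n
  proof (induction n)
    case 0 then show ?case by (simp add: ket_ell2)
  next
    case (Suc n)
    then have "\<rho> * ell2_norm ((S ^^ n) (ket x)) \<le> \<rho> * (ell2_norm (ket x) * \<rho> ^ n)"
      using \<rho>(2) by (intro mult_left_mono) auto
    with S_bounded[OF \<rho>(1), of "(S ^^ n) (ket x)"] Suc show ?case by (auto simp: mult_ac)
  qed
  define q where "q = (\<lambda>n y. w ^ Suc n * (S ^^ n) (ket x) y)"
  have q: "q n \<in> ell2" "ell2_norm (q n) \<le> (cmod w * ell2_norm (ket x)) * (cmod w * \<rho>) ^ n" for n
  proof -
    show "q n \<in> ell2" unfolding q_def using ke by (intro ell2_scale) auto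
    have "ell2_norm (q n) = cmod w ^ Suc n * ell2_norm ((S ^^ n) (ket x))"
      unfolding q_def ell2_norm_scale by (simp add: norm_power norm_mult)
    also have "\<dots> \<le> cmod w ^ Suc n * (ell2_norm (ket x) * \<rho> ^ n)" using ke by (intro mult_left_mono) auto
    finally show "ell2_norm (q n) \<le> (cmod w * ell2_norm (ket x)) * (cmod w * \<rho>) ^ n"
      by (simp add: power_mult_distrib mult_ac)
  qed
  have "cmod w * \<rho> < 1" unfolding wn using \<rho> by simp
  then have sum_l: "(\<lambda>y. \<Sum>n. q n y) \<in> ell2" using \<rho> by (intro ell2_series[OF q]) auto
  have "(\<Sum>n. q n y) = Q x y \<zeta>" for y
  proof -
    have "(\<lambda>n. coef x y n * w ^ n) sums V x y w"
      using holomorphic_power_series[OF V_holomorphic w, of x y] by (simp add: coef_def)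
    then have "(\<lambda>n. coef x y (Suc n) * w ^ Suc n) sums V x y w"
      by (subst sums_Suc_iff) (simp add: coef_rec)
    moreover have "coef x y (Suc n) * w ^ Suc n = q n y" for n
      using coef_moment[of x n] by (simp add: fun_eq_iff q_def mult.commute)
    ultimately show ?thesis using VQ by (simp add: sums_iff)
  qed
  with sum_l have Ql: "(\<lambda>y. Q x y \<zeta>) \<in> ell2" by simp
  obtain C where C: "\<And>f. f \<in> ell2 \<Longrightarrow> T f \<in> ell2" using T_bounded by blast
  have "u x (Complex E \<tau>) = (\<lambda>y. (T (\<lambda>y. Q x y \<zeta>) y - of_real E * Q x y \<zeta>) + \<zeta> * Q x y \<zeta>)"
  proof
    fix y
    have "Complex E \<tau> = of_real E + \<zeta>" by (simp add: \<zeta>_def complex_eq_iff)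
    then show "u x (Complex E \<tau>) y = (T (\<lambda>y. Q x y \<zeta>) y - of_real E * Q x y \<zeta>) + \<zeta> * Q x y \<zeta>"
    proof -
      assume e: "Complex E \<tau> = of_real E + \<zeta>"
      have "\<zeta> * Q x y \<zeta> = (u x (of_real E + \<zeta>) y - u x (of_real E - \<zeta>) y) / 2"
        by (simp only: Q_nonzero[OF \<zeta>(2)]) (use \<zeta>(2) in simp)
      then show ?thesis by (simp only: Q_eq(1)[OF om \<zeta>(2)] e) (simp add: field_simps)
    qed
  qed
  also have "\<dots> \<in> ell2" by (intro ell2_add(1) ell2_diff(1) ell2_scale Ql C)
  finally show ?thesis .
qed

end

lemma square_dist_bound:
  obtains M where "M > d" "\<forall>x\<in>K. (x - E)\<^sup>2 \<le> M"
proof -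
  have "bounded ((\<lambda>x. (x - E)\<^sup>2) ` K)"
    by (intro compact_imp_bounded compact_continuous_image K continuous_intros)
  then obtain B where "\<forall>y\<in>(\<lambda>x. (x - E)\<^sup>2) ` K. \<bar>y\<bar> \<le> B" unfolding bounded_iff real_norm_def by blast
  then show thesis by (intro that[of "max B (d + 1)"]) (auto simp: le_max_iff_disj)
qed

text \<open>For real \<open>z\<close> the gap \<open>d\<close> is the squared distance to
  \<open>K\<close>. For nonreal \<open>z\<close> one takes \<open>d = 0\<close> and the positive
  number \<open>\<tau>\<^sup>2\<close> plays the role of the gap.\<close>

theorem spectrum_subset: "ell2_spectrum T \<subseteq> complex_of_real ` K"
proof (rule subsetI, rule ccontr)
  fix z assume z: "z \<in> ell2_spectrum T" "z \<notin> complex_of_real ` K"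
  define E \<tau> where "E = Re z" and "\<tau> = Im z"
  have "\<exists>d\<ge>0. d + \<tau>\<^sup>2 > 0 \<and> (\<forall>x\<in>K. d \<le> (x - E)\<^sup>2)"
  proof (cases "\<tau> = 0")
    case True
    then have "z = of_real E" by (simp add: E_def \<tau>_def complex_eq_iff)
    then have "E \<notin> K" using z by auto
    then obtain e where e: "e > 0" "\<And>x. x \<in> K \<Longrightarrow> e \<le> dist E x"
      using separate_point_closed[OF compact_imp_closed[OF K]] by blast
    have "e\<^sup>2 \<le> (x - E)\<^sup>2" if "x \<in> K" for x
      using power_mono[OF e(2)[OF that], of 2] e(1) by (simp add: dist_real_def power2_commute)
    then show ?thesis using e by (intro exI[of _ "e\<^sup>2"]) (auto simp: True)
  qed auto
  then obtain d where d: "d \<ge> 0" "d + \<tau>\<^sup>2 > 0" "\<And>x. x \<in> K \<Longrightarrow> d \<le> (x - E)\<^sup>2" by blast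
  obtain M where M: "M > d" "\<And>x. x \<in> K \<Longrightarrow> (x - E)\<^sup>2 \<le> M"
    by (rule square_dist_bound) blast
  then have "z \<notin> ell2_spectrum T"
    using d by (intro not_in_spectrum_aux[of d M E \<tau>]) (auto simp: M E_def \<tau>_def)
  with z show False by simp
qed

lemma u_ell2: assumes "Im z \<noteq> 0" shows "u x z \<in> ell2"
proof -
  obtain M where M: "M > 0" "\<And>x. x \<in> K \<Longrightarrow> (x - Re z)\<^sup>2 \<le> M"
    by (rule square_dist_bound) blast
  from u_ell2_aux[of 0 M "Re z" "Im z" x, OF _ _ _ assms refl] M show ?thesis by auto
qed

end

section \<open>Compactly supported measures and sign changes of polynomials\<close>

definition pint :: "real measure \<Rightarrow> real poly \<Rightarrow> real" where
  "pint M p = (\<integral>x. poly p x \<partial>M)"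

definition ptransform :: "real measure \<Rightarrow> real poly \<Rightarrow> complex \<Rightarrow> complex" where
  "ptransform M p z = (\<integral>x. complex_of_real (poly p x) / (z - complex_of_real x) \<partial>M)"

lemma stieltjes_eq_ptransform: "stieltjes M z = ptransform M 1 z"
  by (simp add: stieltjes_def ptransform_def)

locale compact_measure = finite_measure M for M :: "real measure" +
  assumes sets_M: "sets M = sets borel" and compact_supp: "compact (measure_supp M)"
    and infinite_supp: "infinite (measure_supp M)"
begin

lemma space_M: "space M = UNIV"
  using sets_eq_imp_space_eq[OF sets_M] by simp

text \<open>The complement of the support is a union of open null sets, and by Lindelof countably
  many of them suffice.\<close>

lemma AE_supp: "AE x in M. x \<in> measure_supp M"
proof -
  define F where "F = {U. open U \<and> emeasure M U = 0}"
  obtain F' where F': "F' \<subseteq> F" "countable F'" "\<Union>F' = \<Union>F"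
    using Lindelof[of F] by (auto simp: F_def)
  have "(\<Union>U\<in>F'. U) \<in> null_sets M"
    by (rule null_sets_UN'[OF F'(2)]) (use F'(1) in \<open>auto simp: F_def null_sets_def sets_M\<close>)
  then have "\<Union>F \<in> null_sets M" using F'(3) by simp
  then show ?thesis
    by (rule AE_I'[rotated, rotated, of _ _ "\<lambda>x. x \<in> measure_supp M", simplified])
      (auto simp: measure_supp_def F_def zero_less_iff_neq_zero)
qed

lemma measurable_M: "f \<in> borel_measurable borel \<Longrightarrow> f \<in> borel_measurable M"
  using measurable_cong_sets[OF sets_M refl] by blast

lemma integrable_bounded:
  fixes f :: "real \<Rightarrow> 'a::{banach, second_countable_topology}"
  assumes "f \<in> borel_measurable borel" "\<And>x. x \<in> measure_supp M \<Longrightarrow> norm (f x) \<le> B"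
  shows "integrable M f"
  by (rule integrable_const_bound[where B = B]) (use assms AE_supp measurable_M in auto)

lemma integrable_continuous:
  fixes f :: "real \<Rightarrow> 'a::{banach, second_countable_topology}"
  assumes "f \<in> borel_measurable borel" "continuous_on (measure_supp M) f"
  shows "integrable M f"
proof -
  have "bounded (f ` measure_supp M)"
    by (intro compact_imp_bounded compact_continuous_image assms compact_supp)
  then obtain B where "\<forall>x\<in>f ` measure_supp M. norm x \<le> B" unfolding bounded_iff by blast
  then show ?thesis by (intro integrable_bounded[OF assms(1), of B]) auto
qed

lemma norm_integral_le:
  fixes f :: "real \<Rightarrow> complex"
  assumes "f \<in> borel_measurable borel" "\<And>x. x \<in> measure_supp M \<Longrightarrow> norm (f x) \<le> B"
  shows "norm (\<integral>x. f x \<partial>M) \<le> B * measure M UNIV"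
proof -
  have "norm (\<integral>x. f x \<partial>M) \<le> (\<integral>x. norm (f x) \<partial>M)" by simp
  also have "\<dots> \<le> (\<integral>x. B \<partial>M)"
    by (rule integral_mono_AE) (use AE_supp assms in \<open>auto intro!: integrable_bounded\<close>)
  finally show ?thesis by (simp add: space_M mult.commute)
qed

lemma poly_integrable: "integrable M (poly p)"
  by (intro integrable_continuous borel_measurable_continuous_onI continuous_intros)

lemma pint_add: "pint M (p + q) = pint M p + pint M q"
  by (simp add: pint_def poly_integrable)

lemma pint_diff: "pint M (p - q) = pint M p - pint M q"
  by (simp add: pint_def poly_integrable)

lemma pint_smult: "pint M (smult c p) = c * pint M p"
  by (simp add: pint_def)

lemma pint_0: "pint M 0 = 0" by (simp add: pint_def)

lemma pint_sum: "finite A \<Longrightarrow> pint M (\<Sum>i\<in>A. f i) = (\<Sum>i\<in>A. pint M (f i))"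
  by (induction A rule: finite_induct) (auto simp: pint_0 pint_add)

lemma pint_1: "pint M 1 = measure M UNIV"
  by (simp add: pint_def space_M)

lemma integral_pos:
  fixes f :: "real \<Rightarrow> real"
  assumes f: "f \<in> borel_measurable borel" "integrable M f"
    and nn: "\<And>x. x \<in> measure_supp M \<Longrightarrow> f x \<ge> 0"
    and x: "x \<in> measure_supp M" "isCont f x" "f x > 0"
  shows "(\<integral>x. f x \<partial>M) > 0"
proof -
  have AE: "AE x in M. f x \<ge> 0" using AE_supp nn by auto
  have "(\<integral>x. f x \<partial>M) \<noteq> 0"
  proof
    assume "(\<integral>x. f x \<partial>M) = 0"
    then have 0: "AE x in M. f x = 0" using integral_nonneg_eq_0_iff_AE[OF f(2) AE] by simp
    have "\<forall>\<^sub>F y in nhds x. f y > 0"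
      using x by (intro order_tendstoD(1)) (auto simp: isCont_def tendsto_at_iff_tendsto_nhds)
    then obtain U where U: "open U" "x \<in> U" "\<And>y. y \<in> U \<Longrightarrow> f y > 0"
      unfolding eventually_nhds by blast
    have "AE y in M. y \<notin> U" using 0 by eventually_elim (use U in force)
    then have "emeasure M U = 0"
      using AE_iff_measurable[of U M "\<lambda>y. y \<notin> U"] U(1) by (auto simp: sets_M space_M)
    then show False using x(1) U by (auto simp: measure_supp_def)
  qed
  moreover have "(\<integral>x. f x \<partial>M) \<ge> 0" by (rule integral_nonneg_AE[OF AE])
  ultimately show ?thesis by simp
qed

lemma supp_nonroot: "p \<noteq> (0 :: real poly) \<Longrightarrow> \<exists>x\<in>measure_supp M. poly p x \<noteq> 0"
  using infinite_supp poly_roots_finite[of p] finite_subset[of "measure_supp M" "{x. poly p x = 0}"] by blast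

lemma pint_pos:
  assumes "p \<noteq> 0" "\<And>x. x \<in> measure_supp M \<Longrightarrow> poly p x \<ge> 0"
  shows "pint M p > 0"
proof -
  obtain x where "x \<in> measure_supp M" "poly p x \<noteq> 0" using supp_nonroot[OF assms(1)] by blast
  then show ?thesis unfolding pint_def
    using assms(2) by (intro integral_pos[of _ x] poly_integrable)
      (auto intro!: borel_measurable_continuous_onI continuous_intros simp: order.not_eq_order_implies_strict less_le)
qed

lemma total_mass_pos: "measure M UNIV > 0"
  using pint_pos[of 1] by (simp add: pint_1)

lemma supp_of_real_closed: "closed (complex_of_real ` measure_supp M)"
  by (intro compact_imp_closed compact_continuous_image compact_supp continuous_intros)

lemma kernel_measurable: "(\<lambda>x. complex_of_real (poly p x) / (z - complex_of_real x)) \<in> borel_measurable borel"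
proof -
  have "(\<lambda>x. complex_of_real (poly p x)) \<in> borel_measurable borel"
    "(\<lambda>x. z - complex_of_real x) \<in> borel_measurable borel"
    by (intro borel_measurable_continuous_onI continuous_intros)+
  then show ?thesis by measurable
qed

lemma kernel_integrable:
  assumes "z \<notin> complex_of_real ` measure_supp M"
  shows "integrable M (\<lambda>x. complex_of_real (poly p x) / (z - complex_of_real x))"
  by (rule integrable_continuous[OF kernel_measurable]) (use assms in \<open>auto intro!: continuous_intros\<close>)

lemma ptransform_add:
  assumes "z \<notin> complex_of_real ` measure_supp M"
  shows "ptransform M (p + q) z = ptransform M p z + ptransform M q z"
  unfolding ptransform_def using kernel_integrable[OF assms] by (simp add: add_divide_distrib)

lemma ptransform_smult: "ptransform M (smult c p) z = of_real c * ptransform M p z"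
  unfolding ptransform_def integral_mult_right_zero[symmetric] by (simp add: mult.assoc)

lemma ptransform_0: "ptransform M 0 z = 0"
  by (simp add: ptransform_def)

lemma ptransform_X_mult:
  assumes "z \<notin> complex_of_real ` measure_supp M"
  shows "ptransform M ([:0, 1:] * p) z = z * ptransform M p z - of_real (pint M p)"
proof -
  have "ptransform M ([:0, 1:] * p) z = (\<integral>x. z * (complex_of_real (poly p x) / (z - complex_of_real x)) - complex_of_real (poly p x) \<partial>M)"
    unfolding ptransform_def
  proof (rule integral_cong_AE)
    show "AE x in M. complex_of_real (poly ([:0, 1:] * p) x) / (z - complex_of_real x) =
        z * (complex_of_real (poly p x) / (z - complex_of_real x)) - complex_of_real (poly p x)"
      using AE_supp
    proof eventually_elim
      case (elim x)
      then have "z \<noteq> of_real x" using assms by auto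
      then show ?case by (simp add: field_simps)
    qed
  qed (intro measurable_M kernel_measurable borel_measurable_diff borel_measurable_times
      borel_measurable_continuous_onI continuous_intros)+
  also have "\<dots> = z * ptransform M p z - (\<integral>x. complex_of_real (poly p x) \<partial>M)"
    unfolding ptransform_def
    using kernel_integrable[OF assms, of p] poly_integrable[of p]
    by (subst Bochner_Integration.integral_diff) (auto simp del: times_divide_eq_right)
  finally show ?thesis by (simp add: pint_def)
qed

lemma ptransform_cnj: "ptransform M p (cnj z) = cnj (ptransform M p z)"
  unfolding ptransform_def by (simp flip: Bochner_Integration.integral_cnj)

lemma supp_bound: "\<exists>B>0. \<forall>x\<in>measure_supp M. \<bar>x\<bar> \<le> B \<and> \<bar>poly p x\<bar> \<le> B"
proof -
  have "bounded (poly p ` measure_supp M)" "bounded (measure_supp M)"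
    by (intro compact_imp_bounded compact_continuous_image compact_supp continuous_intros)+
  then obtain B C where "\<forall>x\<in>measure_supp M. \<bar>poly p x\<bar> \<le> B" "\<forall>x\<in>measure_supp M. \<bar>x\<bar> \<le> C"
    unfolding bounded_iff by auto
  then show ?thesis by (intro exI[of _ "max 1 (max B C)"]) (auto simp: le_max_iff_disj)
qed

lemma ptransform_at_infinity: "(ptransform M p \<longlongrightarrow> 0) at_infinity"
proof -
  obtain B where B: "B > 0" "\<And>x. x \<in> measure_supp M \<Longrightarrow> \<bar>x\<bar> \<le> B \<and> \<bar>poly p x\<bar> \<le> B"
    using supp_bound by blast
  show ?thesis
  proof (rule Lim_null_comparison)
    show "\<forall>\<^sub>F z in at_infinity. norm (ptransform M p z) \<le> (2 * B * measure M UNIV) * norm (inverse z)"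
      unfolding eventually_at_infinity
    proof (intro exI[of _ "2 * B"] allI impI)
      fix z :: complex assume z: "2 * B \<le> norm z"
      have "norm (ptransform M p z) \<le> (B / (norm z / 2)) * measure M UNIV"
        unfolding ptransform_def
      proof (rule norm_integral_le[OF kernel_measurable])
        fix x assume x: "x \<in> measure_supp M"
        have "norm z / 2 \<le> norm z - \<bar>x\<bar>" using z B(2)[OF x] by linarith
        also have "\<dots> \<le> norm (z - of_real x)" by (metis norm_of_real norm_triangle_ineq2)
        finally have 1: "norm z / 2 \<le> norm (z - of_real x)" .
        have "norm z > 0" using z B(1) by linarith
        then have "\<bar>poly p x\<bar> / norm (z - of_real x) \<le> B / (norm z / 2)"
          using B(2)[OF x] B(1) 1 by (intro frac_le) auto
        then show "norm (complex_of_real (poly p x) / (z - complex_of_real x)) \<le> B / (norm z / 2)"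
          by (simp add: norm_divide)
      qed
      then show "norm (ptransform M p z) \<le> (2 * B * measure M UNIV) * norm (inverse z)"
        by (simp add: norm_divide inverse_eq_divide mult.commute)
    qed
    show "((\<lambda>z::complex. (2 * B * measure M UNIV) * norm (inverse z)) \<longlongrightarrow> 0) at_infinity"
      by (intro tendsto_mult_right_zero tendsto_norm_zero tendsto_inverse_0)
  qed
qed

text \<open>The derivative is obtained directly from difference quotients: their deviation from
  \<open>D\<close> is the integral of \<open>p * (z - w) / ((z - x) * (w - x)\<^sup>2)\<close>,
  which is of first order in \<open>z - w\<close>.\<close>

lemma ptransform_holomorphic: "ptransform M p holomorphic_on - (complex_of_real ` measure_supp M)"
proof (rule holomorphic_onI)
  fix w assume w: "w \<in> - (complex_of_real ` measure_supp M)"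
  let ?S = "measure_supp M"
  obtain B where B: "B > 0" "\<And>x. x \<in> ?S \<Longrightarrow> \<bar>x\<bar> \<le> B \<and> \<bar>poly p x\<bar> \<le> B"
    using supp_bound by blast
  obtain e where e: "e > 0" "\<And>x. x \<in> complex_of_real ` ?S \<Longrightarrow> e \<le> dist w x"
    using separate_point_closed[OF supp_of_real_closed] w by blast
  define D where "D = (\<integral>x. - (complex_of_real (poly p x) / (w - complex_of_real x)\<^sup>2) \<partial>M)"
  have mD: "(\<lambda>x. - (complex_of_real (poly p x) / (w - complex_of_real x)\<^sup>2)) \<in> borel_measurable borel"
  proof -
    have "(\<lambda>x. complex_of_real (poly p x)) \<in> borel_measurable borel"
      "(\<lambda>x. (w - complex_of_real x)\<^sup>2) \<in> borel_measurable borel"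
      by (intro borel_measurable_continuous_onI continuous_intros)+
    then show ?thesis by measurable
  qed
  have iD: "integrable M (\<lambda>x. - (complex_of_real (poly p x) / (w - complex_of_real x)\<^sup>2))"
    by (rule integrable_continuous[OF mD]) (use w in \<open>auto intro!: continuous_intros\<close>)
  have "((\<lambda>z. (ptransform M p z - ptransform M p w) / (z - w)) \<longlongrightarrow> D) (at w)"
  proof (rule Lim_null[THEN iffD2], rule Lim_null_comparison)
    \<comment> \<open>On the support \<open>p\<close> is bounded by \<open>B\<close> and
      \<open>w - x\<close> is at least \<open>e\<close> in modulus; for \<open>z\<close> within
      \<open>e / 2\<close> of \<open>w\<close>, \<open>z - x\<close> is at least
      \<open>e / 2\<close>, whence the factor 2.\<close>
    let ?C = "2 * B / e ^ 3 * measure M UNIV"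
    show "((\<lambda>z. ?C * norm (z - w)) \<longlongrightarrow> 0) (at w)"
      by (intro tendsto_mult_right_zero tendsto_norm_zero LIM_zero tendsto_ident_at)
    have "\<forall>\<^sub>F z in at w. z \<in> ball w (e / 2) - {w}"
      by (rule eventually_at_in_open) (use e in auto)
    then show "\<forall>\<^sub>F z in at w. norm ((ptransform M p z - ptransform M p w) / (z - w) - D) \<le> ?C * norm (z - w)"
    proof eventually_elim
      case (elim z)
      then have zw: "z \<noteq> w" "dist z w < e / 2" by (auto simp: dist_commute)
      have far: "e \<le> cmod (w - of_real x)" "e / 2 \<le> cmod (z - of_real x)" if "x \<in> ?S" for x
      proof -
        show 1: "e \<le> cmod (w - of_real x)" using e(2)[of "of_real x"] that by (auto simp: dist_norm)
        have "cmod (w - of_real x) \<le> cmod (w - z) + cmod (z - of_real x)"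
          using norm_triangle_ineq[of "w - z" "z - of_real x"] by simp
        then show "e / 2 \<le> cmod (z - of_real x)" using 1 zw(2) by (simp add: dist_norm norm_minus_commute)
      qed
      have zS: "z \<notin> complex_of_real ` ?S" using far(2) e(1) by force
      have "(ptransform M p z - ptransform M p w) / (z - w) - D
        = (\<integral>x. (complex_of_real (poly p x) / (z - complex_of_real x) - complex_of_real (poly p x) / (w - complex_of_real x)) / (z - w)
              - - (complex_of_real (poly p x) / (w - complex_of_real x)\<^sup>2) \<partial>M)"
      proof -
        have k: "integrable M (\<lambda>x. complex_of_real (poly p x) / (z - complex_of_real x))"
          "integrable M (\<lambda>x. complex_of_real (poly p x) / (w - complex_of_real x))"
          using kernel_integrable[OF zS] kernel_integrable[of w] w by auto
        note d = Bochner_Integration.integrable_diff[OF k]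
        show ?thesis
          unfolding ptransform_def D_def Bochner_Integration.integral_diff[OF k, symmetric]
            integral_divide_zero[symmetric]
          by (rule Bochner_Integration.integral_diff[symmetric, OF integrable_divide_zero[OF d] iD])
      qed
      also have "norm \<dots> \<le> (B * cmod (z - w) / (e / 2 * e\<^sup>2)) * measure M UNIV"
      proof (rule norm_integral_le)
        show "(\<lambda>x. (complex_of_real (poly p x) / (z - complex_of_real x) - complex_of_real (poly p x) / (w - complex_of_real x)) / (z - w)
              - - (complex_of_real (poly p x) / (w - complex_of_real x)\<^sup>2)) \<in> borel_measurable borel"
          by (intro borel_measurable_diff borel_measurable_divide kernel_measurable mD) auto
        fix x assume x: "x \<in> ?S"
        have ne: "z - of_real x \<noteq> 0" "w - of_real x \<noteq> 0" "z - w \<noteq> 0" using far[OF x] e(1) zw by auto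
        have "(1 / (z - complex_of_real x) - 1 / (w - complex_of_real x)) / (z - w)
              + 1 / (w - complex_of_real x)\<^sup>2 = (z - w) / ((z - of_real x) * (w - of_real x)\<^sup>2)"
        proof -
          define a b where "a = z - complex_of_real x" and "b = w - complex_of_real x"
          have ab: "z - w = a - b" "a \<noteq> 0" "b \<noteq> 0" "a - b \<noteq> 0" using ne by (auto simp: a_def b_def)
          have "(1 / a - 1 / b) / (a - b) = - 1 / (a * b)" using ab by (simp add: divide_simps)
          then show ?thesis unfolding ab(1) a_def[symmetric] b_def[symmetric]
            using ab by (simp add: divide_simps power2_eq_square) (simp add: algebra_simps)
        qed
        then have "of_real (poly p x) * ((1 / (z - complex_of_real x) - 1 / (w - complex_of_real x)) / (z - w)
              + 1 / (w - complex_of_real x)\<^sup>2) = of_real (poly p x) * ((z - w) / ((z - of_real x) * (w - of_real x)\<^sup>2))" by simp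
        then have eq: "(complex_of_real (poly p x) / (z - complex_of_real x) - complex_of_real (poly p x) / (w - complex_of_real x)) / (z - w)
              - - (complex_of_real (poly p x) / (w - complex_of_real x)\<^sup>2)
            = of_real (poly p x) * (z - w) / ((z - of_real x) * (w - of_real x)\<^sup>2)"
          by (simp add: algebra_simps diff_divide_distrib)
        have "\<bar>poly p x\<bar> * cmod (z - w) / (cmod (z - of_real x) * (cmod (w - of_real x))\<^sup>2)
            \<le> B * cmod (z - w) / (e / 2 * e\<^sup>2)"
          using far[OF x] B e(1) x by (intro frac_le mult_mono power_mono mult_pos_pos) auto
        then show "norm ((complex_of_real (poly p x) / (z - complex_of_real x) - complex_of_real (poly p x) / (w - complex_of_real x)) / (z - w)
              - - (complex_of_real (poly p x) / (w - complex_of_real x)\<^sup>2)) \<le> B * cmod (z - w) / (e / 2 * e\<^sup>2)"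
          unfolding eq by (simp add: norm_mult norm_divide norm_power)
      qed
      also have "\<dots> = ?C * norm (z - w)" by (simp add: power3_eq_cube power2_eq_square mult_ac)
      finally show ?case .
    qed
  qed
  then have "(ptransform M p has_field_derivative D) (at w)" by (simp add: has_field_derivative_iff)
  then show "ptransform M p field_differentiable at w within - (complex_of_real ` ?S)"
    using field_differentiable_at_within field_differentiable_def by blast
qed

end

text \<open>\<open>R\<close> collects sign changes of \<open>q\<close>. Each time a root
  \<open>c\<close> is divided out, membership of \<open>c\<close> in the set for the quotient is
  toggled, because a double factor \<open>(x - c)\<^sup>2\<close> has no influence on the sign.
  Divisibility bounds \<open>card R\<close> by the degree and makes every point of \<open>R\<close>
  a root.\<close>

lemma sign_change_factor:
  fixes q :: "real poly"
  assumes "q \<noteq> 0"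
  shows "\<exists>R s. finite R \<and> R \<subseteq> {l..r} \<and> \<bar>s\<bar> = 1 \<and> (\<Prod>a\<in>R. [:- a, 1:]) dvd q \<and>
    (\<forall>x\<in>{l..r}. s * poly (q * (\<Prod>a\<in>R. [:- a, 1:])) x \<ge> 0)"
  using assms
proof (induction "degree q" arbitrary: q rule: less_induct)
  case less
  show ?case
  proof (cases "(\<forall>x\<in>{l..r}. poly q x \<ge> 0) \<or> (\<forall>x\<in>{l..r}. poly q x \<le> 0)")
    case True
    then show ?thesis
    proof
      assume "\<forall>x\<in>{l..r}. poly q x \<ge> 0"
      then show ?thesis by (intro exI[of _ "{}"] exI[of _ 1]) auto
    next
      assume "\<forall>x\<in>{l..r}. poly q x \<le> 0"
      then show ?thesis by (intro exI[of _ "{}"] exI[of _ "-1"]) auto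
    qed
  next
    case False
    then obtain x y where xy: "x \<in> {l..r}" "y \<in> {l..r}" "poly q x < 0" "poly q y > 0"
      by (auto simp: not_le)
    have "\<exists>c\<in>{l..r}. poly q c = 0"
    proof (cases "x < y")
      case True
      from poly_IVT[OF this, of q] xy show ?thesis by (force simp: mult_neg_pos)
    next
      case False
      then have "y < x" using xy by (cases "x = y") auto
      from poly_IVT[OF this, of q] xy show ?thesis by (force simp: mult_pos_neg)
    qed
    then obtain c where c: "c \<in> {l..r}" "poly q c = 0" by blast
    then obtain q' where q': "q = [:- c, 1:] * q'" using poly_eq_0_iff_dvd by (auto simp: dvd_def)
    have nz: "q' \<noteq> 0" using less.prems q' by auto
    have deg: "degree q' < degree q" using q' nz by (subst q', subst degree_mult_eq) auto
    obtain R s where R: "finite R" "R \<subseteq> {l..r}" "\<bar>s\<bar> = 1" "(\<Prod>a\<in>R. [:- a, 1:]) dvd q'"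
      "\<And>x. x \<in> {l..r} \<Longrightarrow> s * poly (q' * (\<Prod>a\<in>R. [:- a, 1:])) x \<ge> 0"
      using less.hyps[OF deg nz] by blast
    show ?thesis
    proof (cases "c \<in> R")
      case True
      have pr: "(\<Prod>a\<in>R. [:- a, 1:]) = [:- c, 1:] * (\<Prod>a\<in>R - {c}. [:- a, 1:])"
        using R(1) True by (rule prod.remove)
      have eq: "q * (\<Prod>a\<in>R - {c}. [:- a, 1:]) = q' * (\<Prod>a\<in>R. [:- a, 1:])"
        unfolding pr q' by (simp only: mult_ac)
      have "(\<Prod>a\<in>R - {c}. [:- a, 1:]) dvd q"
        using R(4) unfolding pr q' by (metis dvd_mult dvd_mult_right)
      then show ?thesis
        using R eq by (intro exI[of _ "R - {c}"] exI[of _ s]) auto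
    next
      case False
      have pr: "(\<Prod>a\<in>insert c R. [:- a, 1:]) = [:- c, 1:] * (\<Prod>a\<in>R. [:- a, 1:])"
        using R(1) False by simp
      have eq: "poly (q * (\<Prod>a\<in>insert c R. [:- a, 1:])) x
         = (x - c)\<^sup>2 * poly (q' * (\<Prod>a\<in>R. [:- a, 1:])) x" for x
        unfolding pr q' by (simp add: power2_eq_square algebra_simps)
      have "s * poly (q * (\<Prod>a\<in>insert c R. [:- a, 1:])) x \<ge> 0" if "x \<in> {l..r}" for x
        unfolding eq using mult_nonneg_nonneg[OF zero_le_power2[of "x - c"] R(5)[OF that]]
        by (simp only: mult_ac)
      moreover have "(\<Prod>a\<in>insert c R. [:- a, 1:]) dvd q"
        unfolding pr q' using R(4) by (intro mult_dvd_mono) auto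
      ultimately show ?thesis
        using R c by (intro exI[of _ "insert c R"] exI[of _ s]) auto
    qed
  qed
qed

lemma linear_factor_prod:
  fixes R :: "real set"
  assumes "finite R"
  shows "degree (\<Prod>a\<in>R. [:- a, 1:]) = card R" "lead_coeff (\<Prod>a\<in>R. [:- a, 1:]) = 1"
    "(\<Prod>a\<in>R. [:- a, 1:]) \<noteq> 0"
proof -
  show nz: "(\<Prod>a\<in>R. [:- a, 1:]) \<noteq> 0" using assms by (simp add: prod_zero_iff)
  show "degree (\<Prod>a\<in>R. [:- a, 1:]) = card R"
    using assms by (induction R rule: finite_induct) (auto simp: degree_mult_eq prod_zero_iff simp del: mult_pCons_left)
  show "lead_coeff (\<Prod>a\<in>R. [:- a, 1:]) = 1"
    by (simp add: lead_coeff_prod)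
qed

text \<open>There is one more unknown than equations. The induction eliminates the last unknown with
  a pivot row \<open>p\<close>; if the last column vanishes, the last unit vector is a
  solution.\<close>

lemma homogeneous_system:
  fixes m :: "nat \<Rightarrow> nat \<Rightarrow> 'a::field"
  shows "\<exists>c. (\<exists>j\<le>N. c j \<noteq> 0) \<and> (\<forall>i<N. (\<Sum>j\<le>N. m i j * c j) = 0)"
proof (induction N arbitrary: m)
  case 0
  show ?case by (intro exI[of _ "\<lambda>_. 1"]) auto
next
  case (Suc N)
  show ?case
  proof (cases "\<exists>i\<le>N. m i (Suc N) \<noteq> 0")
    case False
    then show ?thesis
      by (intro exI[of _ "\<lambda>j. if j = Suc N then 1 else 0"]) (auto simp: if_distrib less_Suc_eq_le cong: if_cong)
  next
    case True
    then obtain p where p: "p \<le> N" "m p (Suc N) \<noteq> 0" by blast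
    \<comment> \<open>\<open>r\<close> enumerates the rows other than the pivot; \<open>i'\<close>
      below inverts it.\<close>
    define r where "r = (\<lambda>i. if i < p then i else Suc i)"
    define m' where "m' = (\<lambda>i j. m (r i) j - m (r i) (Suc N) / m p (Suc N) * m p j)"
    obtain c where c: "\<exists>j\<le>N. c j \<noteq> 0" "\<And>i. i < N \<Longrightarrow> (\<Sum>j\<le>N. m' i j * c j) = 0"
      using Suc.IH[of m'] by blast
    define t where "t = - (\<Sum>j\<le>N. m p j * c j) / m p (Suc N)"
    define c' where "c' = (\<lambda>j. if j = Suc N then t else c j)"
    have sum: "(\<Sum>j\<le>Suc N. m i j * c' j) = (\<Sum>j\<le>N. m i j * c j) + m i (Suc N) * t" for i
    proof -
      have "(\<Sum>j\<le>N. m i j * c' j) = (\<Sum>j\<le>N. m i j * c j)"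
        by (rule sum.cong) (auto simp: c'_def)
      then show ?thesis by (simp add: c'_def)
    qed
    have "(\<Sum>j\<le>Suc N. m i j * c' j) = 0" if "i < Suc N" for i
    proof (cases "i = p")
      case True
      then show ?thesis unfolding sum using p by (simp add: t_def)
    next
      case False
      define i' where "i' = (if i < p then i else i - 1)"
      have i': "i' < N" "r i' = i"
        using that p(1) False by (auto simp: r_def i'_def)
      have "(\<Sum>j\<le>N. m' i' j * c j) = (\<Sum>j\<le>N. m i j * c j) - m i (Suc N) / m p (Suc N) * (\<Sum>j\<le>N. m p j * c j)"
        unfolding m'_def i' by (simp add: algebra_simps sum_subtractf sum_distrib_left)
      then show ?thesis unfolding sum using c(2)[OF i'(1)] p by (simp add: t_def)
    qed
    moreover obtain j where "j \<le> N" "c j \<noteq> 0" using c(1) by blast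
    then have "j \<le> Suc N \<and> c' j \<noteq> 0" by (simp add: c'_def)
    ultimately show ?thesis by (intro exI[of _ c']) blast
  qed
qed

section \<open>Multiple orthogonal polynomials of an Angelesco system\<close>

declare One_nat_def [simp del]

text \<open>Orthogonality in one place for two uses: integration against a fixed polynomial, and the
  pairing of a fixed form with a varying polynomial.\<close>

lemma functional_top_coeff:
  fixes \<Lambda> :: "real poly \<Rightarrow> real"
  assumes add: "\<And>p q. \<Lambda> (p + q) = \<Lambda> p + \<Lambda> q" and smult: "\<And>c p. \<Lambda> (smult c p) = c * \<Lambda> p"
    and low: "\<And>m. m < N \<Longrightarrow> \<Lambda> (monom 1 m) = 0" and deg: "degree q \<le> N"
  shows "\<Lambda> q = coeff q N * \<Lambda> (monom 1 N)"
proof -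
  have zero: "\<Lambda> 0 = 0" using smult[of 0 0] by simp
  have sum: "\<Lambda> (\<Sum>i\<in>A. f i) = (\<Sum>i\<in>A. \<Lambda> (f i))" if "finite A" for A :: "nat set" and f
    using that by (induction A rule: finite_induct) (auto simp: zero add)
  have mon: "\<Lambda> (monom c i) = c * \<Lambda> (monom 1 i)" for c i
    using smult[of c "monom 1 i"] by (simp add: smult_monom)
  have "\<Lambda> q = \<Lambda> (\<Sum>i\<le>N. monom (coeff q i) i)" using poly_as_sum_of_monoms'[OF deg] by simp
  also have "\<dots> = (\<Sum>i\<le>N. coeff q i * \<Lambda> (monom 1 i))"
    unfolding sum[OF finite_atMost] by (intro sum.cong refl mon)
  also have "\<dots> = (\<Sum>i\<in>{N}. coeff q i * \<Lambda> (monom 1 i))"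
    by (rule sum.mono_neutral_right) (auto simp: low)
  finally show ?thesis by simp
qed

lemma functional_vanish:
  fixes \<Lambda> :: "real poly \<Rightarrow> real"
  assumes add: "\<And>p q. \<Lambda> (p + q) = \<Lambda> p + \<Lambda> q" and smult: "\<And>c p. \<Lambda> (smult c p) = c * \<Lambda> p"
    and low: "\<And>m. m < N \<Longrightarrow> \<Lambda> (monom 1 m) = 0" and deg: "degree q < N"
  shows "\<Lambda> q = 0"
  using functional_top_coeff[of \<Lambda> "degree q" q] assms by auto

lemma prod_linear_dvd:
  fixes q :: "real poly"
  assumes "finite R" "\<And>a. a \<in> R \<Longrightarrow> poly q a = 0"
  shows "(\<Prod>a\<in>R. [:- a, 1:]) dvd q"
  using assms
proof (induction R arbitrary: q rule: finite_induct)
  case (insert c R)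
  then obtain q' where q': "q = [:- c, 1:] * q'" using poly_eq_0_iff_dvd[of q c] by (auto simp: dvd_def)
  have "poly q' a = 0" if "a \<in> R" for a
    using insert.prems[of a] that insert.hyps(2) unfolding q' by auto
  from insert.IH[OF this] show ?case unfolding q' prod.insert[OF insert.hyps] by (intro mult_dvd_mono) auto
qed simp

definition tot :: "nat^2 \<Rightarrow> nat" where "tot n = n $ 1 + n $ 2"

lemma tot_add_axis: "tot (n + axis i 1) = Suc (tot n)"
  using exhaust_2[of i] by (auto simp: tot_def axis_def)

lemma tot_diff_axis: "n $ i > 0 \<Longrightarrow> Suc (tot (n - axis i 1)) = tot n"
  using exhaust_2[of i] by (auto simp: tot_def axis_def)

lemma diff_add_axis: "n $ i > 0 \<Longrightarrow> n - axis i 1 + axis i 1 = (n :: nat^2)"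
  by (simp add: vec_eq_iff axis_def)

lemma ex_other: "\<exists>j::2. j \<noteq> k"
  using exhaust_2[of k] zero_neq_one by (metis one_neq_zero)

section \<open>Position of the intervals, and zeros of orthogonal polynomials\<close>

locale angelesco_system =
  fixes \<mu> :: "2 \<Rightarrow> real measure"
  assumes angelesco: "angelesco \<mu>"

sublocale angelesco_system \<subseteq> M: compact_measure "\<mu> k" for k
  using angelesco unfolding angelesco_def compact_measure_def compact_measure_axioms_def by blast

context angelesco_system
begin

declare One_nat_def [simp del]

lemma supp_subset_Delta: "measure_supp (\<mu> k) \<subseteq> Delta \<mu> k"
  unfolding Delta_def by (rule hull_subset)

lemma Delta_interval: "\<exists>l r. Delta \<mu> k = {l..r}"
proof -
  have "compact (Delta \<mu> k)" "connected (Delta \<mu> k)"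
    unfolding Delta_def using M.compact_supp compact_convex_hull convex_convex_hull convex_connected by blast+
  then show ?thesis using connected_compact_interval_1 by blast
qed

lemma compact_Delta: "compact (Delta \<mu> k)"
  unfolding Delta_def using M.compact_supp compact_convex_hull by blast

lemma Delta_disjoint: "j \<noteq> k \<Longrightarrow> Delta \<mu> j \<inter> Delta \<mu> k = {}"
  using angelesco exhaust_2[of j] exhaust_2[of k] unfolding angelesco_def by auto

lemma Delta_nonempty: "Delta \<mu> k \<noteq> {}"
  using supp_subset_Delta[of k] M.infinite_supp[of k] by auto

text \<open>\<open>g\<close> is a point of the gap and \<open>\<sigma> k\<close> tells on which side
  of it the \<open>k\<close>-th interval lies. This keeps all sign arguments free of the question
  which interval is the left one.\<close>

lemma separation:
  "\<exists>\<sigma> g. (\<forall>k. \<bar>\<sigma> k\<bar> = 1) \<and> (\<forall>j k. j \<noteq> k \<longrightarrow> \<sigma> j = - \<sigma> k) \<and>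
     (\<forall>k. \<forall>x\<in>Delta \<mu> k. \<sigma> k * (x - g) > (0::real))"
proof -
  obtain l r where lr: "Delta \<mu> k = {l k..r k}" for k using Delta_interval by metis
  have le: "l k \<le> r k" for k using Delta_nonempty[of k] lr by auto
  have d: "r 1 < l 2 \<or> r 2 < l 1"
  proof (rule ccontr)
    assume "\<not> ?thesis"
    then have "max (l 1) (l 2) \<in> Delta \<mu> 1 \<inter> Delta \<mu> 2" using le[of 1] le[of 2] unfolding lr by auto
    then show False using Delta_disjoint[of 1 2] by auto
  qed
  then show ?thesis
  proof
    assume a: "r 1 < l 2"
    show ?thesis
      using a by (intro exI[of _ "\<lambda>k. if k = 1 then -1 else 1"] exI[of _ "(r 1 + l 2) / 2"])
        (auto simp: forall_2 lr)
  next
    assume a: "r 2 < l 1"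
    show ?thesis
      using a by (intro exI[of _ "\<lambda>k. if k = 1 then 1 else -1"] exI[of _ "(r 2 + l 1) / 2"])
        (auto simp: forall_2 lr)
  qed
qed

text \<open>Zeros in the other interval lie on the opposite side of \<open>g\<close> from
  \<open>x\<close>, so each linear factor has the sign \<open>\<sigma> k\<close>.\<close>

lemma separation_prod:
  fixes \<sigma> :: "2 \<Rightarrow> real"
  assumes \<sigma>: "\<forall>j k. j \<noteq> k \<longrightarrow> \<sigma> j = - \<sigma> k" "\<forall>k. \<forall>x\<in>Delta \<mu> k. \<sigma> k * (x - g) > 0"
    and jk: "j \<noteq> k" and R: "finite R" "R \<subseteq> Delta \<mu> j" and x: "x \<in> Delta \<mu> k"
  shows "\<sigma> k ^ card R * poly (\<Prod>a\<in>R. [:- a, 1:]) x > 0"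
proof -
  have "\<sigma> k ^ card R * poly (\<Prod>a\<in>R. [:- a, 1:]) x = (\<Prod>a\<in>R. \<sigma> k * (x - a))"
    by (simp add: poly_prod prod.distrib)
  also have "\<dots> > 0"
  proof (rule prod_pos)
    fix a assume "a \<in> R"
    then have "\<sigma> j * (a - g) > 0" using \<sigma>(2) R by blast
    then have "- (\<sigma> k * (a - g)) > 0" using \<sigma>(1) jk by fastforce
    moreover have "\<sigma> k * (x - g) > 0" using \<sigma>(2) x by blast
    ultimately show "\<sigma> k * (x - a) > 0" by (simp add: algebra_simps)
  qed
  finally show ?thesis .
qed

lemma pint_mult_monom: "pint N (p * monom 1 m) = (\<integral>x. poly p x * x ^ m \<partial>N)"
  unfolding pint_def poly_mult poly_monom by simp

definition orth :: "nat^2 \<Rightarrow> real poly \<Rightarrow> bool" where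
  "orth n p \<longleftrightarrow> (\<forall>k. \<forall>m < n $ k. pint (\<mu> k) (p * monom 1 m) = 0)"

lemma orth_diff: "orth n p \<Longrightarrow> orth n q \<Longrightarrow> orth n (p - q)"
  by (simp add: orth_def left_diff_distrib M.pint_diff)

lemma orth_smult: "orth n p \<Longrightarrow> orth n (smult c p)"
  by (simp add: orth_def M.pint_smult)

lemma pint_mult_top:
  assumes "\<And>m. m < N \<Longrightarrow> pint (\<mu> k) (p * monom 1 m) = 0" "degree q \<le> N"
  shows "pint (\<mu> k) (p * q) = coeff q N * pint (\<mu> k) (p * monom 1 N)"
  by (rule functional_top_coeff[where \<Lambda> = "\<lambda>q. pint (\<mu> k) (p * q)"])
    (use assms in \<open>auto simp: distrib_left M.pint_add M.pint_smult\<close>)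

lemma pint_mult_vanish:
  assumes "\<And>m. m < N \<Longrightarrow> pint (\<mu> k) (p * monom 1 m) = 0" "degree q < N"
  shows "pint (\<mu> k) (p * q) = 0"
  by (rule functional_vanish[where \<Lambda> = "\<lambda>q. pint (\<mu> k) (p * q)" and N = N])
    (use assms in \<open>auto simp: distrib_left M.pint_add M.pint_smult\<close>)

text \<open>With fewer than \<open>n $ k\<close> sign changes on the interval, the polynomial with
  these zeros is an admissible test polynomial, and its product with \<open>q\<close> is one-signed
  with vanishing integral.\<close>

lemma orth_roots:
  assumes q: "q \<noteq> 0" "orth n q"
  shows "\<exists>R. \<forall>k. finite (R k) \<and> R k \<subseteq> Delta \<mu> k \<and> n $ k \<le> card (R k) \<and> (\<forall>a\<in>R k. poly q a = 0)"
proof -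
  have "\<exists>R. finite R \<and> R \<subseteq> Delta \<mu> k \<and> n $ k \<le> card R \<and> (\<forall>a\<in>R. poly q a = 0)" for k
  proof -
    obtain l r where lr: "Delta \<mu> k = {l..r}" using Delta_interval by blast
    obtain R s where R: "finite R" "R \<subseteq> {l..r}" "\<bar>s\<bar> = 1" "(\<Prod>a\<in>R. [:- a, 1:]) dvd q"
      "\<forall>x\<in>{l..r}. s * poly (q * (\<Prod>a\<in>R. [:- a, 1:])) x \<ge> 0"
      using sign_change_factor[OF q(1), of l r] by (elim exE conjE) (rule that)
    have "n $ k \<le> card R"
    proof (rule ccontr)
      assume "\<not> n $ k \<le> card R"
      then have "degree (\<Prod>a\<in>R. [:- a, 1:]) < n $ k" using linear_factor_prod(1)[OF R(1)] by linarith
      then have "pint (\<mu> k) (q * (\<Prod>a\<in>R. [:- a, 1:])) = 0"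
        by (rule pint_mult_vanish[rotated]) (use q(2) in \<open>simp add: orth_def\<close>)
      moreover have "pint (\<mu> k) (smult s (q * (\<Prod>a\<in>R. [:- a, 1:]))) > 0"
      proof (rule M.pint_pos)
        show "smult s (q * (\<Prod>a\<in>R. [:- a, 1:])) \<noteq> 0"
          using q(1) R(3) linear_factor_prod(3)[OF R(1)] by auto
        show "0 \<le> poly (smult s (q * (\<Prod>a\<in>R. [:- a, 1:]))) x" if "x \<in> measure_supp (\<mu> k)" for x
          using R(5) supp_subset_Delta[of k] that lr by auto
      qed
      ultimately show False by (simp add: M.pint_smult)
    qed
    moreover have "poly q a = 0" if "a \<in> R" for a
    proof -
      have "poly (\<Prod>a\<in>R. [:- a, 1:]) a = 0" using that R(1) by (auto simp: poly_prod)
      then show ?thesis using R(4) by (auto simp: dvd_def)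
    qed
    ultimately show ?thesis using R lr by blast
  qed
  then show ?thesis by metis
qed

lemma roots_prod_dvd:
  assumes R: "\<And>k. finite (R k) \<and> R k \<subseteq> Delta \<mu> k \<and> (\<forall>a\<in>R k. poly q a = 0)"
  shows "(\<Prod>a\<in>R 1. [:- a, 1:]) * (\<Prod>a\<in>R 2. [:- a, 1:]) dvd q"
    and "degree ((\<Prod>a\<in>R 1. [:- a, 1:]) * (\<Prod>a\<in>R 2. [:- a, 1:])) = card (R 1) + card (R 2)"
proof -
  have "R 1 \<inter> R 2 = {}" using R[of 1] R[of 2] Delta_disjoint[of 1 2] by auto
  then have "(\<Prod>a\<in>R 1. [:- a, 1:]) * (\<Prod>a\<in>R 2. [:- a, 1:]) = (\<Prod>a\<in>R 1 \<union> R 2. [:- a, 1:])"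
    using R[of 1] R[of 2] by (intro prod.union_disjoint[symmetric]) auto
  also have "\<dots> dvd q" using R[of 1] R[of 2] by (intro prod_linear_dvd) auto
  finally show "(\<Prod>a\<in>R 1. [:- a, 1:]) * (\<Prod>a\<in>R 2. [:- a, 1:]) dvd q" .
  show "degree ((\<Prod>a\<in>R 1. [:- a, 1:]) * (\<Prod>a\<in>R 2. [:- a, 1:])) = card (R 1) + card (R 2)"
    using R linear_factor_prod by (subst degree_mult_eq) auto
qed

text \<open>This is where disjointness of the intervals yields normality: the zeros found in the two
  intervals are distinct, so their numbers add up.\<close>

lemma orth_degree:
  assumes q: "q \<noteq> 0" "orth n q" shows "tot n \<le> degree q"
proof -
  obtain R where R: "\<And>k. finite (R k) \<and> R k \<subseteq> Delta \<mu> k \<and> n $ k \<le> card (R k) \<and> (\<forall>a\<in>R k. poly q a = 0)"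
    using orth_roots[OF assms] by blast
  have "card (R 1) + card (R 2) \<le> degree q"
    using roots_prod_dvd[of R q] R dvd_imp_degree_le[OF _ q(1)] by metis
  then show ?thesis using R[of 1] R[of 2] by (simp add: tot_def)
qed

lemma orth_zero:
  assumes "orth n q" "\<And>i. i \<ge> tot n \<Longrightarrow> coeff q i = 0" shows "q = 0"
proof (rule ccontr)
  assume "q \<noteq> 0"
  then have "coeff q (degree q) = 0" using assms orth_degree by blast
  then show False using \<open>q \<noteq> 0\<close> by simp
qed

text \<open>Orthogonality imposes \<open>tot n\<close> linear conditions on the
  \<open>tot n + 1\<close> coefficients.\<close>

lemma ex_orth: "\<exists>q. q \<noteq> 0 \<and> degree q \<le> tot n \<and> orth n q"
proof -
  \<comment> \<open>The conditions are numbered consecutively, first those for the first measure,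
    then those for the second: condition \<open>i\<close> integrates against
    \<open>\<mu> (K i)\<close> with exponent \<open>E i\<close>.\<close>
  define K where "K = (\<lambda>i. if i < n $ 1 then 1 else 2 :: 2)"
  define E where "E = (\<lambda>i. if i < n $ 1 then i else i - n $ 1)"
  obtain c where c: "\<exists>j\<le>tot n. c j \<noteq> (0::real)"
    "\<And>i. i < tot n \<Longrightarrow> (\<Sum>j\<le>tot n. pint (\<mu> (K i)) (monom 1 j * monom 1 (E i)) * c j) = 0"
    using homogeneous_system[of "tot n" "\<lambda>i j. pint (\<mu> (K i)) (monom 1 j * monom 1 (E i))"] by blast
  define q where "q = (\<Sum>j\<le>tot n. monom (c j) j)"
  have co: "coeff q i = (if i \<le> tot n then c i else 0)" for i
    by (simp add: q_def coeff_sum)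
  have "q \<noteq> 0" using c(1) co by (metis coeff_0)
  moreover have "degree q \<le> tot n" by (rule degree_le) (simp add: co)
  moreover have "orth n q"
    unfolding orth_def
  proof (intro allI impI)
    fix k m assume m: "m < n $ k"
    define i where "i = (if k = 1 then m else m + n $ 1)"
    have i: "i < tot n" "K i = k" "E i = m"
      using m exhaust_2[of k] by (auto simp: i_def tot_def K_def E_def)
    have "pint (\<mu> k) (q * monom 1 m) = (\<Sum>j\<le>tot n. pint (\<mu> k) (monom (c j) j * monom 1 m))"
      by (simp add: q_def sum_distrib_right M.pint_sum)
    also have "\<dots> = (\<Sum>j\<le>tot n. pint (\<mu> k) (monom 1 j * monom 1 m) * c j)"
    proof (rule sum.cong)
      fix j show "pint (\<mu> k) (monom (c j) j * monom 1 m) = pint (\<mu> k) (monom 1 j * monom 1 m) * c j"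
        using M.pint_smult[of k "c j" "monom 1 j * monom 1 m"] by (simp add: mult_monom smult_monom)
    qed simp
    also have "\<dots> = 0" using c(2)[OF i(1)] i by simp
    finally show "pint (\<mu> k) (q * monom 1 m) = 0" .
  qed
  ultimately show ?thesis by blast
qed

abbreviation P :: "nat^2 \<Rightarrow> real poly" where "P n \<equiv> mop \<mu> n"

text \<open>The difference of two candidates is orthogonal of degree less than \<open>tot n\<close>,
  hence zero. This justifies the definite description in \<open>mop\<close>.\<close>

lemma mop_props: "lead_coeff (P n) = 1" "degree (P n) = tot n" "orth n (P n)"
proof -
  obtain q where q: "q \<noteq> 0" "degree q \<le> tot n" "orth n q" using ex_orth by blast
  have dq: "degree q = tot n" using q orth_degree by (simp add: antisym)
  define p where "p = smult (1 / lead_coeff q) q"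
  have p: "lead_coeff p = 1" "degree p = tot n" "orth n p"
    using q dq leading_coeff_neq_0[OF q(1)] by (auto simp: p_def orth_smult)
  have unique: "p' = p" if p': "lead_coeff p' = 1" "degree p' = tot n" "orth n p'" for p'
  proof -
    have "p' - p = 0"
    proof (rule orth_zero[OF orth_diff[OF p'(3) p(3)]])
      fix i assume "i \<ge> tot n"
      then show "coeff (p' - p) i = 0"
        using p p' by (cases "i = tot n") (auto simp: coeff_eq_0)
    qed
    then show ?thesis by simp
  qed
  have mop_eq: "mop \<mu> n = (THE p. lead_coeff p = 1 \<and> degree p = tot n \<and> orth n p)"
    unfolding mop_def orth_def tot_def pint_mult_monom ..
  have "lead_coeff (P n) = 1 \<and> degree (P n) = tot n \<and> orth n (P n)"
    unfolding mop_eq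
  proof (rule theI)
    show "lead_coeff p = 1 \<and> degree p = tot n \<and> orth n p" using p by blast
    show "p' = p" if "lead_coeff p' = 1 \<and> degree p' = tot n \<and> orth n p'" for p'
      using that unique by blast
  qed
  then show "lead_coeff (P n) = 1" "degree (P n) = tot n" "orth n (P n)" by auto
qed

lemma mop_top: "coeff (P n) (tot n) = 1"
  using mop_props by metis

lemma mop_high: "i > tot n \<Longrightarrow> coeff (P n) i = 0"
  using mop_props(2) coeff_eq_0 by metis

lemma mop_orth: "m < n $ k \<Longrightarrow> pint (\<mu> k) (P n * monom 1 m) = 0"
  using mop_props(3) by (simp add: orth_def)

text \<open>The first moment of \<open>P n\<close> that orthogonality does not force to vanish. The
  coefficients \<open>ra\<close> and the leading coefficients of the type I forms are expressed
  through it.\<close>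

definition h :: "nat^2 \<Rightarrow> 2 \<Rightarrow> real" where
  "h n k = pint (\<mu> k) (P n * monom 1 (n $ k))"

text \<open>Replacing the monomial by the factor of \<open>P n\<close> with zeros in the
  \<open>k\<close>-th interval does not change the moment. The integrand is then a square times the
  other factor, which has sign \<open>\<sigma> k ^ (n $ j)\<close> there.\<close>

lemma h_sign:
  fixes \<sigma> :: "2 \<Rightarrow> real"
  assumes \<sigma>: "\<forall>j k. j \<noteq> k \<longrightarrow> \<sigma> j = - \<sigma> k" "\<forall>k. \<forall>x\<in>Delta \<mu> k. \<sigma> k * (x - g) > 0"
    and jk: "j \<noteq> k"
  shows "\<sigma> k ^ (n $ j) * h n k > 0"
proof -
  have nz: "P n \<noteq> 0" using mop_props(1)[of n] by auto
  obtain R where R: "\<And>k. finite (R k) \<and> R k \<subseteq> Delta \<mu> k \<and> n $ k \<le> card (R k) \<and> (\<forall>a\<in>R k. poly (P n) a = 0)"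
    using orth_roots[OF nz mop_props(3)] by blast
  let ?p = "\<lambda>k. \<Prod>a\<in>R k. [:- a, 1:]"
  have R': "finite (R k) \<and> R k \<subseteq> Delta \<mu> k \<and> (\<forall>a\<in>R k. poly (P n) a = 0)" for k using R by blast
  note dv = roots_prod_dvd[of R "P n", OF R']
  obtain t where t: "P n = (?p 1 * ?p 2) * t" using dv(1) by (auto simp: dvd_def)
  have lc: "lead_coeff (?p k) = 1" "?p k \<noteq> 0" "degree (?p k) = card (R k)" for k
    using linear_factor_prod[of "R k"] R by auto
  have "t \<noteq> 0" using t nz by auto
  then have dt: "tot n = card (R 1) + card (R 2) + degree t"
    using mop_props(2)[of n] dv(2) lc(2) unfolding t by (subst (asm) degree_mult_eq) auto
  \<comment> \<open>The zeros already found exhaust the degree, so their numbers are exact and the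
    cofactor \<open>t\<close> is constant.\<close>
  then have card: "card (R k) = n $ k" for k
  proof -
    have "n $ 1 \<le> card (R 1)" "n $ 2 \<le> card (R 2)" "n $ 1 + n $ 2 = card (R 1) + card (R 2) + degree t"
      using R[of 1] R[of 2] dt by (auto simp: tot_def)
    then show ?thesis using exhaust_2[of k] by auto
  qed
  have "degree t = 0" using dt card by (simp add: tot_def)
  moreover have "lead_coeff t = 1"
    using mop_props(1)[of n] lc(1)[of 1] lc(1)[of 2] unfolding t by (simp only: lead_coeff_mult mult_1_left)
  ultimately have "t = 1" by (auto elim!: degree_eq_zeroE simp: one_pCons)
  then have P: "P n = ?p k * ?p j" using t jk exhaust_2[of j] exhaust_2[of k] by (auto simp: mult.commute)
  have "pint (\<mu> k) (P n * ?p k) = coeff (?p k) (n $ k) * h n k"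
    unfolding h_def by (rule pint_mult_top[OF mop_orth]) (auto simp: lc card)
  then have "h n k = pint (\<mu> k) (P n * ?p k)" using lc(1)[of k] lc(3)[of k] card by simp
  then have "\<sigma> k ^ (n $ j) * h n k = pint (\<mu> k) (smult (\<sigma> k ^ (n $ j)) (P n * ?p k))"
    by (simp add: M.pint_smult)
  also have "\<dots> > 0"
  proof (rule M.pint_pos)
    have "\<sigma> k \<noteq> 0" using \<sigma>(2) Delta_nonempty[of k] by fastforce
    then show "smult (\<sigma> k ^ (n $ j)) (P n * ?p k) \<noteq> 0" using nz lc(2) by simp
    fix x assume "x \<in> measure_supp (\<mu> k)"
    then have x: "x \<in> Delta \<mu> k" using supp_subset_Delta by blast
    have "0 < \<sigma> k ^ card (R j) * poly (?p j) x"
      by (rule separation_prod[OF \<sigma> jk _ _ x]) (use R in auto)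
    then have "0 \<le> (poly (?p k) x)\<^sup>2 * (\<sigma> k ^ (n $ j) * poly (?p j) x)" using card by simp
    also have "\<dots> = poly (smult (\<sigma> k ^ (n $ j)) (P n * ?p k)) x"
      unfolding P by (simp add: power2_eq_square mult_ac)
    finally show "0 \<le> poly (smult (\<sigma> k ^ (n $ j)) (P n * ?p k)) x" .
  qed
  finally show ?thesis .
qed

lemma h_nonzero: "h n k \<noteq> 0"
proof -
  obtain j where "j \<noteq> k" using ex_other by blast
  moreover obtain \<sigma> :: "2 \<Rightarrow> real" and g where "\<forall>j k. j \<noteq> k \<longrightarrow> \<sigma> j = - \<sigma> k"
    "\<forall>k. \<forall>x\<in>Delta \<mu> k. \<sigma> k * (x - g) > 0"
    using separation by (elim exE conjE) (rule that)
  ultimately have "\<sigma> k ^ (n $ j) * h n k > 0" by (intro h_sign)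
  then show ?thesis by auto
qed

definition ra :: "nat^2 \<Rightarrow> 2 \<Rightarrow> real" where
  "ra n j = (if n $ j = 0 then 0 else h n j / h (n - axis j 1) j)"

definition rb :: "nat^2 \<Rightarrow> 2 \<Rightarrow> real" where
  "rb n i = coeff ([:0, 1:] * P n - P (n + axis i 1)) (tot n)"

text \<open>The sign of \<open>h n k\<close> depends only on the other index \<open>n $ j\<close>,
  which is the same for \<open>n\<close> and \<open>n - axis k 1\<close>; so the quotient is
  positive.\<close>

lemma ra_pos:
  assumes "n $ k > 0" shows "ra n k > 0"
proof -
  obtain j where j: "j \<noteq> k" using ex_other by blast
  obtain \<sigma> :: "2 \<Rightarrow> real" and g where \<sigma>: "\<forall>k. \<bar>\<sigma> k\<bar> = 1" "\<forall>j k. j \<noteq> k \<longrightarrow> \<sigma> j = - \<sigma> k"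
    "\<forall>k. \<forall>x\<in>Delta \<mu> k. \<sigma> k * (x - g) > 0"
    using separation by (elim exE conjE) (rule that)
  have "\<sigma> k ^ (n $ j) * h n k > 0" "\<sigma> k ^ (n $ j) * h (n - axis k 1) k > 0"
    using h_sign[OF \<sigma>(2,3) j, of n] h_sign[OF \<sigma>(2,3) j, of "n - axis k 1"] j
    by (auto simp: axis_def)
  then have "(\<sigma> k ^ (n $ j) * h n k) / (\<sigma> k ^ (n $ j) * h (n - axis k 1) k) > 0"
    by (rule divide_pos_pos)
  moreover have "\<sigma> k \<noteq> 0" using \<sigma>(1) by (metis abs_zero zero_neq_one)
  ultimately show ?thesis using assms by (simp add: ra_def)
qed

lemma X_mult_monom: "[:0, 1:] * p * monom 1 m = p * monom (1::real) (Suc m)"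
  by (simp add: monom_Suc)

lemma mop_pred_facts:
  "i \<ge> tot n \<Longrightarrow> coeff (mop_pred \<mu> n j) i = 0"
  "m < n $ k \<Longrightarrow> pint (\<mu> k) (mop_pred \<mu> n j * monom 1 m) =
     (if j = k \<and> Suc m = n $ k then h (n - axis k 1) k else 0)"
proof -
  show "coeff (mop_pred \<mu> n j) i = 0" if "i \<ge> tot n"
    using that tot_diff_axis[of n j] by (auto simp: mop_pred_def intro!: mop_high)
  show "pint (\<mu> k) (mop_pred \<mu> n j * monom 1 m) =
     (if j = k \<and> Suc m = n $ k then h (n - axis k 1) k else 0)" if m: "m < n $ k"
  proof (cases "j = k \<and> Suc m = n $ k")
    case True
    then have "m = (n - axis k 1) $ k" by (auto simp: axis_def)
    then show ?thesis using True m by (simp add: mop_pred_def h_def)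
  next
    case False
    then have "m < (n - axis j 1) $ k" using m by (auto simp: axis_def)
    then have "pint (\<mu> k) (mop_pred \<mu> n j * monom 1 m) = 0"
      by (simp add: mop_pred_def mop_orth M.pint_0)
    then show ?thesis using False by auto
  qed
qed

text \<open>The difference of both sides has degree less than \<open>tot n\<close> and satisfies all
  orthogonality relations for \<open>n\<close>. The value of \<open>rb\<close> cancels the
  coefficient of order \<open>tot n\<close>, and \<open>ra\<close> repairs the one relation per
  measure that multiplication by \<open>x\<close> destroys.\<close>

lemma recurrence_II:
  "[:0, 1:] * P n = P (n + axis i 1) + smult (rb n i) (P n)
     + smult (ra n 1) (mop_pred \<mu> n 1) + smult (ra n 2) (mop_pred \<mu> n 2)"
proof -
  let ?X = "[:0, 1:] * P n"
  define D where "D = ?X - P (n + axis i 1) - smult (rb n i) (P n)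
     - smult (ra n 1) (mop_pred \<mu> n 1) - smult (ra n 2) (mop_pred \<mu> n 2)"
  have "D = 0"
  proof (rule orth_zero)
    fix l assume l: "l \<ge> tot n"
    show "coeff D l = 0"
    proof (cases "l = tot n")
      case True
      then show ?thesis unfolding D_def by (simp add: mop_pred_facts(1) mop_top rb_def)
    next
      case False
      then obtain l' where l': "l = Suc l'" "l' \<ge> tot n" using l by (cases l) auto
      have "coeff (P n) l' = coeff (P (n + axis i 1)) l"
        using mop_top[of n] mop_top[of "n + axis i 1"] mop_high[of n l'] mop_high[of "n + axis i 1" l] l'
        by (cases "l' = tot n") (auto simp: tot_add_axis)
      moreover have "coeff (P n) l = 0" using l' by (intro mop_high) auto
      ultimately show ?thesis unfolding D_def using mop_pred_facts(1)[OF l] l' by simp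
    qed
  next
    show "orth n D"
      unfolding orth_def
    proof (intro allI impI)
      fix k m assume m: "m < n $ k"
      have 1: "pint (\<mu> k) (?X * monom 1 m) = (if Suc m = n $ k then h n k else 0)"
        unfolding X_mult_monom using m mop_orth[of "Suc m" n k] by (auto simp: h_def)
      have 2: "pint (\<mu> k) (P (n + axis i 1) * monom 1 m) = 0"
        using m by (intro mop_orth) (simp add: axis_def)
      have 3: "pint (\<mu> k) (P n * monom 1 m) = 0" using m by (rule mop_orth)
      have "pint (\<mu> k) (D * monom 1 m) = pint (\<mu> k) (?X * monom 1 m)
         - ra n 1 * pint (\<mu> k) (mop_pred \<mu> n 1 * monom 1 m) - ra n 2 * pint (\<mu> k) (mop_pred \<mu> n 2 * monom 1 m)"
        unfolding D_def left_diff_distrib M.pint_diff mult_smult_left M.pint_smult 2 3 by simp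
      also have "\<dots> = 0"
        unfolding 1 mop_pred_facts(2)[OF m] using m exhaust_2[of k] h_nonzero by (auto simp: ra_def)
      finally show "pint (\<mu> k) (D * monom 1 m) = 0" .
    qed
  qed
  then show ?thesis unfolding D_def by (simp add: algebra_simps)
qed

text \<open>For uniqueness, \<open>b\<close> is read off at order \<open>tot n\<close>, and
  \<open>a $ k\<close> by integrating against the power \<open>n $ k - 1\<close>, where only the
  \<open>k\<close>-th predecessor contributes.\<close>

lemma recurrence_coeffs_eq: "recurrence_coeffs \<mu> n = (vector [ra n 1, ra n 2], vector [rb n 1, rb n 2])"
  unfolding recurrence_coeffs_def
proof (rule the_equality)
  show "case (vector [ra n 1, ra n 2], vector [rb n 1, rb n 2]) of (a, b) \<Rightarrow>
     (\<forall>i. [:0, 1:] * P n = P (n + axis i 1) + smult (b $ i) (P n)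
        + smult (a $ 1) (mop_pred \<mu> n 1) + smult (a $ 2) (mop_pred \<mu> n 2)) \<and>
     (\<forall>j. n $ j = 0 \<longrightarrow> a $ j = 0)"
    using recurrence_II[of n 1] recurrence_II[of n 2] by (simp add: forall_2 ra_def)
next
  fix ab :: "(real^2) \<times> (real^2)"
  assume *: "case ab of (a, b) \<Rightarrow>
     (\<forall>i. [:0, 1:] * P n = P (n + axis i 1) + smult (b $ i) (P n)
        + smult (a $ 1) (mop_pred \<mu> n 1) + smult (a $ 2) (mop_pred \<mu> n 2)) \<and>
     (\<forall>j. n $ j = 0 \<longrightarrow> a $ j = 0)"
  obtain a b where ab: "ab = (a, b)" by (cases ab)
  have rec: "[:0, 1:] * P n = P (n + axis i 1) + smult (b $ i) (P n)
        + smult (a $ 1) (mop_pred \<mu> n 1) + smult (a $ 2) (mop_pred \<mu> n 2)" for i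
    using * unfolding ab by blast
  have zero: "n $ j = 0 \<Longrightarrow> a $ j = 0" for j using * unfolding ab by blast
  have b: "b $ i = rb n i" for i
    unfolding rb_def rec[of i] by (simp add: mop_pred_facts(1) mop_top)
  have "smult (a $ 1) (mop_pred \<mu> n 1) + smult (a $ 2) (mop_pred \<mu> n 2)
      = smult (ra n 1) (mop_pred \<mu> n 1) + smult (ra n 2) (mop_pred \<mu> n 2)"
    using rec[of 1] recurrence_II[of n 1] b[of 1] by (simp add: add.assoc)
  note eq = this
  have a: "a $ k = ra n k" for k
  proof (cases "n $ k = 0")
    case True
    then show ?thesis using zero by (simp add: ra_def)
  next
    case False
    define m where "m = n $ k - 1"
    have m: "m < n $ k" "Suc m = n $ k" using False by (auto simp: m_def)
    have "pint (\<mu> k) ((smult (a $ 1) (mop_pred \<mu> n 1) + smult (a $ 2) (mop_pred \<mu> n 2)) * monom 1 m)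
        = pint (\<mu> k) ((smult (ra n 1) (mop_pred \<mu> n 1) + smult (ra n 2) (mop_pred \<mu> n 2)) * monom 1 m)"
      unfolding eq ..
    then have "a $ k * h (n - axis k 1) k = ra n k * h (n - axis k 1) k"
      unfolding distrib_right M.pint_add mult_smult_left M.pint_smult mop_pred_facts(2)[OF m(1)]
      using m(2) exhaust_2[of k] by auto
    then show ?thesis using h_nonzero by simp
  qed
  show "ab = (vector [ra n 1, ra n 2], vector [rb n 1, rb n 2])"
    unfolding ab using a b by (simp add: vec_eq_iff forall_2)
qed

lemma rec_a_eq: "rec_a \<mu> n i = ra n i"
  using exhaust_2[of i] by (auto simp: rec_a_def recurrence_coeffs_eq)

lemma rec_b_eq: "rec_b \<mu> n i = rb n i"
  using exhaust_2[of i] by (auto simp: rec_b_def recurrence_coeffs_eq)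

end

section \<open>Type I forms and functions of the second kind\<close>

lemma ex_2_iff: "(\<exists>k::2. P k) \<longleftrightarrow> P 1 \<or> P 2"
  by (metis exhaust_2)

context angelesco_system
begin

definition pairing :: "(2 \<Rightarrow> real poly) \<Rightarrow> real poly \<Rightarrow> real" where
  "pairing A q = (\<Sum>k\<in>UNIV. pint (\<mu> k) (A k * q))"

lemma pairing_add: "pairing A (p + q) = pairing A p + pairing A q"
  by (simp add: pairing_def distrib_left M.pint_add sum.distrib)

lemma pairing_smult: "pairing A (smult c q) = c * pairing A q"
  by (simp add: pairing_def M.pint_smult sum_distrib_left)

lemma pairing_top:
  assumes "\<And>m. m < N \<Longrightarrow> pairing A (monom 1 m) = 0" "degree q \<le> N"
  shows "pairing A q = coeff q N * pairing A (monom 1 N)"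
  by (rule functional_top_coeff[of "pairing A"]) (use assms pairing_add pairing_smult in auto)

lemma pairing_vanish:
  assumes "\<And>m. m < N \<Longrightarrow> pairing A (monom 1 m) = 0" "degree q < N"
  shows "pairing A q = 0"
  by (rule functional_vanish[of "pairing A"]) (use assms pairing_add pairing_smult in auto)

definition bounded_form :: "nat^2 \<Rightarrow> (2 \<Rightarrow> real poly) \<Rightarrow> bool" where
  "bounded_form n A \<longleftrightarrow> (\<forall>k. \<forall>i\<ge>n $ k. coeff (A k) i = 0)"

lemma bounded_form_degree: "bounded_form n A \<Longrightarrow> A k \<noteq> 0 \<Longrightarrow> degree (A k) < n $ k"
  unfolding bounded_form_def by (metis leading_coeff_0_iff not_le)

text \<open>If the natural multiplier, which cancels the sign changes of \<open>A 1\<close> and \<open>A 2\<close>, produces the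
  wrong relative sign, this is corrected by one further zero in the gap between the intervals.\<close>

lemma sign_multiplier:
  fixes t :: "2 \<Rightarrow> real"
  assumes A: "bounded_form n A" "\<exists>k. A k \<noteq> 0" and t: "\<And>k. \<bar>t k\<bar> = 1"
  shows "\<exists>q. q \<noteq> 0 \<and> degree q < tot n \<and> (\<forall>k. \<forall>x\<in>Delta \<mu> k. t k * poly (A k * q) x \<ge> 0)"
proof -
  obtain \<sigma> :: "2 \<Rightarrow> real" and g where \<sigma>1: "\<forall>k. \<bar>\<sigma> k\<bar> = 1" and \<sigma>: "\<forall>j k. j \<noteq> k \<longrightarrow> \<sigma> j = - \<sigma> k"
    "\<forall>k. \<forall>x\<in>Delta \<mu> k. \<sigma> k * (x - g) > 0"
    using separation by (elim exE conjE) (rule that)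
  have "\<exists>R s. finite R \<and> R \<subseteq> Delta \<mu> k \<and> \<bar>s\<bar> = 1 \<and> (A k = 0 \<longrightarrow> card R = 0) \<and> (A k \<noteq> 0 \<longrightarrow> card R < n $ k) \<and>
     (\<forall>x\<in>Delta \<mu> k. s * poly (A k * (\<Prod>a\<in>R. [:- a, 1:])) x \<ge> 0)" for k
  proof (cases "A k = 0")
    case True
    then show ?thesis by (intro exI[of _ "{}"] exI[of _ 1]) auto
  next
    case False
    obtain l r where lr: "Delta \<mu> k = {l..r}" using Delta_interval by blast
    obtain R s where R: "finite R" "R \<subseteq> {l..r}" "\<bar>s\<bar> = 1" "(\<Prod>a\<in>R. [:- a, 1:]) dvd A k"
      "\<forall>x\<in>{l..r}. s * poly (A k * (\<Prod>a\<in>R. [:- a, 1:])) x \<ge> 0"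
      using sign_change_factor[OF False, of l r] by (elim exE conjE) (rule that)
    have "card R \<le> degree (A k)"
      using dvd_imp_degree_le[OF R(4) False] linear_factor_prod(1)[OF R(1)] by simp
    then have "card R < n $ k" using bounded_form_degree[OF A(1) False] by simp
    then show ?thesis using R False unfolding lr by (intro exI[of _ R] exI[of _ s]) auto
  qed
  then obtain R s where R: "\<And>k. finite (R k)" "\<And>k. R k \<subseteq> Delta \<mu> k" "\<And>k. \<bar>s k :: real\<bar> = 1"
    "\<And>k. A k = 0 \<Longrightarrow> card (R k) = 0" "\<And>k. A k \<noteq> 0 \<Longrightarrow> card (R k) < n $ k"
    "\<And>k x. x \<in> Delta \<mu> k \<Longrightarrow> s k * poly (A k * (\<Prod>a\<in>R k. [:- a, 1:])) x \<ge> 0"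
    by metis
  let ?p = "\<lambda>k. \<Prod>a\<in>R k. [:- a, 1:]"
  define q where "q = ?p 1 * ?p 2"
  define j where "j = (\<lambda>k::2. if k = 1 then 2 else 1 :: 2)"
  have j: "j k \<noteq> k" "q = ?p k * ?p (j k)" for k
    using exhaust_2[of k] by (auto simp: j_def q_def mult.commute)
  \<comment> \<open>\<open>e k\<close> is the sign that \<open>A k * q\<close> has on the
    \<open>k\<close>-th interval: \<open>s k\<close> from its own zeros, the power of
    \<open>\<sigma> k\<close> from the zeros in the other interval.\<close>
  define e where "e = (\<lambda>k. s k * \<sigma> k ^ card (R (j k)))"
  have sq: "x = 1 \<or> x = -1" if "\<bar>x\<bar> = 1" for x :: real using that by linarith
  have e1: "e k = 1 \<or> e k = -1" for k
    by (rule sq) (use R(3) \<sigma>1 in \<open>simp add: e_def abs_mult power_abs\<close>)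
  have eq: "e k * poly (A k * q) x \<ge> 0" if x: "x \<in> Delta \<mu> k" for k x
  proof -
    have "0 < \<sigma> k ^ card (R (j k)) * poly (?p (j k)) x"
      by (rule separation_prod[OF \<sigma> j(1) R(1,2) x])
    from mult_nonneg_nonneg[OF R(6)[OF x] less_imp_le[OF this]]
    have "0 \<le> (s k * poly (A k * ?p k) x) * (\<sigma> k ^ card (R (j k)) * poly (?p (j k)) x)" .
    also have "\<dots> = e k * poly (A k * (?p k * ?p (j k))) x" by (simp add: e_def mult_ac)
    finally show ?thesis using j(2) by metis
  qed
  have q0: "q \<noteq> 0" unfolding q_def using linear_factor_prod(3)[OF R(1)] by (metis mult_eq_0_iff)
  have dq: "degree q = card (R 1) + card (R 2)"
    unfolding q_def degree_mult_eq[OF linear_factor_prod(3)[OF R(1)] linear_factor_prod(3)[OF R(1)]]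
      linear_factor_prod(1)[OF R(1)] ..
  have tt: "t k = 1 \<or> t k = -1" for k by (rule sq[OF t])
  have ss: "\<sigma> k = 1 \<or> \<sigma> k = -1" for k by (rule sq) (use \<sigma>1 in blast)
  have te: "t k * e k = 1 \<or> t k * e k = -1" for k using tt[of k] e1[of k] by auto
  show ?thesis
  proof (cases "t 1 * e 1 = t 2 * e 2 \<or> A 1 = 0 \<or> A 2 = 0")
    case True
    define c where "c = (if A 1 \<noteq> 0 then t 1 * e 1 else t 2 * e 2)"
    have c: "c = 1 \<or> c = -1" "\<And>k. A k \<noteq> 0 \<Longrightarrow> c = t k * e k"
    proof -
      show "c = 1 \<or> c = -1" unfolding c_def using te[of 1] te[of 2] by presburger
      fix k assume "A k \<noteq> 0"
      then show "c = t k * e k" using True exhaust_2[of k] unfolding c_def by metis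
    qed
    have "degree (smult c q) < tot n"
      using A(2) R(4)[of 1] R(4)[of 2] R(5)[of 1] R(5)[of 2] dq c(1)
      by (cases "A 1 = 0"; cases "A 2 = 0") (auto simp: tot_def ex_2_iff)
    moreover have "t k * poly (A k * smult c q) x \<ge> 0" if "x \<in> Delta \<mu> k" for k x
    proof (cases "A k = 0")
      case False
      have "t k * poly (A k * smult c q) x = (t k * c) * poly (A k * q) x" by simp
      also have "t k * c = e k"
      proof -
        have "t k * c = (t k * t k) * e k" unfolding c(2)[OF False] by (simp only: mult_ac)
        also have "t k * t k = 1" using tt[of k] by auto
        finally show ?thesis by simp
      qed
      finally show ?thesis using eq[OF that] by (simp only:)
    qed simp
    moreover have "smult c q \<noteq> 0" using q0 c(1) by auto
    ultimately show ?thesis by blast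
  next
    case False
    \<comment> \<open>Between the intervals both \<open>t k * e k\<close> and
      \<open>\<sigma> k\<close> change sign, so this constant serves both. As both components are
      nonzero, \<open>degree q\<close> is at most \<open>tot n - 2\<close>, which leaves room for
      the factor with zero \<open>g\<close>.\<close>
    define c where "c = t 1 * e 1 * \<sigma> 1"
    have \<sigma>2: "\<sigma> 2 = - \<sigma> 1" using \<sigma>(1)[rule_format, of 2 1] by simp
    have te2: "t 2 * e 2 = - (t 1 * e 1)" using te[of 1] te[of 2] False by linarith
    have c: "c = t k * e k * \<sigma> k" for k
      using exhaust_2[of k] by (elim disjE) (simp_all only: c_def \<sigma>2 te2, simp)
    have c1: "c = 1 \<or> c = -1" using te[of 1] ss[of 1] unfolding c_def by (elim disjE) auto
    let ?q = "smult c (q * [:- g, 1:])"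
    have lin: "[:- g, 1:] \<noteq> 0" "degree [:- g, 1:] = 1" by auto
    have qg: "q * [:- g, 1:] \<noteq> 0" using q0 lin(1) by (metis mult_eq_0_iff)
    have "degree ?q = Suc (degree q)"
      using c1 degree_mult_eq[OF q0 lin(1)] lin(2) by (metis Suc_eq_plus1 degree_smult_eq neg_equal_0_iff_equal zero_neq_one)
    then have "degree ?q < tot n"
      using False R(5)[of 1] R(5)[of 2] dq by (auto simp: tot_def)
    moreover have "?q \<noteq> 0" using qg c1 by (metis smult_eq_0_iff neg_equal_0_iff_equal zero_neq_one)
    moreover have "t k * poly (A k * ?q) x \<ge> 0" if x: "x \<in> Delta \<mu> k" for k x
    proof -
      have "t k * poly (A k * ?q) x = (t k * c) * poly (A k * q) x * (x - g)"
        by (simp add: algebra_simps)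
      also have "t k * c = e k * \<sigma> k"
      proof -
        have "t k * c = (t k * t k) * (e k * \<sigma> k)" unfolding c[of k] by (simp only: mult_ac)
        also have "t k * t k = 1" using tt[of k] by auto
        finally show ?thesis by simp
      qed
      also have "e k * \<sigma> k * poly (A k * q) x * (x - g) = (e k * poly (A k * q) x) * (\<sigma> k * (x - g))"
        by (simp only: mult_ac)
      also have "\<dots> \<ge> 0" by (rule mult_nonneg_nonneg[OF eq[OF x] less_imp_le[OF \<sigma>(2)[rule_format, OF x]]])
      finally show ?thesis .
    qed
    ultimately show ?thesis by blast
  qed
qed

lemma sign_multiplierE:
  fixes t :: "2 \<Rightarrow> real"
  assumes "bounded_form n A" "\<exists>k. A k \<noteq> 0" "\<And>k. \<bar>t k\<bar> = 1"
  obtains q where "q \<noteq> 0" "degree q < tot n" "\<And>k x. x \<in> Delta \<mu> k \<Longrightarrow> t k * poly (A k * q) x \<ge> 0"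
proof -
  obtain q where "q \<noteq> 0" "degree q < tot n" and q: "\<forall>k. \<forall>x\<in>Delta \<mu> k. t k * poly (A k * q) x \<ge> 0"
    using sign_multiplier[of n A t, OF assms] by (elim exE conjE) (rule that)
  with q[rule_format] show thesis by (intro that[of q])
qed

text \<open>For a nonzero form, a multiplier making both components nonnegative has positive
  pairing, yet its degree lies in the range where the pairing vanishes.\<close>

lemma bounded_form_zero:
  assumes A: "bounded_form n A" and low: "\<And>m. m < tot n \<Longrightarrow> pairing A (monom 1 m) = 0"
  shows "A k = 0"
proof (rule ccontr)
  assume nz: "A k \<noteq> 0"
  obtain q where q: "q \<noteq> 0" "degree q < tot n" "\<And>k x. x \<in> Delta \<mu> k \<Longrightarrow> 1 * poly (A k * q) x \<ge> 0"
    by (rule sign_multiplierE[OF A, of "\<lambda>_. 1"]) (use nz in auto)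
  have qq: "0 \<le> poly (A l * q) x" if "x \<in> measure_supp (\<mu> l)" for l x
    using q(3)[OF subsetD[OF supp_subset_Delta that]] by (simp only: mult_1_left)
  have nn: "pint (\<mu> l) (A l * q) \<ge> 0" for l
  proof (cases "A l * q = 0")
    case False
    show ?thesis by (intro less_imp_le M.pint_pos False qq)
  qed (simp only: M.pint_0 order_refl)
  have "A k * q \<noteq> 0" using nz q(1) by simp
  then have "pint (\<mu> k) (A k * q) > 0" by (intro M.pint_pos qq)
  then have "pairing A q > 0"
    unfolding pairing_def using nn by (intro sum_pos2[of _ k]) auto
  moreover have "pairing A q = 0" by (rule pairing_vanish[OF low q(2)])
  ultimately show False by simp
qed

text \<open>There are \<open>N\<close> conditions on \<open>N + 1\<close> coefficients. The
  remaining pairing cannot vanish as well, since \<open>bounded_form_zero\<close> would then kill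
  the form; so it can be normalised.\<close>

lemma ex_form:
  assumes "tot n = Suc N"
  shows "\<exists>A. bounded_form n A \<and> (\<forall>m<N. pairing A (monom 1 m) = 0) \<and> pairing A (monom 1 N) = 1"
proof -
  \<comment> \<open>Here the unknown coefficients are numbered, not the conditions: unknown
    \<open>j\<close> is the coefficient of order \<open>E j\<close> in component
    \<open>K j\<close>.\<close>
  define K where "K = (\<lambda>j. if j < n $ 1 then 1 else 2 :: 2)"
  define E where "E = (\<lambda>j. if j < n $ 1 then j else j - n $ 1)"
  obtain c where c: "\<exists>j\<le>N. c j \<noteq> (0::real)"
    "\<And>i. i < N \<Longrightarrow> (\<Sum>j\<le>N. pint (\<mu> (K j)) (monom 1 (E j) * monom 1 i) * c j) = 0"
    using homogeneous_system[of N "\<lambda>i j. pint (\<mu> (K j)) (monom 1 (E j) * monom 1 i)"] by blast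
  define A where "A = (\<lambda>k. \<Sum>j\<in>{j. j \<le> N \<and> K j = k}. monom (c j) (E j))"
  have fin: "finite {j. j \<le> N \<and> K j = k}" for k by simp
  have co: "coeff (A (K j)) (E j) = c j" if "j \<le> N" for j
  proof -
    have "coeff (A (K j)) (E j) = (\<Sum>i\<in>{i. i \<le> N \<and> K i = K j}. if i = j then c i else 0)"
      unfolding A_def coeff_sum
      by (rule sum.cong) (auto simp: K_def E_def split: if_splits)
    then show ?thesis using that by simp
  qed
  have bd: "bounded_form n A"
    unfolding bounded_form_def
  proof (intro allI impI)
    fix k i assume i: "n $ k \<le> i"
    have "E j \<noteq> i" if "j \<le> N" "K j = k" for j
      using that i assms by (auto simp: E_def K_def tot_def split: if_splits)
    then show "coeff (A k) i = 0" unfolding A_def coeff_sum by (intro sum.neutral) auto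
  qed
  have pair: "pairing A (monom 1 i) = (\<Sum>j\<le>N. pint (\<mu> (K j)) (monom 1 (E j) * monom 1 i) * c j)" for i
  proof -
    have t: "pint (\<mu> k) (monom (c j) (E j) * monom 1 i) = pint (\<mu> k) (monom 1 (E j) * monom 1 i) * c j" for k j
      using M.pint_smult[of k "c j" "monom 1 (E j) * monom 1 i"] by (simp add: mult_monom smult_monom)
    have "pairing A (monom 1 i) = (\<Sum>k\<in>UNIV. \<Sum>j\<in>{j. j \<le> N \<and> K j = k}. pint (\<mu> (K j)) (monom 1 (E j) * monom 1 i) * c j)"
      unfolding pairing_def A_def sum_distrib_right M.pint_sum[OF fin] t by (intro sum.cong) auto
    also have "\<dots> = (\<Sum>j\<in>(\<Union>k\<in>UNIV. {j. j \<le> N \<and> K j = k}). pint (\<mu> (K j)) (monom 1 (E j) * monom 1 i) * c j)"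
      by (rule sum.UNION_disjoint[symmetric]) auto
    also have "(\<Union>k\<in>UNIV. {j. j \<le> N \<and> K j = k}) = {..N}" by auto
    finally show ?thesis .
  qed
  have nz: "pairing A (monom 1 N) \<noteq> 0"
  proof
    assume 0: "pairing A (monom 1 N) = 0"
    have "pairing A (monom 1 m) = 0" if "m < tot n" for m
      using that 0 pair c(2)[of m] assms by (cases "m = N") auto
    from bounded_form_zero[OF bd this] c(1) co show False by (metis coeff_0)
  qed
  define B where "B = (\<lambda>k. smult (1 / pairing A (monom 1 N)) (A k))"
  have Bp: "pairing B q = pairing A q / pairing A (monom 1 N)" for q
    unfolding pairing_def B_def by (simp add: M.pint_smult sum_divide_distrib)
  have "bounded_form n B" using bd by (simp add: bounded_form_def B_def)
  then show ?thesis using nz c(2) pair by (intro exI[of _ B]) (simp add: Bp)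
qed

text \<open>The type I multiple orthogonal polynomials. For \<open>tot n = 0\<close> every bounded
  form is zero and the normalisation is impossible, which is why later facts assume
  \<open>tot n \<noteq> 0\<close>.\<close>

definition TI :: "nat^2 \<Rightarrow> 2 \<Rightarrow> real poly" where
  "TI n = (SOME A. bounded_form n A \<and> (\<forall>m<tot n - 1. pairing A (monom 1 m) = 0) \<and>
      pairing A (monom 1 (tot n - 1)) = 1)"

lemma TI_props:
  assumes "tot n \<noteq> 0"
  shows "bounded_form n (TI n)" "m < tot n - 1 \<Longrightarrow> pairing (TI n) (monom 1 m) = 0"
    "pairing (TI n) (monom 1 (tot n - 1)) = 1"
proof -
  have "tot n = Suc (tot n - 1)" using assms by simp
  from someI_ex[OF ex_form[OF this]]
  show "bounded_form n (TI n)" "m < tot n - 1 \<Longrightarrow> pairing (TI n) (monom 1 m) = 0"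
    "pairing (TI n) (monom 1 (tot n - 1)) = 1" unfolding TI_def by blast+
qed

lemma TI_high: "tot n \<noteq> 0 \<Longrightarrow> i \<ge> n $ k \<Longrightarrow> coeff (TI n k) i = 0"
  using TI_props(1) by (simp add: bounded_form_def)

lemma TI_degree_le: "tot n \<noteq> 0 \<Longrightarrow> degree (TI n k) \<le> n $ k - 1"
  by (rule degree_le) (use TI_high in auto)

lemma TI_pairing: "tot n = Suc N \<Longrightarrow> degree q \<le> N \<Longrightarrow> pairing (TI n) q = coeff q N"
  using pairing_top[of N "TI n" q] TI_props[of n] by auto

lemma TI_nonzero: "tot n \<noteq> 0 \<Longrightarrow> \<exists>k. TI n k \<noteq> 0"
proof (rule ccontr)
  assume n: "tot n \<noteq> 0" and "\<not> ?thesis"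
  then have "pairing (TI n) (monom 1 (tot n - 1)) = 0" by (simp add: pairing_def M.pint_0)
  then show False using TI_props(3)[OF n] by simp
qed

text \<open>The pairing of \<open>TI (n + axis k 1)\<close> with \<open>P n\<close> is computed
  twice: it is 1 by normalisation, while orthogonality of \<open>P n\<close> leaves only the leading
  term of component \<open>k\<close>.\<close>

lemma TI_lead: "coeff (TI (n + axis k 1) k) (n $ k) * h n k = 1"
proof -
  let ?n = "n + axis k 1"
  have nz: "tot ?n \<noteq> 0" by (simp add: tot_add_axis)
  have "1 = pairing (TI ?n) (P n)"
    using TI_pairing[of ?n "tot n" "P n"] by (simp add: tot_add_axis mop_props(2) mop_top)
  also have "\<dots> = (\<Sum>l\<in>UNIV. if l = k then coeff (TI ?n k) (n $ k) * h n k else 0)"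
    unfolding pairing_def
  proof (rule sum.cong)
    fix l :: 2
    show "pint (\<mu> l) (TI ?n l * P n) = (if l = k then coeff (TI ?n k) (n $ k) * h n k else 0)"
    proof (cases "l = k")
      case True
      have "degree (TI ?n k) \<le> n $ k" using TI_degree_le[OF nz, of k] by (simp add: axis_def)
      then have "pint (\<mu> k) (P n * TI ?n k) = coeff (TI ?n k) (n $ k) * h n k"
        unfolding h_def by (rule pint_mult_top[OF mop_orth, rotated])
      then show ?thesis using True by (simp add: mult.commute)
    next
      case False
      have "pint (\<mu> l) (P n * TI ?n l) = 0"
      proof (cases "TI ?n l = 0")
        case False
        then have "degree (TI ?n l) < n $ l"
          using bounded_form_degree[OF TI_props(1)[OF nz] False] \<open>l \<noteq> k\<close> by (simp add: axis_def)
        then show ?thesis by (rule pint_mult_vanish[OF mop_orth, rotated])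
      qed (simp add: M.pint_0)
      then show ?thesis using False by (simp add: mult.commute)
    qed
  qed simp
  finally show ?thesis by simp
qed

lemma pairing_mop_TI: "tot n \<noteq> 0 \<Longrightarrow> pairing (TI n) (P n) = 0"
  unfolding pairing_def
proof (rule sum.neutral, rule ballI)
  fix k assume n: "tot n \<noteq> 0"
  have "pint (\<mu> k) (P n * TI n k) = 0"
  proof (cases "TI n k = 0")
    case False
    show ?thesis
      by (rule pint_mult_vanish[OF mop_orth, rotated, OF bounded_form_degree[OF TI_props(1)[OF n] False]])
  qed (simp add: M.pint_0)
  then show "pint (\<mu> k) (TI n k * P n) = 0" by (simp add: mult.commute)
qed

text \<open>This is the transpose of the type II recurrence. The remainder \<open>R\<close> is again
  a bounded form for \<open>n\<close>, because \<open>ra\<close> matches leading coefficients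
  through \<open>TI_lead\<close>, and it pairs to zero with all degrees below \<open>tot n\<close>,
  so it vanishes.\<close>

lemma recurrence_I:
  assumes n: "\<And>k. n $ k > 0"
  shows "[:0, 1:] * TI n k = TI (n - axis i 1) k + smult (rb (n - axis i 1) i) (TI n k)
     + smult (ra n 1) (TI (n + axis 1 1) k) + smult (ra n 2) (TI (n + axis 2 1) k)"
proof -
  let ?m = "n - axis i 1"
  obtain N where N: "tot n = Suc (Suc N)" using n[of 1] n[of 2] by (cases "n $ 1"; cases "n $ 2") (auto simp: tot_def)
  have m: "tot ?m = Suc N" using tot_diff_axis[of n i] n[of i] N by simp
  have up: "tot (n + axis j 1) = Suc (Suc (Suc N))" for j by (simp add: tot_add_axis N)
  have mn: "?m + axis i 1 = n" by (rule diff_add_axis[OF n])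
  define R where "R = (\<lambda>k. [:0, 1:] * TI n k - TI ?m k - smult (rb ?m i) (TI n k)
     - smult (ra n 1) (TI (n + axis 1 1) k) - smult (ra n 2) (TI (n + axis 2 1) k))"
  have pR: "pairing R q = pairing (TI n) ([:0, 1:] * q) - pairing (TI ?m) q - rb ?m i * pairing (TI n) q
     - ra n 1 * pairing (TI (n + axis 1 1)) q - ra n 2 * pairing (TI (n + axis 2 1)) q" for q
  proof -
    have "R k * q = TI n k * ([:0, 1:] * q) - TI ?m k * q - smult (rb ?m i) (TI n k * q)
     - smult (ra n 1) (TI (n + axis 1 1) k * q) - smult (ra n 2) (TI (n + axis 2 1) k * q)" for k
      unfolding R_def by (simp only: left_diff_distrib mult_smult_left mult.assoc mult.left_commute[of "[:0, 1:]"])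
    then show ?thesis
      unfolding pairing_def by (simp only: M.pint_diff M.pint_smult sum_subtractf sum_distrib_left)
  qed
  have bf: "bounded_form n R"
    unfolding bounded_form_def
  proof (intro allI impI)
    fix l k assume k: "n $ l \<le> k"
    have 1: "coeff (TI ?m l) k = 0" "coeff (TI n l) k = 0"
      using k m N by (auto intro!: TI_high simp: axis_def)
    show "coeff (R l) k = 0"
    proof (cases "k = n $ l")
      case False
      then have "coeff (TI (n + axis j 1) l) k = 0" for j
        using k up by (intro TI_high) (auto simp: axis_def)
      moreover have "coeff ([:0, 1:] * TI n l) k = 0"
        using False k N n[of l] by (cases k) (auto intro!: TI_high)
      ultimately show ?thesis unfolding R_def using 1 by simp
    next
      case True
      obtain p where p: "n $ l = Suc p" using n[of l] by (cases "n $ l") auto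
      define n' where "n' = n - axis l 1"
      have n': "n' + axis l 1 = n" "n' $ l = p" using diff_add_axis[OF n[of l]] p by (auto simp: n'_def axis_def)
      have lead1: "coeff (TI n l) p * h n' l = 1" using TI_lead[of n' l] n' by simp
      have lead2: "coeff (TI (n + axis l 1) l) k * h n l = 1" using TI_lead[of n l] True by simp
      have other: "coeff (TI (n + axis j 1) l) k = 0" if "j \<noteq> l" for j
        using True that up by (intro TI_high) (auto simp: axis_def)
      have ra: "ra n l = h n l / h n' l" using p by (simp add: ra_def n'_def)
      have "ra n 1 * coeff (TI (n + axis 1 1) l) k + ra n 2 * coeff (TI (n + axis 2 1) l) k
          = ra n l * coeff (TI (n + axis l 1) l) k"
        using exhaust_2[of l] other by auto
      also have "\<dots> = coeff (TI n l) p"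
        unfolding ra using lead1 lead2 h_nonzero[of n' l] h_nonzero[of n l] by (simp add: field_simps)
      finally have "ra n 1 * coeff (TI (n + axis 1 1) l) k + ra n 2 * coeff (TI (n + axis 2 1) l) k = coeff (TI n l) p" .
      then show ?thesis unfolding R_def using 1 True p by simp
    qed
  qed
  have low: "pairing R (monom 1 p) = 0" if "p < Suc N" for p
  proof -
    have X: "[:0, 1:] * monom 1 p = monom (1::real) (Suc p)" by (simp add: monom_Suc)
    have d: "degree (monom (1::real) l) = l" for l by (simp add: degree_monom_eq)
    have "pairing (TI (n + axis j 1)) (monom 1 p) = 0" for j
      using that by (subst TI_pairing[OF up]) (auto simp: d)
    moreover have "pairing (TI n) (monom 1 p) = 0" using that by (subst TI_pairing[OF N]) (auto simp: d)
    moreover have "pairing (TI n) (monom 1 (Suc p)) = pairing (TI ?m) (monom 1 p)"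
      using that by (simp add: TI_pairing[OF N] TI_pairing[OF m] d)
    ultimately show ?thesis unfolding pR X by simp
  qed
  have "pairing R (monom 1 l) = 0" if "l < tot n" for l
  proof (cases "l = Suc N")
    case False
    then show ?thesis using that N by (intro low) simp
  next
    case True
    \<comment> \<open>The highest pairing is tested with \<open>P ?m\<close> instead of a monomial,
      which changes nothing since lower pairings vanish. Its type II recurrence then produces the
      coefficient \<open>rb ?m i\<close>.\<close>
    have dm: "degree (P ?m) = Suc N" using mop_props(2)[of ?m] m by simp
    have cm: "coeff (P ?m) (Suc N) = 1" using mop_top[of ?m] m by simp
    have "pairing R (P ?m) = pairing R (monom 1 (Suc N))"
      using pairing_top[of "Suc N" R "P ?m"] low dm cm by simp
    moreover have "pairing R (P ?m) = 0"
    proof -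
      have pred: "pairing (TI n) (mop_pred \<mu> ?m j) = 0" for j
      proof -
        have "degree (mop_pred \<mu> ?m j) \<le> N"
          by (rule degree_le) (use mop_pred_facts(1)[of ?m] m in auto)
        then have "degree (mop_pred \<mu> ?m j) \<le> Suc N" by simp
        then show ?thesis using mop_pred_facts(1)[of ?m "Suc N" j] m by (simp add: TI_pairing[OF N])
      qed
      have 1: "pairing (TI n) (P ?m) = 1" using dm cm by (simp add: TI_pairing[OF N])
      have "pairing (TI n) ([:0, 1:] * P ?m) = rb ?m i"
        unfolding recurrence_II[of ?m i] pairing_add pairing_smult pred mn 1
        using pairing_mop_TI[of n] N by simp
      moreover have "pairing (TI (n + axis j 1)) (P ?m) = 0" for j
        using dm mop_high[of ?m "Suc (Suc N)"] m by (simp add: TI_pairing[OF up])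
      moreover have "pairing (TI ?m) (P ?m) = 0" using pairing_mop_TI[of ?m] m by simp
      ultimately show ?thesis unfolding pR using 1 by simp
    qed
    ultimately show ?thesis using True by simp
  qed
  from bounded_form_zero[OF bf this] have "R k = 0" .
  then show ?thesis unfolding R_def by (simp add: algebra_simps)
qed

section \<open>Cauchy transforms of forms and their zeros\<close>

definition D :: "complex set" where
  "D = complex_of_real ` (Delta \<mu> 1 \<union> Delta \<mu> 2)"

lemma not_in_D: "z \<notin> D \<Longrightarrow> z \<notin> complex_of_real ` measure_supp (\<mu> k)"
  using supp_subset_Delta[of k] exhaust_2[of k] unfolding D_def by auto

lemma not_in_D_real: "complex_of_real E \<notin> D \<Longrightarrow> E \<notin> Delta \<mu> k"
  using exhaust_2[of k] unfolding D_def by auto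

lemma closed_D: "closed D"
  unfolding D_def by (intro compact_imp_closed compact_continuous_image continuous_intros compact_Un compact_Delta)

definition ctransform :: "(2 \<Rightarrow> real poly) \<Rightarrow> complex \<Rightarrow> complex" where
  "ctransform A z = (\<Sum>k\<in>UNIV. ptransform (\<mu> k) (A k) z)"

lemma ctransform_X_mult:
  assumes "z \<notin> D"
  shows "ctransform (\<lambda>k. [:0, 1:] * A k) z = z * ctransform A z - of_real (pairing A 1)"
  unfolding ctransform_def pairing_def M.ptransform_X_mult[OF not_in_D[OF assms]]
  by (simp add: sum_subtractf sum_distrib_left)

lemma ctransform_add:
  "z \<notin> D \<Longrightarrow> ctransform (\<lambda>k. A k + B k) z = ctransform A z + ctransform B z"
  unfolding ctransform_def by (simp add: M.ptransform_add not_in_D sum.distrib)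

lemma ctransform_smult: "ctransform (\<lambda>k. smult c (A k)) z = of_real c * ctransform A z"
  unfolding ctransform_def by (simp add: M.ptransform_smult sum_distrib_left)

lemma ctransform_holomorphic: "ctransform A holomorphic_on - D"
  unfolding ctransform_def
  by (intro holomorphic_on_sum holomorphic_on_subset[OF M.ptransform_holomorphic]) (use not_in_D in auto)

lemma ctransform_at_infinity: "(ctransform A \<longlongrightarrow> 0) at_infinity"
  unfolding ctransform_def using tendsto_sum[of UNIV "\<lambda>k. ptransform (\<mu> k) (A k)" "\<lambda>_. 0"] M.ptransform_at_infinity by simp

text \<open>Pulling \<open>q\<close> out of the transform costs the pairing of the form with
  \<open>(q z - q x) / (z - x)\<close>, a polynomial in \<open>x\<close> of degree less than
  \<open>N\<close>, which is zero. The induction carries this out one coefficient at a time.\<close>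

lemma ctransform_mult:
  assumes z: "z \<notin> D" and low: "\<And>m. m < N \<Longrightarrow> pairing A (monom 1 m) = 0" and deg: "degree q \<le> N"
  shows "ctransform (\<lambda>k. A k * q) z = poly (map_poly of_real q) z * ctransform A z"
  using deg
proof (induction q)
  case 0
  show ?case by (simp add: ctransform_def M.ptransform_0)
next
  case (pCons a q)
  have IH: "ctransform (\<lambda>k. A k * q) z = poly (map_poly of_real q) z * ctransform A z"
    using pCons by (cases "q = 0") (auto simp: ctransform_def M.ptransform_0)
  have "A k * pCons a q = smult a (A k) + [:0, 1:] * (A k * q)" for k by simp
  then have "ctransform (\<lambda>k. A k * pCons a q) z
     = ctransform (\<lambda>k. smult a (A k)) z + ctransform (\<lambda>k. [:0, 1:] * (A k * q)) z"
    using ctransform_add[OF z] by presburger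
  also have "\<dots> = of_real a * ctransform A z + (z * ctransform (\<lambda>k. A k * q) z - of_real (pairing (\<lambda>k. A k * q) 1))"
    by (simp only: ctransform_smult ctransform_X_mult[OF z])
  also have "pairing (\<lambda>k. A k * q) 1 = pairing A q" by (simp add: pairing_def)
  also have "pairing A q = 0"
  proof (cases "q = 0")
    case False
    then have "degree q < N" using pCons.prems by simp
    then show ?thesis by (rule pairing_vanish[OF low, rotated])
  qed (simp add: pairing_def M.pint_0)
  finally show ?case unfolding IH using pCons.hyps by (simp add: map_poly_pCons algebra_simps)
qed

lemma ctransform_nonzero_real:
  fixes E :: real
  assumes E: "of_real E \<notin> D" and B: "\<exists>k. B k \<noteq> 0"
    and pos: "\<And>k x. x \<in> Delta \<mu> k \<Longrightarrow> poly (B k) x / (E - x) \<ge> 0"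
  shows "ctransform B (of_real E) \<noteq> 0"
proof -
  obtain k where k: "B k \<noteq> 0" using B by blast
  have ne0: "E \<notin> measure_supp (\<mu> l)" for l
    using not_in_D[OF E, of l] by auto
  then have ne: "x \<noteq> E" if "x \<in> measure_supp (\<mu> l)" for x l
    using that by metis
  have meas: "(\<lambda>x. poly p x / (E - x)) \<in> borel_measurable borel" for p
  proof -
    have "poly p \<in> borel_measurable borel" "(\<lambda>x. E - x) \<in> borel_measurable borel"
      by (intro borel_measurable_continuous_onI continuous_intros)+
    then show ?thesis by measurable
  qed
  have int: "integrable (\<mu> l) (\<lambda>x. poly (B l) x / (E - x))" for l
    by (rule M.integrable_continuous[OF meas]) (use ne0 in \<open>auto intro!: continuous_intros\<close>)
  have eq: "ctransform B (of_real E) = of_real (\<Sum>l\<in>UNIV. \<integral>x. poly (B l) x / (E - x) \<partial>\<mu> l)"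
    unfolding ctransform_def ptransform_def of_real_sum
    by (intro sum.cong refl) (simp flip: of_real_diff of_real_divide)
  have nn: "(\<integral>x. poly (B l) x / (E - x) \<partial>\<mu> l) \<ge> 0" for l
    using M.AE_supp[of l] supp_subset_Delta[of l] pos by (intro integral_nonneg_AE) (auto elim!: eventually_mono)
  obtain x where x: "x \<in> measure_supp (\<mu> k)" "poly (B k) x \<noteq> 0" using M.supp_nonroot[OF k] by blast
  have "(\<integral>x. poly (B k) x / (E - x) \<partial>\<mu> k) > 0"
  proof (rule M.integral_pos[OF meas int _ x(1)])
    show "0 \<le> poly (B k) y / (E - y)" if "y \<in> measure_supp (\<mu> k)" for y
      using pos that supp_subset_Delta by blast
    show "isCont (\<lambda>x. poly (B k) x / (E - x)) x" using ne[OF x(1)] by (intro continuous_intros) auto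
    have "0 \<le> poly (B k) x / (E - x)" using pos x(1) supp_subset_Delta by blast
    then show "0 < poly (B k) x / (E - x)" using x ne[OF x(1)] by (simp add: order_less_le)
  qed
  then have "(\<Sum>l\<in>UNIV. \<integral>x. poly (B l) x / (E - x) \<partial>\<mu> l) > 0" using nn by (intro sum_pos2[of _ k]) auto
  then show ?thesis unfolding eq of_real_eq_0_iff by simp
qed

text \<open>The imaginary part of \<open>1 / (z - x)\<close> is \<open>- Im z\<close> divided by the
  squared modulus of \<open>z - x\<close>, so it has one sign for all real \<open>x\<close>.\<close>

lemma ctransform_Im_nonzero:
  assumes z: "Im z \<noteq> 0" and B: "\<exists>k. B k \<noteq> 0"
    and pos: "\<And>k x. x \<in> Delta \<mu> k \<Longrightarrow> poly (B k) x \<ge> 0"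
  shows "Im (ctransform B z) \<noteq> 0"
proof -
  obtain k where k: "B k \<noteq> 0" using B by blast
  have zD: "z \<notin> D" using z by (auto simp: D_def)
  have ne: "z - of_real x \<noteq> 0" for x using z by (auto simp: complex_eq_iff)
  have meas: "(\<lambda>x. poly p x / (cmod (z - of_real x))\<^sup>2) \<in> borel_measurable borel" for p
    by (intro borel_measurable_continuous_onI continuous_intros) (use ne in auto)
  have int: "integrable (\<mu> l) (\<lambda>x. poly (B l) x / (cmod (z - of_real x))\<^sup>2)" for l
    by (rule M.integrable_continuous[OF meas]) (use ne in \<open>auto intro!: continuous_intros\<close>)
  have "Im (ptransform (\<mu> l) (B l) z) = - Im z * (\<integral>x. poly (B l) x / (cmod (z - of_real x))\<^sup>2 \<partial>\<mu> l)" for l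
  proof -
    have "Im (ptransform (\<mu> l) (B l) z) = (\<integral>x. Im (complex_of_real (poly (B l) x) / (z - complex_of_real x)) \<partial>\<mu> l)"
      unfolding ptransform_def by (rule integral_Im[symmetric, OF M.kernel_integrable[OF not_in_D[OF zD]]])
    also have "\<dots> = (\<integral>x. - Im z * (poly (B l) x / (cmod (z - of_real x))\<^sup>2) \<partial>\<mu> l)"
      by (rule Bochner_Integration.integral_cong) (auto simp: Im_divide cmod_power2)
    finally show ?thesis unfolding integral_mult_right_zero .
  qed
  then have eq: "Im (ctransform B z) = - Im z * (\<Sum>l\<in>UNIV. \<integral>x. poly (B l) x / (cmod (z - of_real x))\<^sup>2 \<partial>\<mu> l)"
    unfolding ctransform_def by (simp add: sum_distrib_left)
  have nn: "(\<integral>x. poly (B l) x / (cmod (z - of_real x))\<^sup>2 \<partial>\<mu> l) \<ge> 0" for l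
    using M.AE_supp[of l] supp_subset_Delta[of l] pos
    by (intro integral_nonneg_AE) (auto elim!: eventually_mono intro!: divide_nonneg_nonneg)
  obtain x where x: "x \<in> measure_supp (\<mu> k)" "poly (B k) x \<noteq> 0" using M.supp_nonroot[OF k] by blast
  have "(\<integral>x. poly (B k) x / (cmod (z - of_real x))\<^sup>2 \<partial>\<mu> k) > 0"
  proof (rule M.integral_pos[OF meas int _ x(1)])
    show "0 \<le> poly (B k) y / (cmod (z - of_real y))\<^sup>2" if "y \<in> measure_supp (\<mu> k)" for y
      using pos that supp_subset_Delta by (intro divide_nonneg_nonneg) auto
    show "isCont (\<lambda>x. poly (B k) x / (cmod (z - of_real x))\<^sup>2) x" using ne by (intro continuous_intros) auto
    have "0 \<le> poly (B k) x" using pos x(1) supp_subset_Delta by blast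
    then show "0 < poly (B k) x / (cmod (z - of_real x))\<^sup>2" using x ne by (intro divide_pos_pos) auto
  qed
  then have "(\<Sum>l\<in>UNIV. \<integral>x. poly (B l) x / (cmod (z - of_real x))\<^sup>2 \<partial>\<mu> l) > 0" using nn by (intro sum_pos2[of _ k]) auto
  then show ?thesis unfolding eq using z by simp
qed

definition L :: "nat^2 \<Rightarrow> complex \<Rightarrow> complex" where
  "L n = ctransform (TI n)"

text \<open>By \<open>ctransform_mult\<close> a suitable multiple of \<open>L n z\<close> is the
  transform of a form with controlled signs, and that is nonzero.\<close>

lemma L_nonzero:
  assumes n: "tot n \<noteq> 0" and z: "z \<notin> D"
  shows "L n z \<noteq> 0"
proof -
  obtain N where N: "tot n = Suc N" using n by (cases "tot n") auto
  have low: "m < N \<Longrightarrow> pairing (TI n) (monom 1 m) = 0" for m using TI_props(2)[OF n, of m] N by simp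
  have "\<exists>q. degree q \<le> N \<and> ctransform (\<lambda>k. TI n k * q) z \<noteq> 0"
  proof (cases "Im z = 0")
    case False
    obtain q where q: "q \<noteq> 0" "degree q < tot n" "\<And>k x. x \<in> Delta \<mu> k \<Longrightarrow> 1 * poly (TI n k * q) x \<ge> 0"
      by (rule sign_multiplierE[OF TI_props(1)[OF n] TI_nonzero[OF n], of "\<lambda>_. 1"]) auto
    have "Im (ctransform (\<lambda>k. TI n k * q) z) \<noteq> 0"
      by (rule ctransform_Im_nonzero[OF False]) (use q TI_nonzero[OF n] in \<open>auto simp del: poly_mult\<close>)
    then show ?thesis using q(2) N by (intro exI[of _ q]) auto
  next
    case True
    then obtain E where E: "z = of_real E" by (metis complex_is_Real_iff Reals_cases)
    \<comment> \<open>A real point off \<open>D\<close> lies to one side of each interval, so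
      \<open>E - x\<close> has a constant sign there. The multiplier is made to reproduce that sign,
      in whatever combination the two intervals require.\<close>
    have "\<exists>t::real. \<bar>t\<bar> = 1 \<and> (\<forall>x\<in>Delta \<mu> k. t * (E - x) > 0)" for k
    proof -
      obtain l r where lr: "Delta \<mu> k = {l..r}" using Delta_interval by blast
      then have "E < l \<or> E > r" using not_in_D_real[of E k] z E Delta_nonempty[of k] by auto
      then show ?thesis
        by (elim disjE) (auto simp: lr intro: exI[of _ "-1"] exI[of _ 1])
    qed
    then obtain t where t: "\<And>k. \<bar>t k :: real\<bar> = 1" "\<And>k x. x \<in> Delta \<mu> k \<Longrightarrow> t k * (E - x) > 0" by metis
    obtain q where q: "q \<noteq> 0" "degree q < tot n" "\<And>k x. x \<in> Delta \<mu> k \<Longrightarrow> t k * poly (TI n k * q) x \<ge> 0"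
      by (rule sign_multiplierE[OF TI_props(1)[OF n] TI_nonzero[OF n], of t]) (use t(1) in auto)
    have "ctransform (\<lambda>k. TI n k * q) (of_real E) \<noteq> 0"
    proof (rule ctransform_nonzero_real)
      show "complex_of_real E \<notin> D" using z E by simp
      show "\<exists>k. TI n k * q \<noteq> 0" using q(1) TI_nonzero[OF n] by simp
      fix k x assume x: "x \<in> Delta \<mu> k"
      have "0 \<le> (t k * poly (TI n k * q) x) / (t k * (E - x))"
        by (intro divide_nonneg_pos q(3) t(2) x)
      also have "\<dots> = poly (TI n k * q) x / (E - x)" using t(1)[of k] by auto
      finally show "0 \<le> poly (TI n k * q) x / (E - x)" .
    qed
    then show ?thesis using q(2) N E by (intro exI[of _ q]) auto
  qed
  then obtain q where q: "degree q \<le> N" "ctransform (\<lambda>k. TI n k * q) z \<noteq> 0" by blast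
  then show ?thesis using ctransform_mult[OF z low q(1)] by (auto simp: L_def)
qed

text \<open>The transform of \<open>recurrence_I\<close>. Multiplication by \<open>x\<close> would
  leave a boundary term, the pairing with 1, but this vanishes since \<open>tot n\<close> is at
  least 2.\<close>

lemma L_recurrence:
  assumes n: "\<And>k. n $ k > 0" and z: "z \<notin> D"
  shows "z * L n z = L (n - axis i 1) z + of_real (rb (n - axis i 1) i) * L n z
     + of_real (ra n 1) * L (n + axis 1 1) z + of_real (ra n 2) * L (n + axis 2 1) z"
proof -
  obtain N where N: "tot n = Suc (Suc N)" using n[of 1] n[of 2] by (cases "n $ 1"; cases "n $ 2") (auto simp: tot_def)
  have "pairing (TI n) 1 = 0" using TI_pairing[OF N, of 1] by simp
  then have "z * L n z = ctransform (\<lambda>k. [:0, 1:] * TI n k) z"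
    unfolding L_def ctransform_X_mult[OF z] by simp
  also have "\<dots> = L (n - axis i 1) z + of_real (rb (n - axis i 1) i) * L n z
     + of_real (ra n 1) * L (n + axis 1 1) z + of_real (ra n 2) * L (n + axis 2 1) z"
    unfolding recurrence_I[OF n, of _ i] L_def ctransform_add[OF z] ctransform_smult ..
  finally show ?thesis .
qed

text \<open>Orthogonality turns \<open>z ^ N * L n z\<close> into the transform of the form
  multiplied by \<open>x ^ N\<close>; one more factor \<open>z\<close> extracts the total mass of
  that form, the normalised pairing 1.\<close>

lemma L_asymptotics:
  assumes n: "tot n = Suc N"
  shows "((\<lambda>z. z ^ Suc N * L n z) \<longlongrightarrow> 1) at_infinity"
proof -
  let ?A = "\<lambda>k. TI n k * monom 1 N"
  have "((\<lambda>z. ctransform (\<lambda>k. [:0, 1:] * ?A k) z + of_real (pairing ?A 1)) \<longlongrightarrow> 0 + of_real (pairing ?A 1)) at_infinity"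
    by (intro tendsto_add tendsto_const ctransform_at_infinity)
  moreover have "pairing ?A 1 = 1" using TI_props(3)[of n] n by (simp add: pairing_def)
  ultimately have lim: "((\<lambda>z. ctransform (\<lambda>k. [:0, 1:] * ?A k) z + 1) \<longlongrightarrow> 1) at_infinity" by simp
  have "bounded D" unfolding D_def
    by (intro compact_imp_bounded compact_continuous_image continuous_intros compact_Un compact_Delta)
  then obtain B where B: "\<And>z. z \<in> D \<Longrightarrow> norm z \<le> B" unfolding bounded_iff by blast
  have "\<forall>\<^sub>F z in at_infinity. ctransform (\<lambda>k. [:0, 1:] * ?A k) z + 1 = z ^ Suc N * L n z"
    unfolding eventually_at_infinity
  proof (intro exI[of _ "B + 1"] allI impI)
    fix z :: complex assume "B + 1 \<le> norm z"
    then have z: "z \<notin> D" using B[of z] by fastforce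
    have m: "poly (map_poly complex_of_real (monom 1 N)) z = z ^ N" by (simp add: map_poly_monom poly_monom)
    have "ctransform ?A z = z ^ N * L n z"
      using ctransform_mult[OF z, of N "TI n" "monom 1 N"] TI_props(2)[of n] n
      unfolding m L_def by (simp add: degree_monom_eq)
    then show "ctransform (\<lambda>k. [:0, 1:] * ?A k) z + 1 = z ^ Suc N * L n z"
      unfolding ctransform_X_mult[OF z] \<open>pairing ?A 1 = 1\<close> by simp
  qed
  from Lim_transform_eventually[OF lim this] show ?thesis .
qed

lemma L_holomorphic: "L n holomorphic_on - D"
  unfolding L_def by (rule ctransform_holomorphic)

lemma TI_axis: "TI (axis k 1) j = (if j = k then [:1 / measure (\<mu> k) UNIV:] else 0)"
proof -
  have n: "tot (axis k 1) = Suc 0" using tot_add_axis[of 0 k] by (simp add: tot_def)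
  have deg: "TI (axis k 1) j = [:coeff (TI (axis k 1) j) 0:]" for j
    by (rule poly_eqI) (use TI_high[of "axis k 1" "j"] n in \<open>auto simp: coeff_pCons axis_def split: nat.split if_splits\<close>)
  have o: "TI (axis k 1) j = 0" if "j \<noteq> k" for j
    by (rule poly_eqI) (use TI_high[of "axis k 1" "j"] n that in \<open>auto simp: axis_def\<close>)
  have "1 = pairing (TI (axis k 1)) 1" using TI_pairing[OF n, of 1] by simp
  also have "\<dots> = (\<Sum>j\<in>UNIV. if j = k then pint (\<mu> k) (TI (axis k 1) k) else 0)"
    unfolding pairing_def by (rule sum.cong) (auto simp: o M.pint_0)
  also have "\<dots> = pint (\<mu> k) (smult (coeff (TI (axis k 1) k) 0) 1)" using deg[of k] by simp
  also have "\<dots> = coeff (TI (axis k 1) k) 0 * measure (\<mu> k) UNIV" by (simp only: M.pint_smult M.pint_1)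
  finally have "coeff (TI (axis k 1) k) 0 = 1 / measure (\<mu> k) UNIV"
    using M.total_mass_pos[of k] by (simp add: field_simps)
  then show ?thesis using deg[of k] o by auto
qed

lemma L_axis: "L (axis k 1) z = of_real (1 / measure (\<mu> k) UNIV) * stieltjes (\<mu> k) z"
proof -
  have "L (axis k 1) z = (\<Sum>j\<in>UNIV. if j = k then ptransform (\<mu> k) (smult (1 / measure (\<mu> k) UNIV) 1) z else 0)"
    unfolding L_def ctransform_def by (rule sum.cong) (auto simp: TI_axis M.ptransform_0)
  then show ?thesis unfolding stieltjes_eq_ptransform M.ptransform_smult[symmetric] by simp
qed

lemma L_fun_eq: "L_fun \<mu> c z = of_real (c $ 1) * L (axis 1 1) z + of_real (c $ 2) * L (axis 2 1) z"
  unfolding L_fun_def L_axis by simp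

text \<open>The underlying form has constant components, and a linear multiplier
  \<open>a + b x\<close> makes them nonnegative. At a zero its transform would reduce to a real
  constant, against the nonvanishing imaginary part. At real \<open>z\<close> this gives no
  contradiction.\<close>

lemma L_fun_nonzero:
  assumes c: "c $ 1 + c $ 2 = 1" and z: "Im z \<noteq> 0"
  shows "L_fun \<mu> c z \<noteq> 0"
proof
  assume 0: "L_fun \<mu> c z = 0"
  define A where "A = (\<lambda>k. [:c $ k / measure (\<mu> k) UNIV:])"
  have zD: "z \<notin> D" using z by (auto simp: D_def)
  have Az: "ctransform A z = L_fun \<mu> c z"
  proof -
    have "A k = smult (c $ k / measure (\<mu> k) UNIV) 1" for k by (simp add: A_def)
    then show ?thesis unfolding ctransform_def L_fun_def
      by (simp only: M.ptransform_smult stieltjes_eq_ptransform sum_2)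
  qed
  have bf: "bounded_form (vector [1, 1]) A"
    by (auto simp: bounded_form_def A_def forall_2 coeff_pCons split: nat.split)
  have nz: "\<exists>k. A k \<noteq> 0" using c M.total_mass_pos[of 1] M.total_mass_pos[of 2] by (force simp: A_def ex_2_iff)
  obtain q where q: "q \<noteq> 0" "degree q < tot (vector [1, 1])" "\<And>k x. x \<in> Delta \<mu> k \<Longrightarrow> 1 * poly (A k * q) x \<ge> 0"
    by (rule sign_multiplierE[OF bf nz, of "\<lambda>_. 1"]) auto
  have "degree q \<le> 1" using q(2) by (simp add: tot_def)
  then have "q = [:coeff q 0, coeff q 1:]"
    by (intro poly_eqI) (auto simp: coeff_pCons One_nat_def intro: coeff_eq_0 split: nat.split)
  then obtain a b where ab: "q = [:a, b:]" by blast
  have "Im (ctransform (\<lambda>k. A k * q) z) \<noteq> 0"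
    by (rule ctransform_Im_nonzero[OF z]) (use q nz in \<open>auto simp del: poly_mult\<close>)
  moreover have "(\<lambda>k. A k * q) = (\<lambda>k. smult a (A k) + smult b ([:0, 1:] * A k))"
    by (auto simp: ab A_def fun_eq_iff)
  then have "ctransform (\<lambda>k. A k * q) z = of_real a * 0 + of_real b * (z * 0 - of_real (pairing A 1))"
    by (simp only: ctransform_add[OF zD] ctransform_smult ctransform_X_mult[OF zD] Az 0)
  then have "Im (ctransform (\<lambda>k. A k * q) z) = 0" by simp
  ultimately show False by simp
qed

end

section \<open>The Jacobi matrix on the tree\<close>

lemma at_parent_linear:
  "at_parent (\<lambda>v. a * f v + b * g v) Y = a * at_parent f Y + b * at_parent g Y"
  by (cases Y) auto

lemma jacobi_linear:
  "jacobi \<mu> \<kappa> (\<lambda>v. a * f v + b * g v) = (\<lambda>v. a * jacobi \<mu> \<kappa> f v + b * jacobi \<mu> \<kappa> g v)"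
  unfolding jacobi_def at_parent_linear by (simp add: fun_eq_iff algebra_simps)

text \<open>Every vertex except the root is the child of exactly one vertex. Summing over edges from
  their lower or upper end is what makes the Jacobi matrix symmetric.\<close>

lemma sum_over_children:
  fixes q :: "vertex \<Rightarrow> complex"
  assumes G: "finite G" and root: "q Root = 0"
    and nz: "\<And>x i. q (Child x i) \<noteq> 0 \<Longrightarrow> Child x i \<in> G \<and> x \<in> G"
  shows "(\<Sum>v\<in>G. q v) = (\<Sum>x\<in>G. q (Child x 1) + q (Child x 2))"
proof -
  let ?c = "\<lambda>(x, i). Child x i"
  have "(\<Sum>x\<in>G. q (Child x 1) + q (Child x 2)) = (\<Sum>x\<in>G. \<Sum>i\<in>UNIV. q (Child x i))" by (simp add: sum_2)
  also have "\<dots> = (\<Sum>p\<in>G \<times> UNIV. q (?c p))"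
    by (simp add: sum.cartesian_product split_def)
  also have "\<dots> = (\<Sum>v\<in>?c ` (G \<times> UNIV). q v)"
    by (subst sum.reindex) (auto simp: inj_on_def)
  also have "\<dots> = (\<Sum>v\<in>G \<union> ?c ` (G \<times> UNIV). q v)"
  proof (rule sum.mono_neutral_left)
    show "\<forall>v\<in>G \<union> ?c ` (G \<times> UNIV) - ?c ` (G \<times> UNIV). q v = 0"
    proof
      fix v assume v: "v \<in> G \<union> ?c ` (G \<times> UNIV) - ?c ` (G \<times> UNIV)"
      show "q v = 0"
      proof (cases v)
        case (Child x i)
        then show ?thesis using nz[of x i] v by (force simp: image_iff)
      qed (use root in simp)
    qed
  qed (use G in auto)
  also have "\<dots> = (\<Sum>v\<in>G. q v)"
    by (rule sum.mono_neutral_right) (use G nz in auto)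
  finally show ?thesis ..
qed

lemma jacobi_finite_support:
  assumes f: "finite {v. f v \<noteq> 0}"
  shows "finite {v. jacobi \<mu> \<kappa> f v \<noteq> 0}"
proof (rule finite_subset)
  let ?F = "{v. f v \<noteq> 0}"
  let ?par = "\<lambda>v. case v of Root \<Rightarrow> Root | Child x i \<Rightarrow> x"
  show "{v. jacobi \<mu> \<kappa> f v \<noteq> 0} \<subseteq> ?F \<union> (\<lambda>(x, i). Child x i) ` (?F \<times> UNIV) \<union> ?par ` ?F"
  proof
    fix v assume v: "v \<in> {v. jacobi \<mu> \<kappa> f v \<noteq> 0}"
    have "f v \<noteq> 0 \<or> at_parent f v \<noteq> 0 \<or> (\<exists>i. f (Child v i) \<noteq> 0)"
      by (rule ccontr) (use v in \<open>auto simp: jacobi_def\<close>)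
    then show "v \<in> ?F \<union> (\<lambda>(x, i). Child x i) ` (?F \<times> UNIV) \<union> ?par ` ?F"
    proof (elim disjE exE)
      assume "at_parent f v \<noteq> 0"
      then show ?thesis by (cases v) (auto simp: image_iff)
    next
      fix i assume "f (Child v i) \<noteq> 0"
      then have "?par (Child v i) \<in> ?par ` ?F" by blast
      then show ?thesis by simp
    qed simp
  qed
  show "finite (?F \<union> (\<lambda>(x, i). Child x i) ` (?F \<times> UNIV) \<union> ?par ` ?F)" using f by auto
qed

lemma jacobi_symmetric:
  assumes f: "finite {v. f v \<noteq> 0}" and g: "finite {v. g v \<noteq> 0}"
  shows "ip (jacobi \<mu> \<kappa> f) g = ip f (jacobi \<mu> \<kappa> g)"
proof -
  let ?w = "\<lambda>Y. complex_of_real (sqrt (weight \<mu> Y))"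
  define G where "G = {v. f v \<noteq> 0} \<union> {v. g v \<noteq> 0}"
  have G: "finite G" using f g by (simp add: G_def)
  have fg: "f v \<noteq> 0 \<Longrightarrow> v \<in> G" "g v \<noteq> 0 \<Longrightarrow> v \<in> G" for v by (auto simp: G_def)
  have 1: "(\<Sum>v\<in>G. ?w v * at_parent f v * cnj (g v))
      = (\<Sum>v\<in>G. ?w (Child v 1) * f v * cnj (g (Child v 1)) + ?w (Child v 2) * f v * cnj (g (Child v 2)))"
    using sum_over_children[OF G, of "\<lambda>v. ?w v * at_parent f v * cnj (g v)"] fg by simp
  have 2: "(\<Sum>v\<in>G. ?w v * f v * cnj (at_parent g v))
      = (\<Sum>v\<in>G. ?w (Child v 1) * f (Child v 1) * cnj (g v) + ?w (Child v 2) * f (Child v 2) * cnj (g v))"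
    using sum_over_children[OF G, of "\<lambda>v. ?w v * f v * cnj (at_parent g v)"] fg by simp
  have "ip (jacobi \<mu> \<kappa> f) g = (\<Sum>v\<in>G. jacobi \<mu> \<kappa> f v * cnj (g v))"
    by (rule ip_eq_right[OF jacobi_finite_support[OF f] G]) (auto simp: G_def)
  also have "\<dots> = (\<Sum>v\<in>G. of_real (potential \<mu> \<kappa> v) * f v * cnj (g v))
      + (\<Sum>v\<in>G. ?w v * at_parent f v * cnj (g v))
      + (\<Sum>v\<in>G. ?w (Child v 1) * f (Child v 1) * cnj (g v) + ?w (Child v 2) * f (Child v 2) * cnj (g v))"
    unfolding sum.distrib[symmetric] by (intro sum.cong refl) (simp add: jacobi_def algebra_simps)
  also have "\<dots> = (\<Sum>v\<in>G. of_real (potential \<mu> \<kappa> v) * f v * cnj (g v))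
      + (\<Sum>v\<in>G. ?w v * f v * cnj (at_parent g v))
      + (\<Sum>v\<in>G. ?w (Child v 1) * f v * cnj (g (Child v 1)) + ?w (Child v 2) * f v * cnj (g (Child v 2)))"
    unfolding 1 2 by simp
  also have "\<dots> = (\<Sum>v\<in>G. f v * cnj (jacobi \<mu> \<kappa> g v))"
    unfolding sum.distrib[symmetric] by (intro sum.cong refl) (simp add: jacobi_def algebra_simps)
  also have "\<dots> = ip f (jacobi \<mu> \<kappa> g)"
    by (rule ip_eq[symmetric, OF G]) (auto simp: G_def)
  finally show ?thesis .
qed

lemma jacobi_local_symmetric: "local_symmetric (jacobi \<mu> \<kappa>)"
proof
  fix Y
  show "\<exists>N. finite N \<and> (\<forall>f g. (\<forall>x\<in>N. f x = g x) \<longrightarrow> jacobi \<mu> \<kappa> f Y = jacobi \<mu> \<kappa> g Y)"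
    by (rule exI[of _ "{Y, Child Y 1, Child Y 2} \<union> (case Y of Root \<Rightarrow> {} | Child X i \<Rightarrow> {X})"])
      (auto simp: jacobi_def split: vertex.splits)
qed (fact jacobi_linear jacobi_finite_support jacobi_symmetric)+

text \<open>The first argument is the root of the subtree, the second the vertex lying in
  it.\<close>

primrec below :: "vertex \<Rightarrow> vertex \<Rightarrow> bool" where
  "below X Root \<longleftrightarrow> X = Root"
| "below X (Child Y i) \<longleftrightarrow> X = Child Y i \<or> below X Y"

lemma below_refl: "below X X"
  by (cases X) auto

lemma not_below_parent: "\<not> below (Child X i) X"
proof -
  have "size A \<le> size B" if "below A B" for A B
    using that by (induction B) auto
  then show ?thesis by fastforce
qed

text \<open>The product of the off-diagonal entries along the path from the root. It conjugates the
  nonsymmetric recurrence of the \<open>L n\<close> into the symmetric matrix.\<close>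

primrec amplitude :: "(2 \<Rightarrow> real measure) \<Rightarrow> vertex \<Rightarrow> real" where
  "amplitude \<mu> Root = 1"
| "amplitude \<mu> (Child Y i) = sqrt (weight \<mu> (Child Y i)) * amplitude \<mu> Y"

lemma proj_pos: "proj Y $ k > 0"
  using exhaust_2[of k] by (induction Y) (auto simp: axis_def)

lemma tot_proj: "tot (proj Y) \<ge> 2"
  using proj_pos[of Y 1] proj_pos[of Y 2] by (simp add: tot_def)

lemma below_tot: "below X Y \<Longrightarrow> tot (proj X) \<le> tot (proj Y)"
  by (induction Y) (auto simp: tot_add_axis)

lemma ratio_at_infinity:
  fixes f g :: "complex \<Rightarrow> complex"
  assumes f: "((\<lambda>z. z ^ a * f z) \<longlongrightarrow> 1) at_infinity" and g: "((\<lambda>z. z ^ b * g z) \<longlongrightarrow> 1) at_infinity"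
    and ab: "b < a"
  shows "((\<lambda>z. f z / g z) \<longlongrightarrow> 0) at_infinity"
proof -
  have "((\<lambda>z. (z ^ a * f z) / (z ^ b * g z) * inverse z ^ (a - b)) \<longlongrightarrow> 1 / 1 * 0 ^ (a - b)) at_infinity"
    by (intro tendsto_mult tendsto_divide tendsto_power f g tendsto_inverse_0) auto
  then have lim: "((\<lambda>z. (z ^ a * f z) / (z ^ b * g z) * inverse z ^ (a - b)) \<longlongrightarrow> 0) at_infinity"
    using ab by (simp add: power_0_left)
  have "\<forall>\<^sub>F z in at_infinity. (z ^ a * f z) / (z ^ b * g z) * inverse z ^ (a - b) = f z / g z"
    unfolding eventually_at_infinity
  proof (intro exI[of _ 1] allI impI)
    fix z :: complex assume "1 \<le> norm z"
    then have z: "z \<noteq> 0" by auto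
    have "z ^ a = z ^ b * z ^ (a - b)" using ab by (simp flip: power_add)
    then show "(z ^ a * f z) / (z ^ b * g z) * inverse z ^ (a - b) = f z / g z"
      using z by (simp add: power_inverse field_simps)
  qed
  from Lim_transform_eventually[OF lim this] show ?thesis .
qed

section \<open>The generalised eigenfunction on the tree and the resolvent kernels cut out of
  it\<close>

locale angelesco_tree = angelesco_system +
  fixes \<kappa> :: "real^2"
  assumes \<kappa>: "\<kappa> $ 1 + \<kappa> $ 2 = 1"
begin

definition K :: "real set" where
  "K = Delta \<mu> 1 \<union> Delta \<mu> 2 \<union> E_set \<mu> (vector [\<kappa> $ 2, \<kappa> $ 1])"

definition L\<kappa> :: "complex \<Rightarrow> complex" where
  "L\<kappa> = L_fun \<mu> (vector [\<kappa> $ 2, \<kappa> $ 1])"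

lemma L\<kappa>_eq: "L\<kappa> z = of_real (\<kappa> $ 2) * L (axis 1 1) z + of_real (\<kappa> $ 1) * L (axis 2 1) z"
  by (simp add: L\<kappa>_def L_fun_eq)

lemma L\<kappa>_holomorphic: "L\<kappa> holomorphic_on - D"
  unfolding L\<kappa>_eq[abs_def] by (intro holomorphic_intros L_holomorphic)

lemma L\<kappa>_asymptotics: "((\<lambda>z. z ^ 1 * L\<kappa> z) \<longlongrightarrow> 1) at_infinity"
proof -
  have "tot (axis k 1) = Suc 0" for k using tot_add_axis[of 0 k] by (simp add: tot_def)
  note as = L_asymptotics[OF this]
  have "((\<lambda>z. of_real (\<kappa> $ 2) * (z ^ Suc 0 * L (axis 1 1) z) + of_real (\<kappa> $ 1) * (z ^ Suc 0 * L (axis 2 1) z))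
      \<longlongrightarrow> of_real (\<kappa> $ 2) * 1 + of_real (\<kappa> $ 1) * 1) at_infinity"
    by (intro tendsto_add tendsto_mult tendsto_const as)
  moreover have "complex_of_real (\<kappa> $ 2) * 1 + of_real (\<kappa> $ 1) * 1 = 1"
    using \<kappa> by (simp add: add.commute flip: of_real_add)
  ultimately show ?thesis by (simp add: L\<kappa>_eq algebra_simps)
qed

lemma not_in_K:
  assumes "z \<notin> complex_of_real ` K"
  shows "z \<notin> D" "L\<kappa> z \<noteq> 0"
proof -
  show z: "z \<notin> D" using assms by (auto simp: K_def D_def)
  show "L\<kappa> z \<noteq> 0"
  proof (cases "Im z = 0")
    case False
    then show ?thesis unfolding L\<kappa>_def using \<kappa> by (intro L_fun_nonzero) auto
  next
    case True
    then obtain E where "z = of_real E" by (metis complex_is_Real_iff Reals_cases)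
    then show ?thesis using assms by (auto simp: K_def E_set_def L\<kappa>_def)
  qed
qed

text \<open>Zeros of \<open>L\<kappa>\<close> can accumulate only on the intervals, which belong to
  \<open>K\<close>, and not at infinity, because \<open>z * L\<kappa> z\<close> tends to 1.\<close>

lemma compact_K: "compact K"
proof -
  let ?U = "- (Delta \<mu> 1 \<union> Delta \<mu> 2)"
  have U: "open ?U" by (intro open_Compl closed_Un compact_imp_closed compact_Delta)
  have "continuous_on ?U (\<lambda>x. L\<kappa> (of_real x))"
    by (rule continuous_on_compose2[OF holomorphic_on_imp_continuous_on[OF L\<kappa>_holomorphic]])
      (auto simp: D_def intro!: continuous_intros)
  then have "open (?U \<inter> (\<lambda>x. L\<kappa> (of_real x)) -` (- {0}))"
    by (rule continuous_open_preimage[OF _ U]) auto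
  moreover have "- K = ?U \<inter> (\<lambda>x. L\<kappa> (of_real x)) -` (- {0})"
    by (auto simp: K_def E_set_def L\<kappa>_def)
  ultimately have cl: "closed K" by (simp add: closed_def)
  have "\<forall>\<^sub>F z in at_infinity. z ^ 1 * L\<kappa> z \<noteq> 0"
    by (rule tendsto_imp_eventually_ne[OF L\<kappa>_asymptotics]) simp
  then obtain B where B: "\<And>z. B \<le> norm z \<Longrightarrow> z ^ 1 * L\<kappa> z \<noteq> 0" unfolding eventually_at_infinity by blast
  have "\<bar>x\<bar> \<le> B" if "x \<in> E_set \<mu> (vector [\<kappa> $ 2, \<kappa> $ 1])" for x
    using B[of "of_real x"] that by (force simp: E_set_def L\<kappa>_def)
  then have "bounded (E_set \<mu> (vector [\<kappa> $ 2, \<kappa> $ 1]))" unfolding bounded_iff by auto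
  then have "bounded K" unfolding K_def using compact_Delta compact_imp_bounded by auto
  then show ?thesis using cl compact_eq_bounded_closed by blast
qed

abbreviation "w Y \<equiv> sqrt (weight \<mu> Y)"

lemma weight_pos: "weight \<mu> Y > 0"
  by (cases Y) (auto simp: rec_a_eq intro: ra_pos proj_pos)

lemma amplitude_pos: "amplitude \<mu> Y > 0"
  by (induction Y) (use weight_pos in \<open>auto simp del: weight.simps\<close>)

definition l :: "complex \<Rightarrow> vertex \<Rightarrow> complex" where
  "l z Y = of_real (amplitude \<mu> Y) * L (proj Y) z"

lemma l_nonzero: "z \<notin> D \<Longrightarrow> l z Y \<noteq> 0"
  using amplitude_pos[of Y] tot_proj[of Y] L_nonzero[of "proj Y" z] by (auto simp: l_def)

lemma l_child: "of_real (w (Child Y i)) * l z (Child Y i)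
   = of_real (amplitude \<mu> Y) * (of_real (ra (proj Y) i) * L (proj Y + axis i 1) z)"
proof -
  have "w (Child Y i) * w (Child Y i) = ra (proj Y) i"
    using weight_pos[of "Child Y i"] by (simp add: rec_a_eq)
  then have "complex_of_real (w (Child Y i)) * of_real (w (Child Y i)) = of_real (ra (proj Y) i)"
    by (simp flip: of_real_mult del: weight.simps)
  then show ?thesis by (simp add: l_def mult_ac del: weight.simps)
qed

lemma jacobi_l_child:
  assumes z: "z \<notin> D"
  shows "jacobi \<mu> \<kappa> (l z) (Child Y i) = z * l z (Child Y i)"
proof -
  let ?n = "proj Y + axis i 1"
  have n: "?n - axis i 1 = proj Y" by simp
  have pos: "\<And>k. ?n $ k > 0" using proj_pos[of "Child Y i"] by simp
  have "z * l z (Child Y i) = of_real (amplitude \<mu> (Child Y i)) * (z * L ?n z)"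
    by (simp add: l_def)
  also have "\<dots> = of_real (amplitude \<mu> (Child Y i)) * (L (proj Y) z + of_real (rb (proj Y) i) * L ?n z
     + of_real (ra ?n 1) * L (?n + axis 1 1) z + of_real (ra ?n 2) * L (?n + axis 2 1) z)"
    using L_recurrence[OF pos z, of i] unfolding n by simp
  also have "\<dots> = of_real (rb (proj Y) i) * l z (Child Y i) + of_real (w (Child Y i)) * l z Y
     + of_real (amplitude \<mu> (Child Y i)) * (of_real (ra (proj (Child Y i)) 1) * L (proj (Child Y i) + axis 1 1) z)
     + of_real (amplitude \<mu> (Child Y i)) * (of_real (ra (proj (Child Y i)) 2) * L (proj (Child Y i) + axis 2 1) z)"
    by (simp add: l_def algebra_simps del: weight.simps)
  also have "\<dots> = jacobi \<mu> \<kappa> (l z) (Child Y i)"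
    unfolding l_child[symmetric] jacobi_def by (simp add: rec_b_eq del: weight.simps)
  finally show ?thesis ..
qed

text \<open>At index \<open>(1, 1)\<close> both recurrences hold; they are averaged with weights
  \<open>\<kappa> $ 1\<close> and \<open>\<kappa> $ 2\<close>. Lowering the first index leads to
  \<open>axis 2 1\<close> and vice versa, which is the reason for the interchanged components in
  \<open>L\<kappa>\<close>.\<close>

lemma jacobi_l_root:
  assumes z: "z \<notin> D"
  shows "jacobi \<mu> \<kappa> (l z) Root = z * l z Root - L\<kappa> z"
proof -
  let ?n = "vector [1, 1] :: nat^2"
  have n: "?n - axis 1 1 = axis 2 1" "?n - axis 2 1 = axis 1 1"
    "vector [0, 1] = (axis 2 1 :: nat^2)" "vector [1, 0] = (axis 1 1 :: nat^2)"
    by (auto simp: vec_eq_iff forall_2 axis_def)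
  have pos: "\<And>k. ?n $ k > 0" using proj_pos[of Root] by simp
  define X where "X = of_real (ra ?n 1) * L (?n + axis 1 1) z + of_real (ra ?n 2) * L (?n + axis 2 1) z"
  have r1: "z * L ?n z = L (axis 2 1) z + of_real (rb (axis 2 1) 1) * L ?n z + X"
    and r2: "z * L ?n z = L (axis 1 1) z + of_real (rb (axis 1 1) 2) * L ?n z + X"
    using L_recurrence[OF pos z, of 1] L_recurrence[OF pos z, of 2] unfolding n X_def by (simp_all add: add.assoc)
  have k: "complex_of_real (\<kappa> $ 1) = 1 - of_real (\<kappa> $ 2)"
    using \<kappa> by (metis add_diff_cancel_right' of_real_1 of_real_diff)
  have "z * L ?n z = of_real (\<kappa> $ 1) * (z * L ?n z) + of_real (\<kappa> $ 2) * (z * L ?n z)"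
    by (simp add: k algebra_simps)
  also have "\<dots> = of_real (\<kappa> $ 1) * (L (axis 2 1) z + of_real (rb (axis 2 1) 1) * L ?n z + X)
     + of_real (\<kappa> $ 2) * (L (axis 1 1) z + of_real (rb (axis 1 1) 2) * L ?n z + X)"
    by (subst (1) r1, subst (1) r2) simp
  also have "\<dots> = L\<kappa> z + (of_real (\<kappa> $ 1) * of_real (rb (axis 2 1) 1) + of_real (\<kappa> $ 2) * of_real (rb (axis 1 1) 2)) * L ?n z + X"
    by (simp add: L\<kappa>_eq k algebra_simps)
  finally have 1: "z * L ?n z = L\<kappa> z + (of_real (\<kappa> $ 1) * of_real (rb (axis 2 1) 1) + of_real (\<kappa> $ 2) * of_real (rb (axis 1 1) 2)) * L ?n z + X" .
  have "jacobi \<mu> \<kappa> (l z) Root = (of_real (\<kappa> $ 1) * of_real (rb (axis 2 1) 1) + of_real (\<kappa> $ 2) * of_real (rb (axis 1 1) 2)) * L ?n z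
     + (of_real (w (Child Root 1)) * l z (Child Root 1) + of_real (w (Child Root 2)) * l z (Child Root 2))"
    unfolding jacobi_def by (simp add: rec_b_eq n l_def[of z Root] del: weight.simps(2))
  also have "of_real (w (Child Root 1)) * l z (Child Root 1) + of_real (w (Child Root 2)) * l z (Child Root 2) = X"
    unfolding l_child X_def by simp
  finally show ?thesis using 1 by (simp add: l_def[of z Root])
qed

definition r :: "vertex \<Rightarrow> complex \<Rightarrow> vertex \<Rightarrow> complex" where
  "r X z Y = (if below X Y then l z Y else 0)"

text \<open>Inside the subtree nothing changes and outside everything is zero, so the equation can
  fail only at the two ends of the edge that is cut.\<close>

lemma jacobi_r:
  assumes z: "z \<notin> D"
  shows "jacobi \<mu> \<kappa> (r (Child X i) z) Y - z * r (Child X i) z Y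
    = - of_real (w (Child X i)) * l z X * ket (Child X i) Y
      + of_real (w (Child X i)) * l z (Child X i) * ket X Y"
proof -
  let ?X = "Child X i"
  have ne: "?X \<noteq> X" by (metis below_refl not_below_parent)
  have ch: "below ?X (Child Y j) \<longleftrightarrow> (Y = X \<and> j = i) \<or> below ?X Y" for Y j by auto
  have jl: "jacobi \<mu> \<kappa> (l z) (Child Y j) - z * l z (Child Y j) = 0" for Y j
    using jacobi_l_child[OF z] by simp
  consider "Y = ?X" | "Y = X" | "Y \<noteq> ?X" "below ?X Y" | "Y \<noteq> X" "\<not> below ?X Y"
    using below_refl by blast
  then show ?thesis
  proof cases
    case 1
    have "jacobi \<mu> \<kappa> (r ?X z) ?X = jacobi \<mu> \<kappa> (l z) ?X - of_real (w ?X) * l z X"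
      unfolding jacobi_def r_def by (simp add: not_below_parent del: weight.simps)
    then show ?thesis using 1 jl[of X i] ne by (simp add: r_def ket_def del: weight.simps)
  next
    case 2
    have "at_parent (r ?X z) X = 0"
      using not_below_parent[of X i] by (cases X) (auto simp: r_def)
    then have "jacobi \<mu> \<kappa> (r ?X z) X = of_real (w ?X) * l z ?X"
      unfolding jacobi_def r_def[of ?X z X] r_def[of ?X z "Child X _"] ch
      using not_below_parent[of X i] exhaust_2[of i] by (auto simp del: weight.simps)
    then show ?thesis using 2 ne not_below_parent[of X i] by (simp add: r_def ket_def del: weight.simps)
  next
    case 3
    then obtain Y' j where Y': "Y = Child Y' j" "below ?X Y'" by (cases Y) auto
    have "jacobi \<mu> \<kappa> (r ?X z) Y = jacobi \<mu> \<kappa> (l z) Y"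
      unfolding jacobi_def r_def using 3 Y' by (simp del: weight.simps)
    moreover have "Y \<noteq> X" using 3 not_below_parent by blast
    ultimately show ?thesis using 3 jl[of Y' j] Y' by (auto simp: r_def ket_def simp del: weight.simps)
  next
    case 4
    have "at_parent (r ?X z) Y = 0" using 4 by (cases Y) (auto simp: r_def)
    then have "jacobi \<mu> \<kappa> (r ?X z) Y = 0"
      unfolding jacobi_def using 4 by (simp add: r_def)
    moreover have "Y \<noteq> ?X" using 4 below_refl by blast
    ultimately show ?thesis using 4 by (simp add: r_def ket_def)
  qed
qed

text \<open>\<open>l z\<close> solves the eigenvalue equation except at the root. Cutting it off outside the subtree
  below \<open>X\<close> produces a combination of two neighbouring delta functions, which expresses the
  resolvent at \<open>X\<close> by the one at the parent of \<open>X\<close>.\<close>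

primrec u :: "vertex \<Rightarrow> complex \<Rightarrow> vertex \<Rightarrow> complex" where
  "u Root z = (\<lambda>Y. - l z Y / L\<kappa> z)"
| "u (Child X i) z = (\<lambda>Y. l z (Child X i) / l z X * u X z Y - r (Child X i) z Y / (of_real (w (Child X i)) * l z X))"

lemma u_resolvent:
  assumes z: "z \<notin> complex_of_real ` K"
  shows "jacobi \<mu> \<kappa> (u X z) Y - z * u X z Y = ket X Y"
proof (induction X arbitrary: Y)
  case Root
  note zD = not_in_K[OF z]
  have "jacobi \<mu> \<kappa> (u Root z) = (\<lambda>v. (- 1 / L\<kappa> z) * jacobi \<mu> \<kappa> (l z) v)"
    using jacobi_linear[of \<mu> \<kappa> "- 1 / L\<kappa> z" "l z" 0 "l z"] by simp
  then have "jacobi \<mu> \<kappa> (u Root z) Y - z * u Root z Y = (- 1 / L\<kappa> z) * (jacobi \<mu> \<kappa> (l z) Y - z * l z Y)"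
    by (simp add: field_simps diff_divide_distrib)
  also have "\<dots> = ket Root Y"
    using jacobi_l_root[OF zD(1)] jacobi_l_child[OF zD(1)] zD(2) by (cases Y) (auto simp: ket_def)
  finally show ?case .
next
  case (Child X i)
  note zD = not_in_K[OF z]
  \<comment> \<open>\<open>?b\<close> normalises the delta at the child, and \<open>?a\<close> then
    cancels the delta at \<open>X\<close>.\<close>
  let ?a = "l z (Child X i) / l z X" and ?b = "- 1 / (of_real (w (Child X i)) * l z X)"
  have w: "complex_of_real (w (Child X i)) \<noteq> 0" using weight_pos[of "Child X i"] by simp
  have eq: "u (Child X i) z = (\<lambda>v. ?a * u X z v + ?b * r (Child X i) z v)" by (simp add: fun_eq_iff)
  have "jacobi \<mu> \<kappa> (u (Child X i) z) Y - z * u (Child X i) z Y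
     = ?a * (jacobi \<mu> \<kappa> (u X z) Y - z * u X z Y) + ?b * (jacobi \<mu> \<kappa> (r (Child X i) z) Y - z * r (Child X i) z Y)"
    unfolding eq jacobi_linear by (simp add: algebra_simps)
  also have "\<dots> = ?a * ket X Y + ?b * (- of_real (w (Child X i)) * l z X * ket (Child X i) Y
      + of_real (w (Child X i)) * l z (Child X i) * ket X Y)"
    unfolding Child.IH jacobi_r[OF zD(1)] ..
  also have "\<dots> = ket (Child X i) Y"
    using w l_nonzero[OF zD(1), of X] by (simp add: field_simps del: weight.simps)
  finally show ?case .
qed

lemma l_holomorphic: "(\<lambda>z. l z Y) holomorphic_on - D"
  unfolding l_def by (intro holomorphic_intros L_holomorphic)

lemma r_holomorphic: "(\<lambda>z. r X z Y) holomorphic_on - D"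
  unfolding r_def by (cases "below X Y") (simp_all add: l_holomorphic)

lemma K_subset: "- (complex_of_real ` K) \<subseteq> - D"
  using not_in_K(1) by blast

lemma u_holomorphic: "(\<lambda>z. u X z Y) holomorphic_on - (complex_of_real ` K)"
proof (induction X)
  case Root
  have "(\<lambda>z. - l z Y / L\<kappa> z) holomorphic_on - (complex_of_real ` K)"
    using not_in_K(2)
    by (intro holomorphic_on_divide holomorphic_on_minus holomorphic_on_subset[OF l_holomorphic K_subset]
        holomorphic_on_subset[OF L\<kappa>_holomorphic K_subset]) auto
  then show ?case by simp
next
  case (Child X i)
  have w: "complex_of_real (w (Child X i)) \<noteq> 0" using weight_pos[of "Child X i"] by simp
  have "(\<lambda>z. l z (Child X i) / l z X * u X z Y - r (Child X i) z Y / (of_real (w (Child X i)) * l z X))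
      holomorphic_on - (complex_of_real ` K)"
    using not_in_K(1) l_nonzero w
    by (intro holomorphic_on_diff holomorphic_on_mult holomorphic_on_divide Child holomorphic_on_const
        holomorphic_on_subset[OF l_holomorphic K_subset] holomorphic_on_subset[OF r_holomorphic K_subset])
      (auto simp del: weight.simps)
  then show ?case by simp
qed

lemma L_ratio: "tot n < tot m \<Longrightarrow> tot n \<noteq> 0 \<Longrightarrow> ((\<lambda>z. L m z / L n z) \<longlongrightarrow> 0) at_infinity"
  using L_asymptotics[of m "tot m - 1"] L_asymptotics[of n "tot n - 1"]
  by (intro ratio_at_infinity[of "tot m" "L m" "tot n" "L n"]) auto

lemma l_ratio:
  assumes "tot (proj X) < tot (proj Y)"
  shows "((\<lambda>z. l z Y / l z X) \<longlongrightarrow> 0) at_infinity"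
proof -
  have "((\<lambda>z. of_real (amplitude \<mu> Y) / of_real (amplitude \<mu> X) * (L (proj Y) z / L (proj X) z)) \<longlongrightarrow> 0) at_infinity"
    using L_ratio[OF assms] tot_proj[of X] by (intro tendsto_mult_right_zero) auto
  then show ?thesis by (simp add: l_def)
qed

text \<open>Each step down the tree raises the index by one and so gains one power of
  \<open>1 / z\<close>, by \<open>L_asymptotics\<close>.\<close>

lemma u_at_infinity: "((\<lambda>z. u X z Y) \<longlongrightarrow> 0) at_infinity"
proof (induction X)
  case Root
  have "((\<lambda>z. L (proj Y) z / L\<kappa> z) \<longlongrightarrow> 0) at_infinity"
    using L_asymptotics[of "proj Y" "tot (proj Y) - 1"] tot_proj[of Y] L\<kappa>_asymptotics
    by (intro ratio_at_infinity[of "tot (proj Y)" _ 1]) auto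
  then have "((\<lambda>z. - of_real (amplitude \<mu> Y) * (L (proj Y) z / L\<kappa> z)) \<longlongrightarrow> 0) at_infinity"
    by (rule tendsto_mult_right_zero)
  then show ?case by (simp add: l_def)
next
  case (Child X i)
  have 1: "((\<lambda>z. l z (Child X i) / l z X * u X z Y) \<longlongrightarrow> 0 * 0) at_infinity"
    by (intro tendsto_mult l_ratio Child) (simp add: tot_add_axis)
  have 2: "((\<lambda>z. r (Child X i) z Y / l z X) \<longlongrightarrow> 0) at_infinity"
  proof (cases "below (Child X i) Y")
    case True
    then have "tot (proj X) < tot (proj Y)" using below_tot[OF True] by (simp add: tot_add_axis)
    then show ?thesis using True l_ratio by (simp add: r_def)
  qed (simp add: r_def)
  have "((\<lambda>z. l z (Child X i) / l z X * u X z Y - 1 / of_real (w (Child X i)) * (r (Child X i) z Y / l z X)) \<longlongrightarrow> 0 * 0 - 1 / of_real (w (Child X i)) * 0) at_infinity"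
    by (intro tendsto_diff 1 tendsto_mult tendsto_const 2)
  then show ?case by simp
qed

sublocale J: resolvent_family "jacobi \<mu> \<kappa>" K u
proof -
  interpret J0: local_symmetric "jacobi \<mu> \<kappa>" by (rule jacobi_local_symmetric)
  show "resolvent_family (jacobi \<mu> \<kappa>) K u"
    by standard (use compact_K u_holomorphic u_at_infinity u_resolvent in auto)
qed

end

section \<open>Points of the spectrum\<close>

text \<open>Bounded, with imaginary part of the order of \<open>Im z\<close>. The class is stable
  under sums, products and inverses bounded away from zero, so it can be followed through a Mobius
  transformation.\<close>

definition nearly_real :: "complex set \<Rightarrow> (complex \<Rightarrow> complex) \<Rightarrow> bool" where
  "nearly_real V f \<longleftrightarrow> (\<exists>C. \<forall>z\<in>V. cmod (f z) \<le> C \<and> \<bar>Im (f z)\<bar> \<le> C * \<bar>Im z\<bar>)"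

lemma nearly_realE:
  assumes "nearly_real V f"
  obtains C where "C \<ge> 0" "\<forall>z\<in>V. cmod (f z) \<le> C" "\<forall>z\<in>V. \<bar>Im (f z)\<bar> \<le> C * \<bar>Im z\<bar>"
proof -
  obtain C where C: "\<And>z. z \<in> V \<Longrightarrow> cmod (f z) \<le> C \<and> \<bar>Im (f z)\<bar> \<le> C * \<bar>Im z\<bar>"
    using assms unfolding nearly_real_def by blast
  show thesis
  proof (rule that[of "\<bar>C\<bar>"]; (rule ballI)?)
    fix z assume z: "z \<in> V"
    show "cmod (f z) \<le> \<bar>C\<bar>" using C[OF z] by linarith
    have "C * \<bar>Im z\<bar> \<le> \<bar>C\<bar> * \<bar>Im z\<bar>" by (intro mult_right_mono) auto
    then show "\<bar>Im (f z)\<bar> \<le> \<bar>C\<bar> * \<bar>Im z\<bar>" using C[OF z] by linarith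
  qed simp
qed

lemma nearly_real_const: "nearly_real V (\<lambda>z. of_real c)"
  unfolding nearly_real_def by (intro exI[of _ "\<bar>c\<bar>"]) auto

lemma nearly_real_add:
  assumes "nearly_real V f" "nearly_real V g" shows "nearly_real V (\<lambda>z. f z + g z)"
proof -
  obtain C where "C \<ge> 0" "\<forall>z\<in>V. cmod (f z) \<le> C" "\<forall>z\<in>V. \<bar>Im (f z)\<bar> \<le> C * \<bar>Im z\<bar>"
    by (rule nearly_realE[OF assms(1)])
  note C = this(1) this(2,3)[rule_format]
  obtain B where "B \<ge> 0" "\<forall>z\<in>V. cmod (g z) \<le> B" "\<forall>z\<in>V. \<bar>Im (g z)\<bar> \<le> B * \<bar>Im z\<bar>"
    by (rule nearly_realE[OF assms(2)])
  note B = this(1) this(2,3)[rule_format]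
  show ?thesis unfolding nearly_real_def
  proof (intro exI[of _ "C + B"] ballI conjI)
    fix z assume z: "z \<in> V"
    show "cmod (f z + g z) \<le> C + B" using norm_triangle_ineq[of "f z" "g z"] C(2)[OF z] B(2)[OF z] by linarith
    show "\<bar>Im (f z + g z)\<bar> \<le> (C + B) * \<bar>Im z\<bar>" using C(3)[OF z] B(3)[OF z] by (simp add: distrib_right)
  qed
qed

lemma nearly_real_mult:
  assumes "nearly_real V f" "nearly_real V g" shows "nearly_real V (\<lambda>z. f z * g z)"
proof -
  obtain C where "C \<ge> 0" "\<forall>z\<in>V. cmod (f z) \<le> C" "\<forall>z\<in>V. \<bar>Im (f z)\<bar> \<le> C * \<bar>Im z\<bar>"
    by (rule nearly_realE[OF assms(1)])
  note C = this(1) this(2,3)[rule_format]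
  obtain B where "B \<ge> 0" "\<forall>z\<in>V. cmod (g z) \<le> B" "\<forall>z\<in>V. \<bar>Im (g z)\<bar> \<le> B * \<bar>Im z\<bar>"
    by (rule nearly_realE[OF assms(2)])
  note B = this(1) this(2,3)[rule_format]
  show ?thesis unfolding nearly_real_def
  proof (intro exI[of _ "2 * (C * B)"] ballI conjI)
    fix z assume z: "z \<in> V"
    have "cmod (f z) * cmod (g z) \<le> C * B" using C(1) C(2)[OF z] B(2)[OF z] by (intro mult_mono) auto
    then show "cmod (f z * g z) \<le> 2 * (C * B)" using C(1) B(1) by (simp add: norm_mult) (smt (verit) mult_nonneg_nonneg)
    have "\<bar>Re (f z)\<bar> * \<bar>Im (g z)\<bar> \<le> C * (B * \<bar>Im z\<bar>)"
      using C(1) C(2)[OF z] B(3)[OF z] abs_Re_le_cmod[of "f z"] by (intro mult_mono) auto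
    moreover have "\<bar>Im (f z)\<bar> * \<bar>Re (g z)\<bar> \<le> (C * \<bar>Im z\<bar>) * B"
      using C(1) C(3)[OF z] B(2)[OF z] abs_Re_le_cmod[of "g z"] by (intro mult_mono) auto
    moreover have "\<bar>Im (f z * g z)\<bar> \<le> \<bar>Re (f z)\<bar> * \<bar>Im (g z)\<bar> + \<bar>Im (f z)\<bar> * \<bar>Re (g z)\<bar>"
      using abs_triangle_ineq[of "Re (f z) * Im (g z)" "Im (f z) * Re (g z)"] by (simp add: abs_mult)
    ultimately show "\<bar>Im (f z * g z)\<bar> \<le> 2 * (C * B) * \<bar>Im z\<bar>" by (simp add: algebra_simps)
  qed
qed

lemma nearly_real_inverse:
  assumes "nearly_real V f" "\<beta> > 0" "\<And>z. z \<in> V \<Longrightarrow> \<beta> \<le> cmod (f z)"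
  shows "nearly_real V (\<lambda>z. inverse (f z))"
proof -
  obtain C where "C \<ge> 0" "\<forall>z\<in>V. cmod (f z) \<le> C" "\<forall>z\<in>V. \<bar>Im (f z)\<bar> \<le> C * \<bar>Im z\<bar>"
    by (rule nearly_realE[OF assms(1)])
  note C = this(1) this(3)[rule_format]
  show ?thesis unfolding nearly_real_def
  proof (intro exI[of _ "inverse \<beta> + C / \<beta>\<^sup>2"] ballI conjI)
    fix z assume z: "z \<in> V"
    have "inverse (cmod (f z)) \<le> inverse \<beta>" using assms(2) assms(3)[OF z] by (rule le_imp_inverse_le[rotated])
    then show "cmod (inverse (f z)) \<le> inverse \<beta> + C / \<beta>\<^sup>2" using C(1) assms(2)
      by (simp add: norm_inverse add_increasing2)
    have "\<bar>Im (inverse (f z))\<bar> = \<bar>Im (f z)\<bar> / (cmod (f z))\<^sup>2"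
      by (simp add: cmod_power2 abs_divide)
    also have "\<dots> \<le> (C * \<bar>Im z\<bar>) / \<beta>\<^sup>2"
      using C assms(2) assms(3)[OF z] z by (intro frac_le power_mono) auto
    also have "\<dots> \<le> (inverse \<beta> + C / \<beta>\<^sup>2) * \<bar>Im z\<bar>" using assms(2) by (simp add: distrib_right)
    finally show "\<bar>Im (inverse (f z))\<bar> \<le> (inverse \<beta> + C / \<beta>\<^sup>2) * \<bar>Im z\<bar>" .
  qed
qed

text \<open>Comparing \<open>z\<close> with \<open>cnj z\<close> gives twice the imaginary part on
  both sides. The Lipschitz bound has to hold across the real axis for this.\<close>

lemma nearly_real_lipschitz:
  assumes lip: "\<And>z w. z \<in> V \<Longrightarrow> w \<in> V \<Longrightarrow> cmod (f z - f w) \<le> C * cmod (z - w)"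
    and cnj: "\<And>z. z \<in> V \<Longrightarrow> cnj z \<in> V \<and> f (cnj z) = cnj (f z)" and bd: "\<And>z. z \<in> V \<Longrightarrow> cmod (f z) \<le> B"
  shows "nearly_real V f"
  unfolding nearly_real_def
proof (intro exI[of _ "\<bar>B\<bar> + \<bar>C\<bar>"] ballI conjI)
  fix z assume z: "z \<in> V"
  show "cmod (f z) \<le> \<bar>B\<bar> + \<bar>C\<bar>" using bd[OF z] by linarith
  have d: "cmod (a - cnj a) = 2 * \<bar>Im a\<bar>" for a
    unfolding complex_diff_cnj by (simp add: norm_mult)
  have "2 * \<bar>Im (f z)\<bar> \<le> C * (2 * \<bar>Im z\<bar>)" using lip[OF z, of "cnj z"] cnj[OF z] d by simp
  moreover have "C * \<bar>Im z\<bar> \<le> (\<bar>B\<bar> + \<bar>C\<bar>) * \<bar>Im z\<bar>" by (intro mult_right_mono) auto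
  ultimately show "\<bar>Im (f z)\<bar> \<le> (\<bar>B\<bar> + \<bar>C\<bar>) * \<bar>Im z\<bar>" by linarith
qed

section \<open>Boundary behaviour of Stieltjes transforms\<close>

context compact_measure
begin

lemma stieltjes_lipschitz:
  assumes d: "d > 0" "\<And>x. x \<in> measure_supp M \<Longrightarrow> d \<le> cmod (z - of_real x)" "\<And>x. x \<in> measure_supp M \<Longrightarrow> d \<le> cmod (v - of_real x)"
  shows "cmod (stieltjes M z - stieltjes M v) \<le> (measure M UNIV / d\<^sup>2) * cmod (z - v)"
proof -
  have off: "z \<notin> complex_of_real ` measure_supp M" "v \<notin> complex_of_real ` measure_supp M" using d by force+
  have "stieltjes M z - stieltjes M v = (\<integral>x. of_real (poly 1 x) / (z - of_real x) - of_real (poly 1 x) / (v - of_real x) \<partial>M)"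
    unfolding stieltjes_eq_ptransform ptransform_def
    by (rule Bochner_Integration.integral_diff[symmetric]) (intro kernel_integrable off)+
  also have "cmod \<dots> \<le> (cmod (z - v) / (d * d)) * measure M UNIV"
  proof (rule norm_integral_le)
    show "(\<lambda>x. of_real (poly 1 x) / (z - of_real x) - of_real (poly 1 x) / (v - of_real x)) \<in> borel_measurable borel"
      by (intro borel_measurable_diff kernel_measurable)
    fix x assume x: "x \<in> measure_supp M"
    have ne: "z - of_real x \<noteq> 0" "v - of_real x \<noteq> 0" using d(2,3)[OF x] d(1) by auto
    have "of_real (poly 1 x) / (z - of_real x) - of_real (poly 1 x) / (v - of_real x) = (v - z) / ((z - of_real x) * (v - of_real x))"
      using ne by (simp add: divide_simps)
    then show "cmod (of_real (poly 1 x) / (z - of_real x) - of_real (poly 1 x) / (v - of_real x)) \<le> cmod (z - v) / (d * d)"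
      using d(1) d(2,3)[OF x] by (simp add: norm_divide norm_mult norm_minus_commute[of v z]) (intro frac_le mult_mono; simp)
  qed
  finally show ?thesis by (simp add: power2_eq_square mult.commute)
qed

lemma stieltjes_real_nonzero:
  assumes "\<And>y. y \<in> measure_supp M \<Longrightarrow> t * (x - y) > (0::real)"
  shows "stieltjes M (of_real x) \<noteq> 0"
proof -
  have ne: "y \<noteq> x" if "y \<in> measure_supp M" for y using assms[OF that] by auto
  then have ne0: "x \<notin> measure_supp M" by blast
  have meas: "(\<lambda>y. t / (x - y)) \<in> borel_measurable borel"
  proof -
    have "(\<lambda>y. x - y) \<in> borel_measurable borel" by (intro borel_measurable_continuous_onI continuous_intros)
    then show ?thesis by measurable
  qed
  have int: "integrable M (\<lambda>y. t / (x - y))"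
    by (rule integrable_continuous[OF meas]) (use ne0 in \<open>auto intro!: continuous_intros\<close>)
  obtain y where y: "y \<in> measure_supp M" using infinite_supp by (metis finite.emptyI ex_in_conv)
  have pos: "t / (x - y) > 0" if "y \<in> measure_supp M" for y
    using assms[OF that] by (simp add: zero_less_mult_iff zero_less_divide_iff)
  have "(\<integral>y. t / (x - y) \<partial>M) > 0"
    by (rule integral_pos[OF meas int _ y _ pos[OF y]])
      (use pos ne[OF y] in \<open>auto intro!: continuous_intros less_imp_le\<close>)
  moreover have "of_real t * stieltjes M (of_real x) = of_real (\<integral>y. t / (x - y) \<partial>M)"
    unfolding stieltjes_def integral_mult_right_zero[symmetric] integral_complex_of_real[symmetric] by simp
  ultimately show ?thesis by auto
qed

lemma stieltjes_Im: "Im z \<noteq> 0 \<Longrightarrow> Im (stieltjes M z) = - Im z * (\<integral>x. 1 / (cmod (z - of_real x))\<^sup>2 \<partial>M)"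
proof -
  assume z: "Im z \<noteq> 0"
  then have off: "z \<notin> complex_of_real ` measure_supp M" by auto
  have "Im (stieltjes M z) = (\<integral>x. Im (complex_of_real (poly 1 x) / (z - complex_of_real x)) \<partial>M)"
    unfolding stieltjes_eq_ptransform ptransform_def by (rule integral_Im[symmetric, OF kernel_integrable[OF off]])
  also have "\<dots> = (\<integral>x. - Im z * (1 / (cmod (z - of_real x))\<^sup>2) \<partial>M)"
    by (rule Bochner_Integration.integral_cong) (auto simp: Im_divide cmod_power2)
  finally show ?thesis unfolding integral_mult_right_zero .
qed

text \<open>On this interval the Poisson-type kernel is at least
  \<open>1 / (2 * \<tau>\<^sup>2)\<close>, and its integral is
  \<open>|Im (stieltjes M z)| / \<tau>\<close>.\<close>

lemma measure_interval_le:
  assumes \<tau>: "\<tau> > 0"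
  shows "measure M {x - \<tau>..x + \<tau>} \<le> 2 * \<tau> * \<bar>Im (stieltjes M (Complex x \<tau>))\<bar>"
proof -
  let ?k = "\<lambda>y. 1 / (cmod (Complex x \<tau> - of_real y))\<^sup>2"
  have ne: "Complex x \<tau> - of_real y \<noteq> 0" for y using \<tau> by (auto simp: complex_eq_iff)
  have meas: "?k \<in> borel_measurable borel"
    by (intro borel_measurable_continuous_onI continuous_intros) (use ne in auto)
  have int: "integrable M ?k" by (rule integrable_continuous[OF meas]) (use ne in \<open>auto intro!: continuous_intros\<close>)
  have k: "?k y = 1 / ((x - y)\<^sup>2 + \<tau>\<^sup>2)" for y by (simp add: cmod_power2)
  have "measure M {x - \<tau>..x + \<tau>} / (2 * \<tau>\<^sup>2) = (\<integral>y. indicator {x - \<tau>..x + \<tau>} y / (2 * \<tau>\<^sup>2) \<partial>M)"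
    by (simp add: sets_M space_M)
  also have "\<dots> \<le> (\<integral>y. ?k y \<partial>M)"
  proof (rule integral_mono[OF _ int])
    show "integrable M (\<lambda>y. indicator {x - \<tau>..x + \<tau>} y / (2 * \<tau>\<^sup>2))"
      by (intro integrable_divide integrable_real_indicator) (auto simp: sets_M less_top[symmetric])
    fix y
    show "indicator {x - \<tau>..x + \<tau>} y / (2 * \<tau>\<^sup>2) \<le> ?k y"
    proof (cases "y \<in> {x - \<tau>..x + \<tau>}")
      case True
      then have "\<bar>x - y\<bar> \<le> \<tau>" by auto
      then have "(x - y)\<^sup>2 \<le> \<tau>\<^sup>2" by (metis abs_ge_zero power2_abs power_mono)
      then show ?thesis unfolding k using True \<tau> by (simp add: frac_le add_nonneg_pos)
    qed (simp add: k)
  qed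
  also have "\<dots> = \<bar>Im (stieltjes M (Complex x \<tau>))\<bar> / \<tau>"
  proof -
    have "(\<integral>y. ?k y \<partial>M) \<ge> 0" by (rule Bochner_Integration.integral_nonneg) simp
    then show ?thesis using \<tau> by (simp add: stieltjes_Im abs_mult)
  qed
  finally show ?thesis using \<tau> by (simp add: field_simps power2_eq_square)
qed

text \<open>Covering an interval by \<open>n\<close> pieces of half-length \<open>h / n\<close>
  bounds its mass by \<open>n\<close> terms of order \<open>1 / n\<^sup>2\<close>, so the mass is
  zero.\<close>

lemma not_in_supp_of_Im_bound:
  assumes e: "e > 0" and Im: "\<And>x \<tau>. \<bar>x - x0\<bar> < e \<Longrightarrow> 0 < \<tau> \<Longrightarrow> \<tau> < e \<Longrightarrow> \<bar>Im (stieltjes M (Complex x \<tau>))\<bar> \<le> C * \<tau>"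
  shows "x0 \<notin> measure_supp M"
proof -
  define h where "h = e / 2"
  have h: "h > 0" "h < e" using e by (auto simp: h_def)
  let ?J = "{x0 - h<..<x0 + h}"
  have le: "measure M ?J \<le> (2 * C * h\<^sup>2) / real n" if n: "n > 0" for n
  proof -
    define \<tau> where "\<tau> = h / n"
    have \<tau>: "\<tau> > 0" "\<tau> \<le> h" "n * \<tau> = h" using n h by (auto simp: \<tau>_def field_simps)
    \<comment> \<open>Midpoints of \<open>n\<close> adjacent intervals of length
      \<open>2 * \<tau>\<close> that fill the closure of \<open>?J\<close>.\<close>
    define x where "x = (\<lambda>i::nat. x0 - h + (2 * i + 1) * \<tau>)"
    have "?J \<subseteq> (\<Union>i<n. {x i - \<tau>..x i + \<tau>})"
    proof
      fix y assume y: "y \<in> ?J"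
      define i where "i = nat \<lfloor>(y - (x0 - h)) / (2 * \<tau>)\<rfloor>"
      have nn: "(y - (x0 - h)) / (2 * \<tau>) \<ge> 0" using y \<tau> by auto
      then have "real i = of_int \<lfloor>(y - (x0 - h)) / (2 * \<tau>)\<rfloor>" by (simp add: i_def)
      then have i: "real i \<le> (y - (x0 - h)) / (2 * \<tau>)" "(y - (x0 - h)) / (2 * \<tau>) < real i + 1" by linarith+
      then have i2: "2 * \<tau> * real i \<le> y - (x0 - h)" "y - (x0 - h) < 2 * \<tau> * (real i + 1)"
        using \<tau>(1) by (auto simp: field_simps)
      have "2 * \<tau> * real i < 2 * \<tau> * real n" using i2(1) y \<tau>(3) by (simp add: mult.commute mult.left_commute)
      then have "i < n" using \<tau>(1) by simp
      moreover have "y \<in> {x i - \<tau>..x i + \<tau>}" using i2 by (auto simp: x_def algebra_simps)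
      ultimately show "y \<in> (\<Union>i<n. {x i - \<tau>..x i + \<tau>})" by blast
    qed
    then have "measure M ?J \<le> measure M (\<Union>i<n. {x i - \<tau>..x i + \<tau>})"
      by (intro finite_measure_mono) (auto simp: sets_M)
    also have "\<dots> \<le> (\<Sum>i<n. measure M {x i - \<tau>..x i + \<tau>})"
      by (intro finite_measure_subadditive_finite) (auto simp: sets_M)
    also have "\<dots> \<le> (\<Sum>i<n. 2 * \<tau> * (C * \<tau>))"
    proof (rule sum_mono)
      fix i assume "i \<in> {..<n}"
      then have "real i + 1 \<le> real n" by auto
      then have "(2 * real i + 1) * \<tau> \<le> (2 * real n - 1) * \<tau>" using \<tau>(1) by (intro mult_right_mono) auto
      then have "(2 * real i + 1) * \<tau> < 2 * h" using \<tau> by (simp add: algebra_simps)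
      moreover have "(2 * real i + 1) * \<tau> > 0" using \<tau>(1) by (intro mult_pos_pos) auto
      ultimately have "\<bar>x i - x0\<bar> < e" using h by (auto simp: x_def abs_if)
      then have "\<bar>Im (stieltjes M (Complex (x i) \<tau>))\<bar> \<le> C * \<tau>" using \<tau> h by (intro Im) auto
      then have "2 * \<tau> * \<bar>Im (stieltjes M (Complex (x i) \<tau>))\<bar> \<le> 2 * \<tau> * (C * \<tau>)" using \<tau>(1) by (intro mult_left_mono) auto
      then show "measure M {x i - \<tau>..x i + \<tau>} \<le> 2 * \<tau> * (C * \<tau>)"
        using measure_interval_le[OF \<tau>(1), of "x i"] by linarith
    qed
    also have "\<dots> = (2 * C * h\<^sup>2) / real n" using n by (simp add: \<tau>_def power2_eq_square field_simps)
    finally show ?thesis .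
  qed
  have "(\<lambda>n. (2 * C * h\<^sup>2) / real n) \<longlonglongrightarrow> 0" by (rule lim_const_over_n)
  then have "measure M ?J \<le> 0"
  proof (rule LIMSEQ_le_const)
    show "\<exists>N. \<forall>n\<ge>N. measure M ?J \<le> (2 * C * h\<^sup>2) / real n"
      by (intro exI[of _ 1] allI impI le) simp
  qed
  then have "measure M ?J = 0" by (simp add: order_antisym)
  then have "emeasure M ?J = 0" by (simp add: emeasure_eq_measure)
  then have null: "\<not> emeasure M ?J > 0" by simp
  have J: "open ?J" "x0 \<in> ?J" using h by auto
  show ?thesis
  proof
    assume "x0 \<in> measure_supp M"
    then have "open ?J \<longrightarrow> x0 \<in> ?J \<longrightarrow> emeasure M ?J > 0"
      unfolding measure_supp_def mem_Collect_eq by (rule spec)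
    then show False using J null by blast
  qed
qed

text \<open>Along a vertical approach to \<open>x0\<close> the scaled kernel is bounded by 1 and
  tends to 0 except at \<open>x0\<close> itself, so dominated convergence applies.\<close>

lemma no_atom_limit:
  assumes "measure M {x0} = 0"
  shows "(\<lambda>n. of_real (inverse (Suc n)) * stieltjes M (Complex x0 (inverse (Suc n)))) \<longlonglongrightarrow> 0"
proof -
  let ?z = "\<lambda>n. Complex x0 (inverse (real (Suc n)))"
  let ?s = "\<lambda>n x. complex_of_real (inverse (real (Suc n))) * (complex_of_real (poly 1 x) / (?z n - complex_of_real x))"
  have "(\<lambda>n. \<integral>x. ?s n x \<partial>M) \<longlonglongrightarrow> (\<integral>x. 0 \<partial>M)"
  proof (rule integral_dominated_convergence[where w = "\<lambda>_. 1"])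
    show "?s n \<in> borel_measurable M" for n
      by (intro measurable_M borel_measurable_times kernel_measurable) auto
    have "{x0} \<in> null_sets M" using assms by (simp add: null_sets_def sets_M emeasure_eq_measure)
    then have "AE x in M. x \<noteq> x0" by (rule AE_I') auto
    then show "AE x in M. (\<lambda>n. ?s n x) \<longlonglongrightarrow> 0"
    proof eventually_elim
      case (elim x)
      have l: "(\<lambda>n. complex_of_real (inverse (real (Suc n)))) \<longlonglongrightarrow> of_real 0"
        by (intro tendsto_of_real LIMSEQ_inverse_real_of_nat)
      have z: "?z n = of_real x0 + \<i> * of_real (inverse (real (Suc n)))" for n
        by (simp add: complex_eq_iff del: of_real_inverse of_nat_Suc)
      have "(\<lambda>n. complex_of_real (inverse (real (Suc n))) * (complex_of_real (poly 1 x) / (of_real x0 + \<i> * of_real (inverse (real (Suc n))) - complex_of_real x)))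
        \<longlonglongrightarrow> of_real 0 * (complex_of_real (poly 1 x) / (of_real x0 + \<i> * of_real 0 - complex_of_real x))"
        by (intro tendsto_mult tendsto_divide tendsto_diff tendsto_add tendsto_const l) (use elim in auto)
      then show ?case unfolding z by simp
    qed
    show "AE x in M. norm (?s n x) \<le> 1" for n
    proof (rule AE_I2)
      fix x
      have le: "cmod (of_real t * (of_real (poly 1 x) / q)) \<le> 1" if "0 \<le> t" "t \<le> cmod q" for t q
        using that by (auto simp: norm_mult norm_divide divide_le_eq_1)
      show "norm (?s n x) \<le> 1"
        by (rule le) (use abs_Im_le_cmod[of "?z n - of_real x"] in auto)
    qed
  qed auto
  then show ?thesis unfolding stieltjes_eq_ptransform ptransform_def integral_mult_right_zero[symmetric] by simp
qed

text \<open>\<open>G\<close> is a Mobius transform of \<open>stieltjes M / H\<close>. It can be inverted at a point of the support that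
  is not an atom, and then \<open>Im (stieltjes M)\<close> vanishes on the axis.\<close>

lemma mobius_not_lipschitz:
  fixes G H :: "complex \<Rightarrow> complex" and a b c E e C :: real
  assumes unc: "uncountable (measure_supp M \<inter> {E - e<..<E + e})"
    and C: "C \<ge> 0"
    and G: "\<And>z v. z \<in> U \<Longrightarrow> v \<in> U \<Longrightarrow> cmod (G z - G v) \<le> C * cmod (z - v)"
    and Gc: "\<And>z. z \<in> U \<Longrightarrow> G (cnj z) = cnj (G z)"
    and U: "U = {z. Im z \<noteq> 0 \<and> cmod (z - of_real E) < e}"
    and H: "\<And>z v. cmod (z - of_real E) < e \<Longrightarrow> cmod (v - of_real E) < e \<Longrightarrow> cmod (H z - H v) \<le> C * cmod (z - v)"
    and Hc: "\<And>z. H (cnj z) = cnj (H z)"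
    and H0: "\<And>x. \<bar>x - E\<bar> < e \<Longrightarrow> H (of_real x) \<noteq> 0"
    and ab: "a + b = 1" "c \<noteq> 0"
    and eq: "\<And>z. z \<in> U \<Longrightarrow> stieltjes M z * (of_real c - of_real a * G z) = H z * (of_real b * G z + of_real c)"
  shows False
proof -
  \<comment> \<open>Atoms are countable in number, so an uncountable part of the support contains a
    point that is not an atom.\<close>
  have "countable {x. measure M {x} \<noteq> 0}" by (rule countable_support)
  then have "\<not> measure_supp M \<inter> {E - e<..<E + e} \<subseteq> {x. measure M {x} \<noteq> 0}"
    using unc countable_subset by blast
  then obtain x0 where "x0 \<in> measure_supp M \<inter> {E - e<..<E + e}" "measure M {x0} = 0"
    by blast
  then have x0: "x0 \<in> measure_supp M" "\<bar>x0 - E\<bar> < e" "measure M {x0} = 0"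
    by (auto simp: abs_less_iff)
  define d where "d = e - \<bar>x0 - E\<bar>"
  have d: "d > 0" using x0 by (simp add: d_def)
  have near: "cmod (z - of_real E) < e" if "cmod (z - of_real x0) < d" for z
  proof -
    have "cmod (z - of_real E) \<le> cmod (z - of_real x0) + cmod (of_real x0 - of_real E)"
      using norm_triangle_ineq[of "z - of_real x0" "of_real x0 - of_real E"] by simp
    also have "cmod (of_real x0 - of_real E) = \<bar>x0 - E\<bar>" by (metis norm_of_real of_real_diff)
    finally show ?thesis using that by (simp add: d_def)
  qed
  have inU: "z \<in> U" if "cmod (z - of_real x0) < d" "Im z \<noteq> 0" for z
    using near[OF that(1)] that(2) by (simp add: U)
  let ?z = "\<lambda>n. Complex x0 (inverse (real (Suc n)))"
  have zx: "cmod (?z n - of_real x0) = inverse (real (Suc n))" for n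
  proof -
    have "?z n - of_real x0 = \<i> * of_real (inverse (real (Suc n)))"
      by (simp add: complex_eq_iff del: of_real_inverse of_nat_Suc)
    then show ?thesis by (simp add: norm_mult del: of_real_inverse)
  qed
  have l0: "(\<lambda>n. inverse (real (Suc n))) \<longlonglongrightarrow> 0" by (rule LIMSEQ_inverse_real_of_nat)
  then obtain m where m: "\<And>n. n \<ge> m \<Longrightarrow> inverse (real (Suc n)) < d"
    using order_tendstoD(2)[OF l0 d] unfolding eventually_sequentially by blast
  have zU: "?z n \<in> U" if "n \<ge> m" for n using m[OF that] by (intro inU) (auto simp: zx simp del: of_nat_Suc)
  have zlim: "?z \<longlonglongrightarrow> of_real x0"
    by (rule LIM_zero_cancel, rule tendsto_norm_zero_cancel) (simp only: zx l0)
  \<comment> \<open>The Lipschitz bound yields a boundary value \<open>l\<close> of \<open>G\<close>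
    at \<open>x0\<close>, and it persists with \<open>l\<close> in place of
    \<open>G (of_real x0)\<close>.\<close>
  have "Cauchy (\<lambda>n. G (?z (n + m)))"
  proof (rule metric_CauchyI)
    fix \<epsilon> :: real assume \<epsilon>: "\<epsilon> > 0"
    have "Cauchy ?z" using zlim by (rule LIMSEQ_imp_Cauchy)
    then obtain N where N: "\<And>i j. i \<ge> N \<Longrightarrow> j \<ge> N \<Longrightarrow> dist (?z i) (?z j) < \<epsilon> / (C + 1)"
      using metric_CauchyD[of ?z "\<epsilon> / (C + 1)"] \<epsilon> C by auto
    show "\<exists>N. \<forall>i\<ge>N. \<forall>j\<ge>N. dist (G (?z (i + m))) (G (?z (j + m))) < \<epsilon>"
    proof (intro exI[of _ N] allI impI)
      fix i j assume ij: "i \<ge> N" "j \<ge> N"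
      have "dist (G (?z (i + m))) (G (?z (j + m))) \<le> C * dist (?z (i + m)) (?z (j + m))"
        unfolding dist_norm by (intro G zU) auto
      also have "\<dots> \<le> (C + 1) * dist (?z (i + m)) (?z (j + m))" by (intro mult_right_mono) auto
      also have "\<dots> < (C + 1) * (\<epsilon> / (C + 1))" using N[of "i + m" "j + m"] ij C by (intro mult_strict_left_mono) auto
      finally show "dist (G (?z (i + m))) (G (?z (j + m))) < \<epsilon>" using C by simp
    qed
  qed
  then obtain l where l: "(\<lambda>n. G (?z (n + m))) \<longlonglongrightarrow> l" using Cauchy_convergent convergent_def by blast
  have zm: "(\<lambda>n. ?z (n + m)) \<longlonglongrightarrow> of_real x0" by (rule LIMSEQ_ignore_initial_segment[OF zlim])
  have Gl: "cmod (G z - l) \<le> C * cmod (z - of_real x0)" if "z \<in> U" for z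
  proof (rule LIMSEQ_le)
    show "(\<lambda>n. cmod (G z - G (?z (n + m)))) \<longlonglongrightarrow> cmod (G z - l)" by (intro tendsto_intros l)
    show "(\<lambda>n. C * cmod (z - ?z (n + m))) \<longlonglongrightarrow> C * cmod (z - of_real x0)" by (intro tendsto_intros zm)
    show "\<exists>N. \<forall>n\<ge>N. cmod (G z - G (?z (n + m))) \<le> C * cmod (z - ?z (n + m))"
      by (intro exI[of _ 0] allI impI G that zU le_add2)
  qed
  have x0e: "cmod (of_real x0 - of_real E) < e" using near[of "of_real x0"] d by simp
  have Hl: "cmod (H z - H (of_real x0)) \<le> C * cmod (z - of_real x0)" if "cmod (z - of_real x0) < d" for z
    by (intro H near that x0e)
  \<comment> \<open>If \<open>c = a * l\<close>, the left side of \<open>eq\<close> is of order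
    \<open>Im z\<close> times the transform, which tends to 0 off atoms. As \<open>H\<close> does
    not vanish, \<open>b * l + c = 0\<close>; adding the two relations gives \<open>l = 0\<close>
    and then \<open>c = 0\<close>.\<close>
  have nz: "of_real c - of_real a * l \<noteq> 0"
  proof
    assume 0: "of_real c - of_real a * l = 0"
    have Hz: "(\<lambda>n. H (?z (n + m))) \<longlonglongrightarrow> H (of_real x0)"
    proof (rule LIM_zero_cancel, rule Lim_null_comparison)
      show "\<forall>\<^sub>F n in sequentially. norm (H (?z (n + m)) - H (of_real x0)) \<le> C * cmod (?z (n + m) - of_real x0)"
        by (intro always_eventually allI Hl) (simp only: zx m le_add2)
      have "(\<lambda>n. C * cmod (?z (n + m) - of_real x0)) \<longlonglongrightarrow> C * cmod (of_real x0 - of_real x0)"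
        by (intro tendsto_intros zm)
      then show "(\<lambda>n. C * cmod (?z (n + m) - of_real x0)) \<longlonglongrightarrow> 0" by simp
    qed
    have "(\<lambda>n. H (?z (n + m)) * (of_real b * G (?z (n + m)) + of_real c)) \<longlonglongrightarrow> H (of_real x0) * (of_real b * l + of_real c)"
      by (intro tendsto_intros Hz l)
    moreover have "(\<lambda>n. H (?z (n + m)) * (of_real b * G (?z (n + m)) + of_real c)) \<longlonglongrightarrow> 0"
    proof (rule Lim_null_comparison)
      show "\<forall>\<^sub>F n in sequentially. norm (H (?z (n + m)) * (of_real b * G (?z (n + m)) + of_real c))
         \<le> \<bar>a\<bar> * C * cmod (of_real (inverse (Suc (n + m))) * stieltjes M (?z (n + m)))"
      proof (intro always_eventually allI)
        fix n
        have n: "?z (n + m) \<in> U" by (intro zU) simp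
        have "of_real c - of_real a * G (?z (n + m)) = of_real a * (l - G (?z (n + m)))"
          using 0 by (simp add: algebra_simps)
        then have "H (?z (n + m)) * (of_real b * G (?z (n + m)) + of_real c) = stieltjes M (?z (n + m)) * (of_real a * (l - G (?z (n + m))))"
          using eq[OF n] by simp
        then have "norm (H (?z (n + m)) * (of_real b * G (?z (n + m)) + of_real c)) = cmod (stieltjes M (?z (n + m))) * (\<bar>a\<bar> * cmod (G (?z (n + m)) - l))"
          by (simp only: norm_mult norm_of_real norm_minus_commute)
        also have "\<dots> \<le> cmod (stieltjes M (?z (n + m))) * (\<bar>a\<bar> * (C * inverse (real (Suc (n + m)))))"
          using Gl[OF n] by (intro mult_left_mono) (simp_all only: zx abs_ge_zero norm_ge_zero)
        also have "\<dots> = \<bar>a\<bar> * C * cmod (of_real (inverse (Suc (n + m))) * stieltjes M (?z (n + m)))"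
          by (simp add: norm_mult del: of_real_inverse)
        finally show "norm (H (?z (n + m)) * (of_real b * G (?z (n + m)) + of_real c))
         \<le> \<bar>a\<bar> * C * cmod (of_real (inverse (Suc (n + m))) * stieltjes M (?z (n + m)))" .
      qed
      show "(\<lambda>n. \<bar>a\<bar> * C * cmod (of_real (inverse (Suc (n + m))) * stieltjes M (?z (n + m)))) \<longlonglongrightarrow> 0"
        by (intro tendsto_mult_right_zero tendsto_norm_zero LIMSEQ_ignore_initial_segment[OF no_atom_limit[OF x0(3)], of m])
    qed
    ultimately have "H (of_real x0) * (of_real b * l + of_real c) = 0" by (rule LIMSEQ_unique)
    then have "of_real b * l + of_real c = 0" using H0[OF x0(2)] by simp
    moreover have "of_real c = of_real a * l" using 0 by simp
    ultimately have "(of_real a + of_real b) * l = 0" by (simp add: algebra_simps)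
    then have "l = 0" using ab(1) by (metis mult_1 of_real_1 of_real_add)
    then show False using 0 ab(2) by simp
  qed
  define \<beta> where "\<beta> = cmod (of_real c - of_real a * l) / 2"
  have \<beta>: "\<beta> > 0" using nz by (simp add: \<beta>_def)
  \<comment> \<open>On this smaller disc \<open>a * G\<close> moves by at most
    \<open>\<beta>\<close>, half the modulus of the limiting denominator, so the denominator stays
    at least \<open>\<beta>\<close>.\<close>
  define d' where "d' = min d (\<beta> / (\<bar>a\<bar> * C + 1))"
  have aC: "\<bar>a\<bar> * C + 1 > 0" using C by (simp add: add_nonneg_pos)
  have d': "d' > 0" "d' \<le> d" "\<bar>a\<bar> * C * d' \<le> \<beta>"
  proof -
    show "d' > 0" "d' \<le> d" using d \<beta> aC by (auto simp: d'_def)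
    have "\<bar>a\<bar> * C * d' \<le> (\<bar>a\<bar> * C + 1) * d'" using \<open>d' > 0\<close> by (intro mult_right_mono) auto
    also have "\<dots> \<le> (\<bar>a\<bar> * C + 1) * (\<beta> / (\<bar>a\<bar> * C + 1))" using aC by (intro mult_left_mono) (auto simp: d'_def)
    finally show "\<bar>a\<bar> * C * d' \<le> \<beta>" using aC by simp
  qed
  define V where "V = {z. Im z \<noteq> 0 \<and> cmod (z - of_real x0) < d'}"
  have VU: "z \<in> U" "cmod (z - of_real x0) < d" if "z \<in> V" for z
    using that d' by (auto simp: V_def intro!: inU)
  have Vc: "cnj z \<in> V" if "z \<in> V" for z
  proof -
    have "cmod (cnj z - of_real x0) = cmod (z - of_real x0)" by (metis complex_cnj_complex_of_real complex_cnj_diff complex_mod_cnj)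
    then show ?thesis using that by (simp add: V_def)
  qed
  have bound: "cmod (f z) \<le> cmod p + C * d'" if "cmod (f z - p) \<le> C * cmod (z - of_real x0)" "z \<in> V" for f p z
  proof -
    have "cmod (f z) \<le> cmod p + cmod (f z - p)" using norm_triangle_ineq[of p "f z - p"] by simp
    moreover have "C * cmod (z - of_real x0) \<le> C * d'" using that(2) C by (intro mult_left_mono) (auto simp: V_def)
    ultimately show ?thesis using that(1) by linarith
  qed
  have nG: "nearly_real V G"
    by (rule nearly_real_lipschitz[where C = C and B = "cmod l + C * d'"])
      (use G Gc VU Vc bound[of G, OF Gl] in auto)
  have nH: "nearly_real V H"
    by (rule nearly_real_lipschitz[where C = C and B = "cmod (H (of_real x0)) + C * d'"])
      (use H Hc VU near Vc bound[of H, OF Hl] in auto)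
  have nB: "nearly_real V (\<lambda>z. of_real c + of_real (- a) * G z)"
    by (intro nearly_real_add nearly_real_mult nearly_real_const nG)
  have lower: "\<beta> \<le> cmod (of_real c + of_real (- a) * G z)" if z: "z \<in> V" for z
  proof -
    have "cmod (of_real c - of_real a * l) \<le> cmod (of_real c + of_real (- a) * G z) + cmod (of_real a * (G z - l))"
      using norm_triangle_ineq[of "of_real c + of_real (- a) * G z" "of_real a * (G z - l)"] by (simp add: algebra_simps)
    moreover have "cmod (of_real a * (G z - l)) \<le> \<beta>"
    proof -
      have "cmod (of_real a * (G z - l)) \<le> \<bar>a\<bar> * (C * cmod (z - of_real x0))"
        using Gl[OF VU(1)[OF z]] by (simp add: norm_mult mult_left_mono)
      also have "\<dots> \<le> \<bar>a\<bar> * (C * d')" using z C by (intro mult_left_mono) (auto simp: V_def)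
      finally show ?thesis using d'(3) by simp
    qed
    ultimately show ?thesis unfolding \<beta>_def by linarith
  qed
  have "nearly_real V (\<lambda>z. H z * (of_real b * G z + of_real c) * inverse (of_real c + of_real (- a) * G z))"
    by (rule nearly_real_mult[OF nearly_real_mult[OF nH nearly_real_add[OF
          nearly_real_mult[OF nearly_real_const nG] nearly_real_const]] nearly_real_inverse[OF nB \<beta> lower]])
  then obtain B where "B \<ge> 0" "\<forall>z\<in>V. cmod (H z * (of_real b * G z + of_real c) * inverse (of_real c + of_real (- a) * G z)) \<le> B"
    "\<forall>z\<in>V. \<bar>Im (H z * (of_real b * G z + of_real c) * inverse (of_real c + of_real (- a) * G z))\<bar> \<le> B * \<bar>Im z\<bar>"
    by (rule nearly_realE)
  note B = this(3)[rule_format]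
  have S: "stieltjes M z = H z * (of_real b * G z + of_real c) * inverse (of_real c + of_real (- a) * G z)" if z: "z \<in> V" for z
  proof -
    have "of_real c + of_real (- a) * G z \<noteq> 0" using lower[OF z] \<beta> by auto
    then show ?thesis using eq[OF VU(1)[OF z]] by (simp add: field_simps)
  qed
  have "x0 \<notin> measure_supp M"
  proof (rule not_in_supp_of_Im_bound)
    show "d' / 2 > 0" using d' by simp
    fix x \<tau> assume x: "\<bar>x - x0\<bar> < d' / 2" "0 < \<tau>" "\<tau> < d' / 2"
    have "cmod (Complex x \<tau> - of_real x0) \<le> \<bar>x - x0\<bar> + \<bar>\<tau>\<bar>"
      using cmod_le[of "Complex x \<tau> - of_real x0"] by simp
    then have "Complex x \<tau> \<in> V" using x by (auto simp: V_def)
    from B[OF this] show "\<bar>Im (stieltjes M (Complex x \<tau>))\<bar> \<le> B * \<tau>"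
      unfolding S[OF \<open>Complex x \<tau> \<in> V\<close>, symmetric] using x(2) by simp
  qed
  then show False using x0 by simp
qed

end

lemma nonreal_not_in_image: "Im z \<noteq> 0 \<Longrightarrow> z \<notin> complex_of_real ` A"
  by auto

section \<open>The two kinds of points of the spectrum\<close>

context angelesco_tree
begin

text \<open>The bounded inverse at \<open>E\<close> is applied to \<open>(J - E)\<close> of the root
  column, which is the root ket plus \<open>z - E\<close> times the column. Near \<open>E\<close>
  the second term is absorbed into the left side.\<close>

lemma resolvent_bound:
  assumes "complex_of_real E \<notin> ell2_spectrum (jacobi \<mu> \<kappa>)"
  shows "\<exists>C e. C > 0 \<and> e > 0 \<and>
    (\<forall>z. Im z \<noteq> 0 \<longrightarrow> cmod (z - of_real E) < e \<longrightarrow> cmod (u Root z Root) \<le> C) \<and>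
    (\<forall>z v. Im z \<noteq> 0 \<longrightarrow> Im v \<noteq> 0 \<longrightarrow> cmod (z - of_real E) < e \<longrightarrow> cmod (v - of_real E) < e \<longrightarrow>
       cmod (u Root z Root - u Root v Root) \<le> C * cmod (z - v))"
proof -
  obtain C0 where C0: "\<And>f. f \<in> ell2 \<Longrightarrow> ell2_norm f \<le> C0 * ell2_norm (\<lambda>Y. jacobi \<mu> \<kappa> f Y - of_real E * f Y)"
    using assms unfolding ell2_spectrum_def by blast
  define C where "C = max C0 1"
  have C: "C \<ge> 1" "\<And>f. f \<in> ell2 \<Longrightarrow> ell2_norm f \<le> C * ell2_norm (\<lambda>Y. jacobi \<mu> \<kappa> f Y - of_real E * f Y)"
  proof -
    fix f :: "vertex \<Rightarrow> complex" assume "f \<in> ell2"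
    then have "ell2_norm f \<le> C0 * ell2_norm (\<lambda>Y. jacobi \<mu> \<kappa> f Y - of_real E * f Y)" by (rule C0)
    also have "\<dots> \<le> C * ell2_norm (\<lambda>Y. jacobi \<mu> \<kappa> f Y - of_real E * f Y)"
      by (intro mult_right_mono) (auto simp: C_def)
    finally show "ell2_norm f \<le> C * ell2_norm (\<lambda>Y. jacobi \<mu> \<kappa> f Y - of_real E * f Y)" .
  qed (simp add: C_def)
  have ket1: "ell2_norm (ket Root :: vertex \<Rightarrow> complex) \<le> 1"
    by (rule ell2I(2)) (auto simp: L2_set_def ket_def if_distrib[of cmod] if_distrib[of "\<lambda>x. x\<^sup>2"] cong: if_cong)
  let ?u = "u Root"
  have ul: "?u z \<in> ell2" if "Im z \<noteq> 0" for z by (rule J.u_ell2[OF that])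
  have Ju: "jacobi \<mu> \<kappa> (?u z) Y = ket Root Y + z * ?u z Y" if "Im z \<noteq> 0" for z Y
  proof -
    have "z \<notin> complex_of_real ` K" using that by auto
    from u_resolvent[OF this, of Root Y] show ?thesis by (simp only: diff_eq_eq)
  qed
  \<comment> \<open>The radius \<open>1 / (2 * C)\<close> is the threshold at which the perturbation
    absorbs at most half of the norm.\<close>
  have half: "C * (cmod (z - of_real E) * N) \<le> N / 2" if "cmod (z - of_real E) < 1 / (2 * C)" "N \<ge> 0" for z N
  proof -
    have "C * cmod (z - of_real E) \<le> 1 / 2" using that(1) C(1) by (simp add: field_simps)
    from mult_right_mono[OF this that(2)] show ?thesis by (simp add: mult.assoc)
  qed
  have bd: "ell2_norm (?u z) \<le> 2 * C" if z: "Im z \<noteq> 0" "cmod (z - of_real E) < 1 / (2 * C)" for z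
  proof -
    have "(\<lambda>Y. jacobi \<mu> \<kappa> (?u z) Y - of_real E * ?u z Y) = (\<lambda>Y. ket Root Y + (z - of_real E) * ?u z Y)"
      by (simp only: Ju[OF z(1)]) (simp only: algebra_simps)
    then have "ell2_norm (?u z) \<le> C * ell2_norm (\<lambda>Y. ket Root Y + (z - of_real E) * ?u z Y)"
      using C(2)[OF ul[OF z(1)]] by simp
    also have "\<dots> \<le> C * (1 + cmod (z - of_real E) * ell2_norm (?u z))"
    proof (rule mult_left_mono)
      have "ell2_norm (\<lambda>Y. ket Root Y + (z - of_real E) * ?u z Y) \<le> ell2_norm (ket Root) + ell2_norm (\<lambda>Y. (z - of_real E) * ?u z Y)"
        by (rule ell2_add(2)[OF ket_ell2 ell2_scale[OF ul[OF z(1)]]])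
      then show "ell2_norm (\<lambda>Y. ket Root Y + (z - of_real E) * ?u z Y) \<le> 1 + cmod (z - of_real E) * ell2_norm (?u z)"
        using ket1 unfolding ell2_norm_scale by linarith
    qed (use C in simp)
    also have "\<dots> \<le> C + ell2_norm (?u z) / 2"
      using half[OF z(2), of "ell2_norm (?u z)"] by (simp add: distrib_left)
    finally show ?thesis by simp
  qed
  have lip: "ell2_norm (\<lambda>Y. ?u z Y - ?u v Y) \<le> 4 * C\<^sup>2 * cmod (z - v)"
    if z: "Im z \<noteq> 0" "cmod (z - of_real E) < 1 / (2 * C)" and v: "Im v \<noteq> 0" "cmod (v - of_real E) < 1 / (2 * C)" for z v
  proof -
    define f where "f = (\<lambda>Y. ?u z Y - ?u v Y)"
    have fl: "f \<in> ell2" unfolding f_def by (intro ell2_diff ul z v)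
    have "jacobi \<mu> \<kappa> f = (\<lambda>Y. jacobi \<mu> \<kappa> (?u z) Y - jacobi \<mu> \<kappa> (?u v) Y)"
      unfolding f_def by (rule J.T_diff)
    then have "(\<lambda>Y. jacobi \<mu> \<kappa> f Y - of_real E * f Y) = (\<lambda>Y. (z - of_real E) * f Y + (z - v) * ?u v Y)"
      by (simp only: Ju[OF z(1)] Ju[OF v(1)]) (simp add: f_def algebra_simps del: u.simps)
    then have "ell2_norm f \<le> C * ell2_norm (\<lambda>Y. (z - of_real E) * f Y + (z - v) * ?u v Y)"
      using C(2)[OF fl] by simp
    also have "\<dots> \<le> C * (cmod (z - of_real E) * ell2_norm f + cmod (z - v) * (2 * C))"
    proof (rule mult_left_mono)
      have "ell2_norm (\<lambda>Y. (z - of_real E) * f Y + (z - v) * ?u v Y)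
        \<le> ell2_norm (\<lambda>Y. (z - of_real E) * f Y) + ell2_norm (\<lambda>Y. (z - v) * ?u v Y)"
        by (rule ell2_add(2)[OF ell2_scale[OF fl] ell2_scale[OF ul[OF v(1)]]])
      moreover have "cmod (z - v) * ell2_norm (?u v) \<le> cmod (z - v) * (2 * C)"
        by (intro mult_left_mono bd v) auto
      ultimately show "ell2_norm (\<lambda>Y. (z - of_real E) * f Y + (z - v) * ?u v Y)
        \<le> cmod (z - of_real E) * ell2_norm f + cmod (z - v) * (2 * C)"
        unfolding ell2_norm_scale by linarith
    qed (use C in simp)
    also have "\<dots> \<le> ell2_norm f / 2 + 2 * C\<^sup>2 * cmod (z - v)"
      using half[OF z(2), of "ell2_norm f"] by (simp add: distrib_left power2_eq_square mult_ac)
    finally show ?thesis by (simp add: f_def)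
  qed
  show ?thesis
  proof (intro exI conjI allI impI)
    show "4 * C\<^sup>2 > 0" "1 / (2 * C) > 0" using C(1) by auto
    fix z assume z: "Im z \<noteq> 0" "cmod (z - of_real E) < 1 / (2 * C)"
    have "cmod (?u z Root) \<le> 2 * C" using cmod_le_ell2_norm[OF ul[OF z(1)], of Root] bd[OF z] by linarith
    also have "2 * C \<le> 4 * C\<^sup>2" using C(1) mult_left_mono[of 1 C C] by (simp add: power2_eq_square)
    finally show "cmod (?u z Root) \<le> 4 * C\<^sup>2" .
    fix v assume v: "Im v \<noteq> 0" "cmod (v - of_real E) < 1 / (2 * C)"
    have "cmod (?u z Root - ?u v Root) \<le> ell2_norm (\<lambda>Y. ?u z Y - ?u v Y)"
      using cmod_le_ell2_norm[OF ell2_diff(1)[OF ul[OF z(1)] ul[OF v(1)]], of Root] by simp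
    then show "cmod (?u z Root - ?u v Root) \<le> 4 * C\<^sup>2 * cmod (z - v)" using lip[OF z v] by linarith
  qed
qed

lemma u_root: "u Root z Root = - L (vector [1, 1]) z / L\<kappa> z"
  by (simp add: l_def)

text \<open>A bounded quotient would give \<open>|L (1, 1)| \<le> C * |L\<kappa>|\<close> up to
  \<open>E\<close>. There the right side is zero, while \<open>L (1, 1)\<close> has no zeros off the
  intervals.\<close>

lemma E_set_in_spectrum:
  assumes E: "E \<in> E_set \<mu> (vector [\<kappa> $ 2, \<kappa> $ 1])"
  shows "complex_of_real E \<in> ell2_spectrum (jacobi \<mu> \<kappa>)"
proof (rule ccontr)
  assume "\<not> ?thesis"
  then obtain C e where C: "C > 0" "e > 0"
    "\<And>z. Im z \<noteq> 0 \<Longrightarrow> cmod (z - of_real E) < e \<Longrightarrow> cmod (u Root z Root) \<le> C"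
    using resolvent_bound by blast
  have ED: "of_real E \<notin> D" and E0: "L\<kappa> (of_real E) = 0"
    using E by (auto simp: E_set_def D_def L\<kappa>_def)
  have oD: "open (- D)" using closed_D by (simp add: open_Compl)
  have cont: "isCont (L n) (of_real E)" for n
    using L_holomorphic[of n] oD ED by (meson ComplI continuous_on_eq_continuous_at holomorphic_on_imp_continuous_on)
  have contk: "isCont L\<kappa> (of_real E)"
    using L\<kappa>_holomorphic oD ED by (meson ComplI continuous_on_eq_continuous_at holomorphic_on_imp_continuous_on)
  let ?z = "\<lambda>n. complex_of_real E + \<i> * of_real (inverse (real (Suc n)))"
  have "(\<lambda>n. complex_of_real (inverse (real (Suc n)))) \<longlonglongrightarrow> of_real 0"
    by (intro tendsto_of_real LIMSEQ_inverse_real_of_nat)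
  then have "?z \<longlonglongrightarrow> of_real E + \<i> * of_real 0" by (rule tendsto_add[OF tendsto_const tendsto_mult[OF tendsto_const]])
  then have z: "?z \<longlonglongrightarrow> of_real E" by simp
  have "cmod (L (vector [1, 1]) (of_real E)) \<le> C * cmod (L\<kappa> (of_real E))"
  proof (rule LIMSEQ_le)
    show "(\<lambda>n. cmod (L (vector [1, 1]) (?z n))) \<longlonglongrightarrow> cmod (L (vector [1, 1]) (of_real E))"
      by (intro tendsto_norm isCont_tendsto_compose[OF cont z])
    show "(\<lambda>n. C * cmod (L\<kappa> (?z n))) \<longlonglongrightarrow> C * cmod (L\<kappa> (of_real E))"
      by (intro tendsto_mult tendsto_const tendsto_norm isCont_tendsto_compose[OF contk z])
    obtain N where N: "\<And>n. n \<ge> N \<Longrightarrow> dist (?z n) (of_real E) < e"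
      using tendstoD[OF z C(2)] unfolding eventually_sequentially by blast
    have quot: "cmod p \<le> C * cmod q" if "q \<noteq> 0" "cmod (- p / q) \<le> C" for p q
      using that by (simp add: norm_divide pos_divide_le_eq)
    show "\<exists>N. \<forall>n\<ge>N. cmod (L (vector [1, 1]) (?z n)) \<le> C * cmod (L\<kappa> (?z n))"
    proof (intro exI[of _ N] allI impI)
      fix n assume "n \<ge> N"
      have im: "Im (?z n) \<noteq> 0" by simp
      then have "L\<kappa> (?z n) \<noteq> 0" by (rule not_in_K(2)[OF nonreal_not_in_image])
      moreover have "cmod (u Root (?z n) Root) \<le> C"
        using N[OF \<open>n \<ge> N\<close>] by (intro C(3) im) (simp only: dist_norm)
      ultimately show "cmod (L (vector [1, 1]) (?z n)) \<le> C * cmod (L\<kappa> (?z n))"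
        unfolding u_root by (rule quot)
    qed
  qed
  then have "L (vector [1, 1]) (of_real E) = 0" using E0 by simp
  moreover have "tot (vector [1, 1]) \<noteq> 0" by (simp add: tot_def)
  ultimately show False using L_nonzero[OF _ ED] by blast
qed

lemma L_cnj: "L n (cnj z) = cnj (L n z)"
  by (simp add: L_def ctransform_def M.ptransform_cnj)

text \<open>The form at \<open>(1, 1)\<close> has constant components with total pairing zero, hence
  one free parameter. With \<open>L\<kappa>\<close> also a combination of the same two functions,
  the root entry depends on their ratio alone.\<close>

lemma L_11: "\<exists>c. c \<noteq> 0 \<and> (\<forall>z. z \<notin> D \<longrightarrow> L (vector [1, 1]) z = of_real c * (L (axis 1 1) z - L (axis 2 1) z))"
proof -
  let ?n = "vector [1, 1] :: nat^2"
  have n: "tot ?n = Suc (Suc 0)" by (simp add: tot_def)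
  define a where "a = (\<lambda>k. coeff (TI ?n k) 0)"
  have TIc: "TI ?n k = smult (a k) 1" for k
    by (rule poly_eqI) (use TI_high[of ?n k] n exhaust_2[of k] in \<open>auto simp: a_def coeff_pCons split: nat.split\<close>)
  have "pairing (TI ?n) 1 = 0" using TI_pairing[OF n, of 1] by simp
  then have 0: "a 1 * measure (\<mu> 1) UNIV + a 2 * measure (\<mu> 2) UNIV = 0"
    unfolding pairing_def TIc sum_2 mult_1_right M.pint_smult M.pint_1 .
  define c where "c = a 1 * measure (\<mu> 1) UNIV"
  have a2: "a 2 * measure (\<mu> 2) UNIV = - c" using 0 by (simp add: c_def)
  have Lc: "L ?n z = of_real c * (L (axis 1 1) z - L (axis 2 1) z)" for z
  proof -
    have ne: "measure (\<mu> k) UNIV \<noteq> 0" for k using M.total_mass_pos[of k] by simp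
    have st: "stieltjes (\<mu> k) z = of_real (measure (\<mu> k) UNIV) * L (axis k 1) z" for k
      using ne[of k] by (simp add: L_axis)
    have "L ?n z = of_real (a 1) * stieltjes (\<mu> 1) z + of_real (a 2) * stieltjes (\<mu> 2) z"
      unfolding L_def ctransform_def TIc sum_2 M.ptransform_smult stieltjes_eq_ptransform ..
    also have "\<dots> = of_real (a 1 * measure (\<mu> 1) UNIV) * L (axis 1 1) z + of_real (a 2 * measure (\<mu> 2) UNIV) * L (axis 2 1) z"
      unfolding st by simp
    also have "\<dots> = of_real c * (L (axis 1 1) z - L (axis 2 1) z)"
      unfolding a2 c_def[symmetric] by (simp add: algebra_simps)
    finally show ?thesis .
  qed
  have "c \<noteq> 0"
  proof
    assume "c = 0"
    then have "L ?n \<i> = 0" using Lc[of \<i>] by simp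
    moreover have "\<i> \<notin> D" by (auto simp: D_def complex_eq_iff)
    ultimately show False using L_nonzero[of ?n \<i>] n by simp
  qed
  then show ?thesis using Lc by blast
qed

text \<open>The transform of the other measure is real-analytic and nonzero near \<open>E\<close>,
  so it can serve as \<open>H\<close>, while the root entry of the kernel serves as
  \<open>G\<close>; then \<open>mobius_not_lipschitz\<close> applies.\<close>

lemma Delta_in_spectrum:
  assumes supp: "measure_supp (\<mu> k) = Delta \<mu> k" and E: "E \<in> Delta \<mu> k"
  shows "complex_of_real E \<in> ell2_spectrum (jacobi \<mu> \<kappa>)"
proof (rule ccontr)
  assume "\<not> ?thesis"
  then obtain C e0 where C: "C > 0" "e0 > 0"
    and lip: "\<And>z v. Im z \<noteq> 0 \<Longrightarrow> Im v \<noteq> 0 \<Longrightarrow> cmod (z - of_real E) < e0 \<Longrightarrow> cmod (v - of_real E) < e0 \<Longrightarrow>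
       cmod (u Root z Root - u Root v Root) \<le> C * cmod (z - v)"
    using resolvent_bound by blast
  obtain j where j: "j \<noteq> k" using ex_other by blast
  define mk mj where "mk = measure (\<mu> k) UNIV" and "mj = measure (\<mu> j) UNIV"
  have m: "mk > 0" "mj > 0" using M.total_mass_pos by (auto simp: mk_def mj_def)
  have "E \<notin> Delta \<mu> j" using Delta_disjoint[OF j] E by blast
  then obtain d where d: "d > 0" "\<And>y. y \<in> Delta \<mu> j \<Longrightarrow> d \<le> dist E y"
    using separate_point_closed[OF compact_imp_closed[OF compact_Delta]] by blast
  define e where "e = min e0 (d / 2)"
  have e: "e > 0" "e \<le> e0" "e \<le> d / 2" using C d by (auto simp: e_def)
  have far: "d / 2 \<le> cmod (z - of_real y)" if "cmod (z - of_real E) < e" "y \<in> Delta \<mu> j" for z y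
  proof -
    have "dist E y = cmod (of_real E - of_real y)" by (simp add: dist_real_def flip: of_real_diff)
    also have "\<dots> \<le> cmod (of_real E - z) + cmod (z - of_real y)"
      using norm_triangle_ineq[of "of_real E - z" "z - of_real y"] by simp
    finally show ?thesis using d(2)[OF that(2)] that(1) e(3) by (simp add: norm_minus_commute)
  qed
  obtain c where c: "c \<noteq> 0" "\<And>z. z \<notin> D \<Longrightarrow> L (vector [1, 1]) z = of_real c * (L (axis 1 1) z - L (axis 2 1) z)"
    using L_11 by blast
  \<comment> \<open>The sign accounts for the orientation of the difference in \<open>L_11\<close>,
    so that both choices of \<open>k\<close> lead to the same equation.\<close>
  define c' where "c' = (if k = 1 then - c else c)"
  define a where "a = \<kappa> $ j"
  have a: "a + \<kappa> $ k = 1" using \<kappa> j exhaust_2[of j] exhaust_2[of k] by (auto simp: a_def)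
  define U where "U = {z. Im z \<noteq> 0 \<and> cmod (z - of_real E) < e}"
  define H where "H = (\<lambda>z. of_real (mk / mj) * stieltjes (\<mu> j) z)"
  have eq: "stieltjes (\<mu> k) z * (of_real c' - of_real a * u Root z Root) = H z * (of_real (\<kappa> $ k) * u Root z Root + of_real c')"
    if z: "z \<in> U" for z
  proof -
    have zi: "Im z \<noteq> 0" using z by (simp add: U_def)
    then have zK: "z \<notin> complex_of_real ` K" by auto
    note zD = not_in_K[OF zK]
    define X where "X = L (axis k 1) z"
    define Y where "Y = L (axis j 1) z"
    have "u Root z Root * L\<kappa> z = - L (vector [1, 1]) z" unfolding u_root using zD(2) by simp
    also have "\<dots> = of_real c' * (X - Y)"
      unfolding c(2)[OF zD(1)] X_def Y_def c'_def using j exhaust_2[of j] exhaust_2[of k] by (auto simp: algebra_simps)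
    also have "L\<kappa> z = of_real a * X + of_real (\<kappa> $ k) * Y"
      unfolding L\<kappa>_eq X_def Y_def a_def using j exhaust_2[of j] exhaust_2[of k] by (auto simp: add.commute)
    finally have main: "X * (of_real c' - of_real a * u Root z Root) = Y * (of_real (\<kappa> $ k) * u Root z Root + of_real c')"
      by (simp add: algebra_simps)
    have X: "stieltjes (\<mu> k) z = of_real mk * X" and Y: "H z = of_real mk * Y"
      using m by (auto simp: X_def Y_def L_axis mk_def mj_def H_def)
    show ?thesis unfolding X Y mult.assoc main ..
  qed
  obtain l r where lr: "Delta \<mu> k = {l..r}" using Delta_interval by blast
  have "l < r"
  proof (rule ccontr)
    assume "\<not> l < r"
    then have "{l..r} \<subseteq> {l}" by auto
    then have "finite (measure_supp (\<mu> k))" unfolding supp lr using finite_subset by blast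
    then show False using M.infinite_supp by blast
  qed
  \<comment> \<open>Full support makes a nondegenerate interval around or beside \<open>E\<close>
    available, also when \<open>E\<close> is an endpoint.\<close>
  have unc: "uncountable (measure_supp (\<mu> k) \<inter> {E - e<..<E + e})"
  proof -
    have "max l (E - e / 2) < min r (E + e / 2)" using E e \<open>l < r\<close> by (auto simp: lr)
    then have "uncountable {max l (E - e / 2)..min r (E + e / 2)}" by (simp add: uncountable_closed_interval)
    moreover have "{max l (E - e / 2)..min r (E + e / 2)} \<subseteq> measure_supp (\<mu> k) \<inter> {E - e<..<E + e}"
      unfolding supp lr using e by auto
    ultimately show ?thesis using countable_subset by blast
  qed
  define B where "B = \<bar>mk / mj\<bar> * (measure (\<mu> j) UNIV / (d / 2)\<^sup>2)"
  have B: "B \<ge> 0" by (simp add: B_def)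
  have far': "d / 2 \<le> cmod (z - of_real y)" if "cmod (z - of_real E) < e" "y \<in> measure_supp (\<mu> j)" for z y
    using far[OF that(1)] that(2) supp_subset_Delta by blast
  show False
  proof (rule M.mobius_not_lipschitz[OF unc _ _ _ U_def _ _ _ a _ eq])
    show "max C B \<ge> 0" using B by auto
    show "c' \<noteq> 0" using c(1) by (auto simp: c'_def)
    fix z v assume zv: "z \<in> U" "v \<in> U"
    then have "cmod (u Root z Root - u Root v Root) \<le> C * cmod (z - v)"
      using e by (intro lip) (auto simp: U_def)
    also have "\<dots> \<le> max C B * cmod (z - v)" by (intro mult_right_mono) auto
    finally show "cmod (u Root z Root - u Root v Root) \<le> max C B * cmod (z - v)" .
  next
    fix z show "u Root (cnj z) Root = cnj (u Root z Root)" unfolding u_root L\<kappa>_eq L_cnj by simp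
  next
    fix z v assume zv: "cmod (z - of_real E) < e" "cmod (v - of_real E) < e"
    have "cmod (stieltjes (\<mu> j) z - stieltjes (\<mu> j) v) \<le> (measure (\<mu> j) UNIV / (d / 2)\<^sup>2) * cmod (z - v)"
      by (rule M.stieltjes_lipschitz) (use d far' zv in auto)
    from mult_left_mono[OF this, of "\<bar>mk / mj\<bar>"]
    have "cmod (H z - H v) \<le> B * cmod (z - v)"
      unfolding H_def B_def right_diff_distrib[symmetric] norm_mult norm_of_real by simp
    also have "\<dots> \<le> max C B * cmod (z - v)" by (intro mult_right_mono) auto
    finally show "cmod (H z - H v) \<le> max C B * cmod (z - v)" .
  next
    fix z show "H (cnj z) = cnj (H z)"
      unfolding H_def stieltjes_eq_ptransform M.ptransform_cnj by simp
  next
    fix x assume x: "\<bar>x - E\<bar> < e"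
    have xj: "x \<notin> Delta \<mu> j"
    proof
      assume "x \<in> Delta \<mu> j"
      from far[OF _ this, of "of_real x"] x d show False by (simp flip: of_real_diff)
    qed
    obtain l' r' where lr': "Delta \<mu> j = {l'..r'}" using Delta_interval by blast
    then have "x < l' \<or> x > r'" using xj Delta_nonempty[of j] by auto
    then have "\<exists>t::real. \<forall>y\<in>Delta \<mu> j. t * (x - y) > 0"
      by (elim disjE) (auto simp: lr' intro: exI[of _ "-1"] exI[of _ 1])
    then obtain t :: real where "\<And>y. y \<in> Delta \<mu> j \<Longrightarrow> t * (x - y) > 0" by blast
    then have "stieltjes (\<mu> j) (of_real x) \<noteq> 0"
      using supp_subset_Delta[of j] by (intro M.stieltjes_real_nonzero[of j t]) auto
    then show "H (of_real x) \<noteq> 0" using m by (simp add: H_def)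
  qed
qed

end

theorem theorem3p5p1:
  fixes \<mu> :: "2 \<Rightarrow> real measure" and \<kappa> :: "real^2"
  assumes "angelesco \<mu>"
    and "\<kappa> $ 1 + \<kappa> $ 2 = 1"
  shows "ell2_spectrum (jacobi \<mu> \<kappa>)
           \<subseteq> complex_of_real ` (Delta \<mu> 1 \<union> Delta \<mu> 2 \<union> E_set \<mu> (vector [\<kappa> $ 2, \<kappa> $ 1]))
       \<and> ((\<forall>k. measure_supp (\<mu> k) = Delta \<mu> k) \<longrightarrow>
          ell2_spectrum (jacobi \<mu> \<kappa>)
           = complex_of_real ` (Delta \<mu> 1 \<union> Delta \<mu> 2 \<union> E_set \<mu> (vector [\<kappa> $ 2, \<kappa> $ 1])))"
proof -
  interpret angelesco_tree \<mu> \<kappa>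
    by unfold_locales (use assms in auto)
  have sub: "ell2_spectrum (jacobi \<mu> \<kappa>) \<subseteq> complex_of_real ` K" by (rule J.spectrum_subset)
  moreover have "complex_of_real ` K \<subseteq> ell2_spectrum (jacobi \<mu> \<kappa>)" if "\<forall>k. measure_supp (\<mu> k) = Delta \<mu> k"
    using that Delta_in_spectrum[of 1] Delta_in_spectrum[of 2] E_set_in_spectrum by (auto simp: K_def)
  ultimately show ?thesis unfolding K_def by blast
qed

end
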